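(* Let $P\subseteq \mathrm{GL}(n,\mathbb{F}_q)$ be the standard parabolic subgroup of type $(n_1,\dots,n_s)$ with all block orders $n_k\le 2$. Then: 1) an arbitrary element $g\in P$ is equivalent to some element $g_{D,\rho}$ constructed from a pair $(D,\rho)\in\mathcal{B}$; 2) the element $g_{D,\rho}$ is uniquely determined by $g$; 3) the group $P$ decomposes into (is the disjoint union of) the subsets $K_{D,\rho}=K(g_{D,\rho})$, $(D,\rho)\in\mathcal{B}$.
   Context: **Parabolic subgroup.** $\mathbb{F}_q$ is a finite field, $n=n_1+\dots+n_s$, and $I=\{1,\dots,n\}$ is divided into consecutive segments $I_1,\dots,I_s$ of sizes $n_1,\dots,n_s$. The standard parabolic subgroup of type $(n_1,\dots,n_s)$ is the group $P$ of invertible block upper triangular matrices with diagonal blocks of sizes $n_1,\dots,n_s$. $P=RN$, where $R=R_1\times\dots\times R_s$, $R_k=\mathrm{GL}(n_k,\mathbb{F}_q)$, is the block-diagonal subgroup and $N=1+J$, with $J$ the algebra of strictly block upper triangular matrices. Put $\Delta_J=\bigcup_{1\le k<\ell\le s} I_k\times I_\ell$; its elements are called roots, and $\{E_\alpha:\alpha\in\Delta_J\}$ (matrix units) is a basis of $J$. The Weyl group $W_R=S_{I_1}\times\dots\times S_{I_s}$ of $R$ acts on $\Delta_J$ by $w(i,j)=(w(i),w(j))$. **Rook placements.** A rook placement is a subset $D\subseteq\Delta_J$ with at most one root in each row and at most one root in each column (the root $(i,j)$ lies in row $i$ and column $j$). Put $x_D=\sum_{\alpha\in D}E_\alpha\in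 J$. Fix a set of representatives of the $W_R$-orbits on rook placements in $\Delta_J$. **Equivalence classes.** Elements $g,g'\in P$ are equivalent if $g'=1+ra(g-1)br^{-1}$ for some $r\in R$, $a,b\in N$; $K(g)$ is the equivalence class of $g$. **The set $\mathcal{B}$.** Let $Cl_2$ be a set of representatives of the conjugacy classes of $\mathrm{GL}(2,\mathbb{F}_q)$ containing the matrices $\begin{pmatrix}a&0\\0&1\end{pmatrix}$, $a\neq0$, and $\begin{pmatrix}1&1\\0&1\end{pmatrix}$. Let $\sigma=\begin{pmatrix}0&1\\1&0\end{pmatrix}$. $\mathcal{B}$ is the set of pairs $(D,\rho)$ where $D$ is one of the fixed representatives and $\rho=(\rho_1,\dots,\rho_s)\in R$ is such that each block $\rho_*$ satisfies the applicable condition below (the block-row and block-column of $\rho_*$ are the rows and columns with indices in the corresponding segment; $a$ denotes an arbitrary element of $\mathbb{F}_q^*$). (1) Block of order 1 with segment $\{i\}$: (1a) if there are no roots of $D$ in row $i$ and in column $i$, $\rho_*$ is an arbitrary element of $\mathbb{F}_q^*$; (1b) if there is a root of $D$ in row $i$ or in column $i$, $\rho_*=1$. (2) Block of order 2 with segment $\{i,i+1\}$: (2a) if there are no roots of $D$ in the block-row and block-column of $\rho_*$, then $\rho_*$ is an arbitrary element of $Cl_2$; (2b) if there is a root of $D$ in row $i+1$ and none in row $i$ and none in the block-column, then $\rho_*=\begin{pmatrix}a&0\\0&1\end{pmatrix}$ or $\rho_*=\begin{pmatrix}1&1\\0&1\end{pmatrix}$; (2c) if there is a root of $D$ in column $i$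 and none in column $i+1$ and none in the block-row, then $\rho_*=\begin{pmatrix}1&0\\0&a\end{pmatrix}$ or $\rho_*=\begin{pmatrix}1&1\\0&1\end{pmatrix}$; (2d) if row $i+1$ and column $i+1$ contain roots of $D$ (and (2f) does not apply), then $\rho_*=\begin{pmatrix}a&0\\0&1\end{pmatrix}$; (2e) if row $i+1$ and column $i$ contain roots of $D$ (and (2f) does not apply), then $\rho_*=\begin{pmatrix}1&1\\0&1\end{pmatrix}$ or $\rho_*=\begin{pmatrix}1&0\\0&1\end{pmatrix}$; (2f) if there are two roots of $D$ in the block-row or two roots of $D$ in the block-column, then $\rho_*$ is the identity matrix. In (2b)–(2e), if the roles of $i$ and $i+1$ are interchanged in the hypothesis, then the listed matrices $\rho_*$ are replaced by $\sigma\rho_*\sigma^{-1}$. For $(D,\rho)\in\mathcal{B}$ put $g_{D,\rho}=\rho+x_D\in P$. *)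

theory Defs
  imports
    "Jordan_Normal_Form.Matrix"
    "HOL-Combinatorics.Permutations"
    "HOL-Library.Disjoint_Sets"
begin

text \<open>
  The type of the parabolic subgroup is the list \<open>ns\<close> of block orders. Rows, columns and
  blocks are numbered from 0, so \<open>I = {0..<n}\<close> with \<open>n = sum_list ns\<close>.
\<close>

definition offset :: "nat list \<Rightarrow> nat \<Rightarrow> nat" where
  "offset ns k = sum_list (take k ns)"

definition segment :: "nat list \<Rightarrow> nat \<Rightarrow> nat set" where
  "segment ns k = {offset ns k ..< offset ns (Suc k)}"

definition roots :: "nat list \<Rightarrow> (nat \<times> nat) set" where
  "roots ns = (\<Union>l < length ns. \<Union>k < l. segment ns k \<times> segment ns l)"

definition diag_positions :: "nat list \<Rightarrow> (nat \<times> nat) set" where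
  "diag_positions ns = (\<Union>k < length ns. segment ns k \<times> segment ns k)"

definition supported_on :: "'a :: zero mat \<Rightarrow> (nat \<times> nat) set \<Rightarrow> bool" where
  "supported_on A S \<longleftrightarrow>
    (\<forall>i < dim_row A. \<forall>j < dim_col A. A $$ (i, j) \<noteq> 0 \<longrightarrow> (i, j) \<in> S)"

definition GL :: "nat \<Rightarrow> 'a :: field mat set" where
  "GL m = {A \<in> carrier_mat m m. invertible_mat A}"

definition parabolic :: "nat list \<Rightarrow> 'a :: field mat set" where
  "parabolic ns = {A \<in> GL (sum_list ns). supported_on A (diag_positions ns \<union> roots ns)}"

text \<open>An invertible block-diagonal matrix is the same thing as a tuple of invertible blocks.\<close>

definition levi :: "nat list \<Rightarrow> 'a :: field mat set" where
  "levi ns = {A \<in> GL (sum_list ns). supported_on A (diag_positions ns)}"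

definition nil_algebra :: "nat list \<Rightarrow> 'a :: field mat set" where
  "nil_algebra ns = {A \<in> carrier_mat (sum_list ns) (sum_list ns). supported_on A (roots ns)}"

definition unip_radical :: "nat list \<Rightarrow> 'a :: field mat set" where
  "unip_radical ns = {1\<^sub>m (sum_list ns) + x | x. x \<in> nil_algebra ns}"

definition diag_block :: "nat list \<Rightarrow> 'a mat \<Rightarrow> nat \<Rightarrow> 'a mat" where
  "diag_block ns A k =
    mat (ns ! k) (ns ! k) (\<lambda>(i, j). A $$ (offset ns k + i, offset ns k + j))"

definition weyl :: "nat list \<Rightarrow> (nat \<Rightarrow> nat) set" where
  "weyl ns = {w. w permutes {0 ..< sum_list ns} \<and>
    (\<forall>k < length ns. w ` segment ns k = segment ns k)}"

definition rook_placement :: "nat list \<Rightarrow> (nat \<times> nat) set \<Rightarrow> bool" where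
  "rook_placement ns D \<longleftrightarrow> D \<subseteq> roots ns \<and>
    (\<forall>i. \<exists>\<^sub>\<le>\<^sub>1 j. (i, j) \<in> D) \<and> (\<forall>j. \<exists>\<^sub>\<le>\<^sub>1 i. (i, j) \<in> D)"

definition weyl_equiv :: "nat list \<Rightarrow> (nat \<times> nat) set \<Rightarrow> (nat \<times> nat) set \<Rightarrow> bool" where
  "weyl_equiv ns D D' \<longleftrightarrow> (\<exists>w \<in> weyl ns. D' = map_prod w w ` D)"

text \<open>\<open>T\<close> contains exactly one element of each class of the equivalence relation \<open>E\<close> on \<open>A\<close>.\<close>

definition representatives :: "'b set \<Rightarrow> ('b \<Rightarrow> 'b \<Rightarrow> bool) \<Rightarrow> 'b set \<Rightarrow> bool" where
  "representatives A E T \<longleftrightarrow> T \<subseteq> A \<and> (\<forall>x \<in> A. \<exists>!t. t \<in> T \<and> E x t)"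

definition rook_mat :: "nat list \<Rightarrow> (nat \<times> nat) set \<Rightarrow> 'a :: field mat" where
  "rook_mat ns D =
    mat (sum_list ns) (sum_list ns) (\<lambda>(i, j). if (i, j) \<in> D then 1 else 0)"

definition par_equiv :: "nat list \<Rightarrow> 'a :: field mat \<Rightarrow> 'a mat \<Rightarrow> bool" where
  "par_equiv ns g g' \<longleftrightarrow> g \<in> parabolic ns \<and> g' \<in> parabolic ns \<and>
    (\<exists>r \<in> levi ns. \<exists>r' \<in> levi ns. \<exists>a \<in> unip_radical ns. \<exists>b \<in> unip_radical ns.
       inverts_mat r r' \<and> inverts_mat r' r \<and>
       g' = 1\<^sub>m (sum_list ns) + r * a * (g - 1\<^sub>m (sum_list ns)) * b * r')"

definition par_class :: "nat list \<Rightarrow> 'a :: field mat \<Rightarrow> 'a mat set" where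
  "par_class ns g = {g'. par_equiv ns g g'}"

definition mat2 :: "'a \<Rightarrow> 'a \<Rightarrow> 'a \<Rightarrow> 'a \<Rightarrow> 'a mat" where
  "mat2 a b c d = mat_of_rows_list 2 [[a, b], [c, d]]"

definition conj_sigma :: "'a :: field mat \<Rightarrow> 'a mat" where
  \<comment> \<open>\<open>\<sigma>\<close> is its own inverse\<close>
  "conj_sigma A = mat2 0 1 1 0 * A * mat2 0 1 1 0"

definition is_Cl2 :: "'a :: field mat set \<Rightarrow> bool" where
  "is_Cl2 C \<longleftrightarrow> representatives (GL 2) similar_mat C \<and>
    (\<forall>a. a \<noteq> 0 \<longrightarrow> mat2 a 0 0 1 \<in> C) \<and> mat2 1 1 0 1 \<in> C"

definition row_root :: "(nat \<times> nat) set \<Rightarrow> nat \<Rightarrow> bool" where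
  "row_root D i \<longleftrightarrow> (\<exists>j. (i, j) \<in> D)"

definition col_root :: "(nat \<times> nat) set \<Rightarrow> nat \<Rightarrow> bool" where
  "col_root D j \<longleftrightarrow> (\<exists>i. (i, j) \<in> D)"

definition block1_ok :: "(nat \<times> nat) set \<Rightarrow> nat \<Rightarrow> 'a :: field mat \<Rightarrow> bool" where
  "block1_ok D i B \<longleftrightarrow>
    (\<not> row_root D i \<and> \<not> col_root D i \<longrightarrow> B \<in> GL 1) \<and>
    (row_root D i \<or> col_root D i \<longrightarrow> B = 1\<^sub>m 1)"

definition two_roots :: "(nat \<times> nat) set \<Rightarrow> nat \<Rightarrow> nat \<Rightarrow> bool" where
  "two_roots D i j \<longleftrightarrow> (row_root D i \<and> row_root D j) \<or> (col_root D i \<and> col_root D j)"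

text \<open>
  The conditions on a block of order 2 whose hypotheses are not symmetric in the two indices
  \<open>i\<close>, \<open>j\<close> of its segment; \<open>c\<close> is the modification applied to the listed matrices: the identity
  if \<open>j = i + 1\<close>, and conjugation by \<open>\<sigma>\<close> if the roles of the indices are interchanged.
\<close>

definition block2_asym ::
  "(nat \<times> nat) set \<Rightarrow> nat \<Rightarrow> nat \<Rightarrow> ('a :: field mat \<Rightarrow> 'a mat) \<Rightarrow> 'a mat \<Rightarrow> bool" where
  "block2_asym D i j c B \<longleftrightarrow>
    (row_root D j \<and> \<not> row_root D i \<and> \<not> col_root D i \<and> \<not> col_root D j \<longrightarrow>
       B \<in> c ` ({mat2 a 0 0 1 | a. a \<noteq> 0} \<union> {mat2 1 1 0 1})) \<and>
    (col_root D i \<and> \<not> col_root D j \<and> \<not> row_root D i \<and> \<not> row_root D j \<longrightarrow>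
       B \<in> c ` ({mat2 1 0 0 a | a. a \<noteq> 0} \<union> {mat2 1 1 0 1})) \<and>
    (row_root D j \<and> col_root D j \<and> \<not> two_roots D i j \<longrightarrow>
       B \<in> c ` {mat2 a 0 0 1 | a. a \<noteq> 0}) \<and>
    (row_root D j \<and> col_root D i \<and> \<not> two_roots D i j \<longrightarrow>
       B \<in> c ` {mat2 1 1 0 1, mat2 1 0 0 1})"

definition block2_ok ::
  "'a :: field mat set \<Rightarrow> (nat \<times> nat) set \<Rightarrow> nat \<Rightarrow> 'a mat \<Rightarrow> bool" where
  "block2_ok C D i B \<longleftrightarrow>
    (\<not> row_root D i \<and> \<not> row_root D (i + 1) \<and> \<not> col_root D i \<and> \<not> col_root D (i + 1) \<longrightarrow>
       B \<in> C) \<and>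
    block2_asym D i (i + 1) (\<lambda>A. A) B \<and>
    block2_asym D (i + 1) i conj_sigma B \<and>
    (two_roots D i (i + 1) \<longrightarrow> B = 1\<^sub>m 2)"

text \<open>
  \<open>Ds\<close> is the fixed set of representatives of orbits of rook placements, \<open>C\<close> the set \<open>Cl\<^sub>2\<close>.
\<close>

definition BB ::
  "nat list \<Rightarrow> (nat \<times> nat) set set \<Rightarrow> 'a :: field mat set \<Rightarrow> ((nat \<times> nat) set \<times> 'a mat) set"
where
  "BB ns Ds C = {(D, \<rho>). D \<in> Ds \<and> \<rho> \<in> levi ns \<and>
    (\<forall>k < length ns.
       (ns ! k = 1 \<longrightarrow> block1_ok D (offset ns k) (diag_block ns \<rho> k)) \<and>
       (ns ! k = 2 \<longrightarrow> block2_ok C D (offset ns k) (diag_block ns \<rho> k)))}"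

definition g_elem :: "nat list \<Rightarrow> (nat \<times> nat) set \<Rightarrow> 'a :: field mat \<Rightarrow> 'a mat" where
  "g_elem ns D \<rho> = \<rho> + rook_mat ns D"

end

theory Submission
  imports Defs
begin

text \<open>
  Put \<open>h = g - 1\<close>. Then \<open>g\<close> and \<open>g'\<close> are equivalent iff \<open>p * h = h' * q\<close> for some \<open>p\<close>, \<open>q\<close> in \<open>P\<close> with the
  same diagonal blocks.

  Existence: conjugate the diagonal blocks of \<open>g\<close> into \<open>Cl\<^sub>2\<close>, so that the diagonal part \<open>d\<close> of \<open>h\<close> has
  in each block at most one nonzero entry or is invertible there. Row and column operations clear the
  pivot rows and columns of \<open>d\<close>. The remaining strictly upper part is made monomial column by column:
  of two nonzero entries in one column one can be cancelled against the other. If their rows lie in the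
  same block, the cancellation also acts on columns already treated; the damage is repaired along the
  chains of entries below, which works for at least one of the two directions. A torus element and a
  Weyl group element then give \<open>g\<^bsub>D,\<rho>\<^esub>\<close>.

  Uniqueness: following the roots of \<open>D\<close> downwards from an index gives a word recording the blocks that are
  visited and how the chain ends. For a normal form, the indices of a block whose word is at most \<open>w\<close>
  span a subquotient of the flag of column vectors that is defined by \<open>h\<close> alone and is transported by
  \<open>q\<close>. Counting its vectors shows that the number of indices with a given block and word is an
  invariant, and these numbers determine \<open>D\<close> up to the Weyl group. Finally \<open>\<rho>\<close> is recovered from
  the conjugacy classes of its blocks.
\<close>

section \<open>The ring of column-finite matrices\<close>

text \<open>The two factors in \<open>p * h = h' * q\<close> share their diagonal blocks and are
  otherwise independent. A row operation between different blocks can thus be used alone, whereas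
  one inside a block brings the same column operation with it. This coupling is the obstacle. If a
  multiple of row \<open>a\<close> is added to row \<open>a'\<close> of the same block, column
  \<open>a\<close> is spoiled by column \<open>a'\<close>; the repair is a row operation between the
  rows of the two entries in these columns, one entry further down the chains. Of two chains
  followed in parallel, either one ends at some point, and adding to its row spoils nothing, or they
  enter different blocks, where in one direction the repair is strictly block upper. Words are
  compared in the same way, entry by entry. This makes them linearly ordered, and the span of the
  words at most \<open>w\<close> is described by how far \<open>h\<close> pushes a vector down the
  flag. Order at most 2 matters twice: a representative with eigenvalue 1 differs from the identity
  in at most one entry, and two free rows of a block leave no pivot in it. Finiteness of the field
  lets cardinalities replace dimensions.\<close>

text \<open>
  Square matrices of order \<open>n\<close> are embedded in the unital ring of infinite column-finite matrices, which
  makes carrier conditions unnecessary.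
\<close>

typedef (overloaded) 'a cfm = "{f :: nat \<Rightarrow> nat \<Rightarrow> 'a :: zero. \<forall>j. finite {i. f i j \<noteq> 0}}"
  morphisms ent Cfm
  by (rule exI[of _ "\<lambda>i j. 0"]) simp

lemma ent_Cfm: "(\<And>j. finite {i. f i j \<noteq> 0}) \<Longrightarrow> ent (Cfm f) = f"
  by (simp add: Cfm_inverse)

lemma finite_ent [simp]: "finite {i. ent A i j \<noteq> 0}"
  using ent[of A] by simp

lemma cfm_eqI: "(\<And>i j. ent A i j = ent B i j) \<Longrightarrow> A = B"
  by (metis ent_inject ext)

instantiation cfm :: (ring_1) ring_1
begin

definition zero_cfm :: "'a cfm" where "zero_cfm = Cfm (\<lambda>i j. 0)"
definition one_cfm :: "'a cfm" where "one_cfm = Cfm (\<lambda>i j. if i = j then 1 else 0)"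
definition plus_cfm :: "'a cfm \<Rightarrow> 'a cfm \<Rightarrow> 'a cfm" where
  "plus_cfm A B = Cfm (\<lambda>i j. ent A i j + ent B i j)"
definition minus_cfm :: "'a cfm \<Rightarrow> 'a cfm \<Rightarrow> 'a cfm" where
  "minus_cfm A B = Cfm (\<lambda>i j. ent A i j - ent B i j)"
definition uminus_cfm :: "'a cfm \<Rightarrow> 'a cfm" where
  "uminus_cfm A = Cfm (\<lambda>i j. - ent A i j)"
definition times_cfm :: "'a cfm \<Rightarrow> 'a cfm \<Rightarrow> 'a cfm" where
  "times_cfm A B = Cfm (\<lambda>i j. \<Sum>k | ent B k j \<noteq> 0. ent A i k * ent B k j)"

lemma ent_zero [simp]: "ent 0 i j = 0"
  by (simp add: zero_cfm_def ent_Cfm)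

lemma ent_one: "ent 1 i j = (if i = j then 1 else 0)"
  unfolding one_cfm_def by (subst ent_Cfm) auto

lemma ent_add [simp]: "ent (A + B) i j = ent A i j + ent B i j"
  unfolding plus_cfm_def
proof (subst ent_Cfm)
  fix j
  have "{i. ent A i j + ent B i j \<noteq> 0} \<subseteq> {i. ent A i j \<noteq> 0} \<union> {i. ent B i j \<noteq> 0}" by auto
  then show "finite {i. ent A i j + ent B i j \<noteq> 0}" by (rule finite_subset) simp
qed simp

lemma ent_minus [simp]: "ent (A - B) i j = ent A i j - ent B i j"
  unfolding minus_cfm_def
proof (subst ent_Cfm)
  fix j
  have "{i. ent A i j - ent B i j \<noteq> 0} \<subseteq> {i. ent A i j \<noteq> 0} \<union> {i. ent B i j \<noteq> 0}" by auto
  then show "finite {i. ent A i j - ent B i j \<noteq> 0}" by (rule finite_subset) simp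
qed simp

lemma ent_uminus [simp]: "ent (- A) i j = - ent A i j"
  unfolding uminus_cfm_def by (subst ent_Cfm) auto

lemma ent_times: "ent (A * B) i j = (\<Sum>k | ent B k j \<noteq> 0. ent A i k * ent B k j)"
  unfolding times_cfm_def
proof (subst ent_Cfm)
  fix j
  have "{i. (\<Sum>k | ent B k j \<noteq> 0. ent A i k * ent B k j) \<noteq> 0}
    \<subseteq> (\<Union>k\<in>{k. ent B k j \<noteq> 0}. {i. ent A i k \<noteq> 0})"
  proof
    fix i assume "i \<in> {i. (\<Sum>k | ent B k j \<noteq> 0. ent A i k * ent B k j) \<noteq> 0}"
    then obtain k where "ent B k j \<noteq> 0" "ent A i k * ent B k j \<noteq> 0"
      by (blast elim: sum.not_neutral_contains_not_neutral)
    then show "i \<in> (\<Union>k\<in>{k. ent B k j \<noteq> 0}. {i. ent A i k \<noteq> 0})" by auto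
  qed
  then show "finite {i. (\<Sum>k | ent B k j \<noteq> 0. ent A i k * ent B k j) \<noteq> 0}"
    by (rule finite_subset) simp
qed simp

text \<open>The product is defined by a sum over the support of a column of the right factor, a
  range that changes with that factor. Any finite range containing the contributing indices gives
  the same value, so entries of different products can be compared over one common range.\<close>

lemma ent_times_sum:
  assumes "finite S" "\<And>k. ent B k j \<noteq> 0 \<Longrightarrow> ent A i k \<noteq> 0 \<Longrightarrow> k \<in> S"
  shows "ent (A * B) i j = (\<Sum>k\<in>S. ent A i k * ent B k j)"
proof -
  let ?T = "{k. ent B k j \<noteq> 0} \<union> S"
  have "ent (A * B) i j = (\<Sum>k\<in>?T. ent A i k * ent B k j)"
    unfolding ent_times by (rule sum.mono_neutral_left) (use assms in auto)
  also have "\<dots> = (\<Sum>k\<in>S. ent A i k * ent B k j)"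
    by (rule sum.mono_neutral_right) (use assms in \<open>auto, metis mult_zero_left\<close>)
  finally show ?thesis .
qed

instance
proof
  fix A B C :: "'a cfm"
  show "A * B * C = A * (B * C)"
  proof (rule cfm_eqI)
    fix i j
    let ?S = "{l. ent C l j \<noteq> 0}"
    \<comment> \<open>All middle indices that can contribute to column \<open>j\<close>; over this
      common finite range the two sums can be interchanged.\<close>
    let ?T = "\<Union>l\<in>?S. {k. ent B k l \<noteq> 0}"
    have T: "finite ?T" by simp
    have "ent (A * B * C) i j = (\<Sum>l\<in>?S. (\<Sum>k\<in>?T. ent A i k * ent B k l) * ent C l j)"
      unfolding ent_times[of "A * B" C]
      by (intro sum.cong refl arg_cong2[of _ _ _ _ "(*)"] ent_times_sum) auto
    also have "\<dots> = (\<Sum>k\<in>?T. ent A i k * (\<Sum>l\<in>?S. ent B k l * ent C l j))"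
      unfolding sum_distrib_left sum_distrib_right
      by (subst sum.swap) (simp add: mult.assoc)
    also have "\<dots> = (\<Sum>k\<in>?T. ent A i k * ent (B * C) k j)"
      by (simp add: ent_times[of B C])
    also have "\<dots> = ent (A * (B * C)) i j"
    proof (rule ent_times_sum[symmetric, OF T])
      fix k assume "ent (B * C) k j \<noteq> 0"
      then obtain l where "ent C l j \<noteq> 0" "ent B k l * ent C l j \<noteq> 0"
        unfolding ent_times by (blast elim: sum.not_neutral_contains_not_neutral)
      then show "k \<in> ?T" by auto
    qed
    finally show "ent (A * B * C) i j = ent (A * (B * C)) i j" .
  qed
  show "A + B + C = A + (B + C)" "A + B = B + A" "0 + A = A" "- A + A = 0" "A - B = A + - B"
    by (rule cfm_eqI; simp add: algebra_simps)+
  show "1 * A = A"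
  proof (rule cfm_eqI)
    fix i j
    show "ent (1 * A) i j = ent A i j"
      by (subst ent_times_sum[where S = "{i}"]) (auto simp: ent_one split: if_splits)
  qed
  show "A * 1 = A"
  proof (rule cfm_eqI)
    fix i j
    show "ent (A * 1) i j = ent A i j"
      by (subst ent_times_sum[where S = "{j}"]) (auto simp: ent_one split: if_splits)
  qed
  show "(A + B) * C = A * C + B * C"
    by (rule cfm_eqI) (simp add: ent_times[of _ C] algebra_simps sum.distrib)
  show "A * (B + C) = A * B + A * C"
  proof (rule cfm_eqI)
    fix i j
    let ?S = "{k. ent B k j \<noteq> 0} \<union> {k. ent C k j \<noteq> 0}"
    have S: "finite ?S" by simp
    show "ent (A * (B + C)) i j = ent (A * B + A * C) i j"
      by (simp add: ent_times_sum[OF S] algebra_simps sum.distrib)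
        (subst ent_times_sum[OF S], auto simp: algebra_simps sum.distrib)
  qed
  show "(0 :: 'a cfm) \<noteq> 1"
    by (metis ent_one ent_zero zero_neq_one)
qed

end

section \<open>Diagonal matrices, coordinate projections and matrix units\<close>

definition dg :: "(nat \<Rightarrow> 'a) \<Rightarrow> 'a :: ring_1 cfm" where
  "dg t = Cfm (\<lambda>i j. if i = j then t i else 0)"

abbreviation pr :: "nat set \<Rightarrow> 'a :: ring_1 cfm" where
  "pr S \<equiv> dg (\<lambda>i. if i \<in> S then 1 else 0)"

definition mu :: "nat \<Rightarrow> nat \<Rightarrow> 'a \<Rightarrow> 'a :: ring_1 cfm" where
  "mu a b c = Cfm (\<lambda>i j. if i = a \<and> j = b then c else 0)"

lemma ent_dg: "ent (dg t) i j = (if i = j then t i else 0)"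
  unfolding dg_def by (subst ent_Cfm) auto

lemma ent_mu: "ent (mu a b c) i j = (if i = a \<and> j = b then c else 0)"
  unfolding mu_def by (subst ent_Cfm) auto

lemma ent_dg_times [simp]: "ent (dg t * A) i j = t i * ent A i j"
  by (subst ent_times_sum[where S = "{i}"]) (auto simp: ent_dg split: if_splits)

lemma ent_times_dg [simp]: "ent (A * dg t) i j = ent A i j * t j"
  by (subst ent_times_sum[where S = "{j}"]) (auto simp: ent_dg split: if_splits)

lemma ent_mu_times: "ent (mu a b c * A) i j = (if i = a then c * ent A b j else 0)"
  by (subst ent_times_sum[where S = "{b}"]) (auto simp: ent_mu split: if_splits)

lemma ent_times_mu: "ent (A * mu a b c) i j = (if j = b then ent A i a * c else 0)"
  by (subst ent_times_sum[where S = "{a}"]) (auto simp: ent_mu split: if_splits)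

lemma ent_times_neq0:
  assumes "ent (A * B) i j \<noteq> 0"
  obtains k where "ent A i k \<noteq> 0" "ent B k j \<noteq> 0"
proof -
  obtain k where "ent B k j \<noteq> 0" "ent A i k * ent B k j \<noteq> 0"
    using assms unfolding ent_times by (blast elim: sum.not_neutral_contains_not_neutral)
  moreover from this have "ent A i k \<noteq> 0" by (metis mult_zero_left)
  ultimately show thesis using that by blast
qed

lemma pr_times_eqI: "(\<And>i j. ent A i j \<noteq> 0 \<Longrightarrow> i \<in> S) \<Longrightarrow> pr S * A = A"
  by (rule cfm_eqI) auto

lemma times_pr_eqI: "(\<And>i j. ent A i j \<noteq> 0 \<Longrightarrow> j \<in> S) \<Longrightarrow> A * pr S = A"
  by (rule cfm_eqI) auto

lemma one_eq_dg: "1 = dg (\<lambda>_. 1)"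
  by (rule cfm_eqI) (simp add: ent_one ent_dg)

lemma dg_times_dg: "dg s * dg t = dg (\<lambda>i. s i * t i)"
  by (rule cfm_eqI) (simp add: ent_dg)

section \<open>Block triangular matrices\<close>

text \<open>Blocks are the level sets of the monotone function \<open>blk\<close>. By
  \<open>blk_out\<close> every index from \<open>n\<close> on is a block of its own above all
  smaller indices. So infinite matrices such as 1 count as block triangular, and a block triangular
  matrix has no entry in a column below \<open>n\<close> and a row outside.\<close>

locale blocks =
  fixes n :: nat and blk :: "nat \<Rightarrow> nat"
  assumes blk_mono: "i \<le> j \<Longrightarrow> blk i \<le> blk j"
    and blk_out: "i < j \<Longrightarrow> n \<le> j \<Longrightarrow> blk i < blk j"
begin

definition UT :: "'a :: ring_1 cfm \<Rightarrow> bool" where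
  "UT A \<longleftrightarrow> (\<forall>i j. ent A i j \<noteq> 0 \<longrightarrow> blk i \<le> blk j)"

definition NIL :: "'a :: ring_1 cfm \<Rightarrow> bool" where
  "NIL A \<longleftrightarrow> (\<forall>i j. ent A i j \<noteq> 0 \<longrightarrow> blk i < blk j)"

definition INS :: "'a :: ring_1 cfm \<Rightarrow> bool" where
  "INS A \<longleftrightarrow> (\<forall>i j. ent A i j \<noteq> 0 \<longrightarrow> i < n \<and> j < n)"

definition dp :: "'a :: ring_1 cfm \<Rightarrow> 'a cfm" where
  "dp A = Cfm (\<lambda>i j. if blk i = blk j then ent A i j else 0)"

lemma blk_less_imp: "blk i < blk j \<Longrightarrow> i < j"
  by (metis blk_mono linorder_not_less)

lemma blk_eq_in: "blk i = blk j \<Longrightarrow> i \<noteq> j \<Longrightarrow> i < n \<and> j < n"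
  by (metis blk_out linorder_neqE_nat linorder_not_less nat_less_le)

lemma blk_le_in: "blk i \<le> blk j \<Longrightarrow> j < n \<Longrightarrow> i < n"
  by (metis blk_out linorder_not_less order_less_le_trans)

lemma ent_dp: "ent (dp A) i j = (if blk i = blk j then ent A i j else 0)"
  unfolding dp_def
proof (subst ent_Cfm)
  fix j
  have "{i. (if blk i = blk j then ent A i j else 0) \<noteq> 0} \<subseteq> {i. ent A i j \<noteq> 0}" by auto
  then show "finite {i. (if blk i = blk j then ent A i j else 0) \<noteq> 0}"
    by (rule finite_subset) simp
qed simp

lemma UT_D: "UT A \<Longrightarrow> ent A i j \<noteq> 0 \<Longrightarrow> blk i \<le> blk j" by (auto simp: UT_def)
lemma NIL_D: "NIL A \<Longrightarrow> ent A i j \<noteq> 0 \<Longrightarrow> blk i < blk j" by (auto simp: NIL_def)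
lemma INS_D: "INS A \<Longrightarrow> ent A i j \<noteq> 0 \<Longrightarrow> i < n \<and> j < n" by (auto simp: INS_def)

lemma UT_zero: "UT 0" by (simp add: UT_def)
lemma UT_one: "UT 1" by (simp add: UT_def ent_one)

lemma UT_dg: "UT (dg t)"
  by (auto simp: UT_def ent_dg split: if_splits)

lemma UT_add: "UT A \<Longrightarrow> UT B \<Longrightarrow> UT (A + B)"
  unfolding UT_def by (metis ent_add add_cancel_left_left)

lemma UT_minus: "UT A \<Longrightarrow> UT B \<Longrightarrow> UT (A - B)"
  unfolding UT_def by (metis ent_minus diff_0_right)

lemma UT_times: "UT A \<Longrightarrow> UT B \<Longrightarrow> UT (A * B)"
  unfolding UT_def by (metis ent_times_neq0 order_trans)

lemma UT_power: "UT A \<Longrightarrow> UT (A ^ k)"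
  by (induction k) (auto simp: UT_one UT_times)

lemma UT_sum: "(\<And>k. k \<in> S \<Longrightarrow> UT (f k)) \<Longrightarrow> UT (sum f S)"
  by (induction S rule: infinite_finite_induct) (auto simp: UT_add UT_zero)

lemma NIL_UT: "NIL A \<Longrightarrow> UT A"
  by (auto simp: UT_def NIL_def less_imp_le)

lemma NIL_zero: "NIL 0" by (simp add: NIL_def)

lemma NIL_add: "NIL A \<Longrightarrow> NIL B \<Longrightarrow> NIL (A + B)"
  unfolding NIL_def by (metis ent_add add_cancel_left_left)

lemma NIL_minus: "NIL A \<Longrightarrow> NIL B \<Longrightarrow> NIL (A - B)"
  unfolding NIL_def by (metis ent_minus diff_0_right)

lemma NIL_uminus: "NIL A \<Longrightarrow> NIL (- A)"
  unfolding NIL_def by simp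

lemma NIL_times_UT: "NIL A \<Longrightarrow> UT B \<Longrightarrow> NIL (A * B)"
  unfolding NIL_def UT_def by (metis ent_times_neq0 order_less_le_trans)

lemma UT_times_NIL: "UT A \<Longrightarrow> NIL B \<Longrightarrow> NIL (A * B)"
  unfolding NIL_def UT_def by (metis ent_times_neq0 order_le_less_trans)

lemma INS_add: "INS A \<Longrightarrow> INS B \<Longrightarrow> INS (A + B)"
  unfolding INS_def by (metis ent_add add_cancel_left_left)

lemma INS_minus: "INS A \<Longrightarrow> INS B \<Longrightarrow> INS (A - B)"
  unfolding INS_def by (metis ent_minus diff_0_right)

lemma INS_uminus: "INS A \<Longrightarrow> INS (- A)"
  unfolding INS_def by simp

lemma INS_times: "INS A \<Longrightarrow> INS B \<Longrightarrow> INS (A * B)"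
  unfolding INS_def by (metis ent_times_neq0)

lemma INS_UT_times: "UT A \<Longrightarrow> INS B \<Longrightarrow> INS (A * B)"
  unfolding INS_def UT_def by (metis ent_times_neq0 blk_le_in)

lemma INS_dp: "INS A \<Longrightarrow> INS (dp A)"
  unfolding INS_def by (simp add: ent_dp)

lemma UT_dp: "UT (dp A)"
  unfolding UT_def by (simp add: ent_dp)

lemma NIL_minus_dp: "UT A \<Longrightarrow> NIL (A - dp A)"
  unfolding NIL_def UT_def by (simp add: ent_dp le_neq_implies_less)

text \<open>If the two ends of a product of triangular entries lie in one block, the middle index is
  squeezed into that block. Hence \<open>dp\<close> is multiplicative on block triangular matrices,
  with \<open>NIL\<close> as the part that it kills.\<close>

lemma dp_times:
  assumes "UT A" "UT B"
  shows "dp (A * B) = dp A * dp B"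
proof (rule cfm_eqI)
  fix i j
  let ?S = "{k. ent B k j \<noteq> 0}"
  have "ent (dp A * dp B) i j = (\<Sum>k\<in>?S. ent (dp A) i k * ent (dp B) k j)"
    by (rule ent_times_sum) (auto simp: ent_dp split: if_splits)
  also have "\<dots> = ent (dp (A * B)) i j"
  proof (cases "blk i = blk j")
    case True
    have "ent (dp A) i k * ent (dp B) k j = ent A i k * ent B k j" if "k \<in> ?S" for k
    proof (cases "ent A i k = 0")
      case False
      then have "blk i \<le> blk k" "blk k \<le> blk j" using that assms by (auto simp: UT_def)
      then show ?thesis using True by (simp add: ent_dp)
    qed (simp add: ent_dp)
    then show ?thesis using True by (simp add: ent_dp ent_times)
  next
    case False
    then have "ent (dp A) i k * ent (dp B) k j = 0" for k by (simp add: ent_dp)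
    then show ?thesis using False by (simp add: ent_dp)
  qed
  finally show "ent (dp (A * B)) i j = ent (dp A * dp B) i j" by simp
qed

lemma dp_add: "dp (A + B) = dp A + dp B"
  by (rule cfm_eqI) (simp add: ent_dp)

lemma dp_minus: "dp (A - B) = dp A - dp B"
  by (rule cfm_eqI) (simp add: ent_dp)

lemma dp_one: "dp 1 = 1"
  by (rule cfm_eqI) (simp add: ent_dp ent_one)

lemma dp_NIL: "NIL A \<Longrightarrow> dp A = 0"
  by (rule cfm_eqI) (metis NIL_D ent_dp ent_zero less_irrefl)

lemma power_NIL:
  assumes "NIL x" "INS x" "ent (x ^ k) i j \<noteq> 0" "0 < k"
  shows "blk i + k \<le> blk j \<and> j < n"
  using assms(3,4)
proof (induction k arbitrary: i)
  case (Suc k)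
  obtain l where l: "ent x i l \<noteq> 0" "ent (x ^ k) l j \<noteq> 0"
    using Suc.prems(1) by (auto elim: ent_times_neq0)
  show ?case
  proof (cases "k = 0")
    case True
    then have "l = j" using l(2) by (auto simp: ent_one split: if_splits)
    then show ?thesis using NIL_D[OF assms(1) l(1)] INS_D[OF assms(2) l(1)] True by simp
  next
    case False
    then show ?thesis using Suc.IH[OF l(2)] NIL_D[OF assms(1) l(1)] by simp
  qed
qed simp

lemma geometric_sum_inverse:
  fixes x :: "'b :: ring_1"
  shows "(1 - x) * (\<Sum>k<K. x ^ k) = 1 - x ^ K" "(\<Sum>k<K. x ^ k) * (1 - x) = 1 - x ^ K"
proof (induction K)
  case (Suc K)
  show "(1 - x) * (\<Sum>k<Suc K. x ^ k) = 1 - x ^ Suc K"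
    using Suc(1) by (simp add: distrib_left left_diff_distrib)
  show "(\<Sum>k<Suc K. x ^ k) * (1 - x) = 1 - x ^ Suc K"
  proof -
    have "(\<Sum>k<Suc K. x ^ k) * (1 - x) = (\<Sum>k<K. x ^ k) * (1 - x) + (x ^ K - x ^ K * x)"
      by (simp add: distrib_right right_diff_distrib)
    then show ?thesis unfolding Suc(2) by (simp add: power_commutes)
  qed
qed simp_all

text \<open>Inversion by the geometric series in \<open>- x\<close>. It is finite because every
  factor \<open>x\<close> raises the block number, which is bounded on the indices below
  \<open>n\<close>.\<close>

lemma NIL_inverse:
  fixes x :: "'a :: ring_1 cfm"
  assumes "NIL x" "INS x"
  obtains z where "NIL z" "INS z" "(1 + x) * (1 + z) = 1" "(1 + z) * (1 + x) = 1"
proof -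
  \<comment> \<open>A power with exponent \<open>K\<close> would have to raise the block number by
    more than \<open>blk n\<close>, but \<open>blk j \<le> blk n\<close> for
    \<open>j < n\<close>.\<close>
  define K where "K = Suc (blk n)"
  define s where "s = (\<Sum>k<K. (- x) ^ k)"
  have nx: "NIL (- x)" "INS (- x)" using assms by (auto intro: NIL_uminus INS_uminus)
  have xK: "(- x) ^ K = 0"
  proof (rule cfm_eqI, rule ccontr)
    fix i j assume "ent ((- x) ^ K) i j \<noteq> ent 0 i j"
    then have "blk i + K \<le> blk j" "j < n" using power_NIL[OF nx, of K i j] by (auto simp: K_def)
    moreover have "blk j \<le> blk n" using \<open>j < n\<close> by (auto intro: blk_mono)
    ultimately show False by (simp add: K_def)
  qed
  have inv: "(1 + x) * s = 1" "s * (1 + x) = 1"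
    using geometric_sum_inverse[of "- x" K] xK by (simp_all add: s_def)
  have s: "s = 1 + - x * s" "s = 1 + s * - x"
    using inv by (simp_all add: algebra_simps)
  have UTs: "UT s" unfolding s_def by (intro UT_sum UT_power NIL_UT nx)
  show thesis
  proof (rule that[of "- x * s"])
    show "NIL (- x * s)" by (rule NIL_times_UT[OF nx(1) UTs])
    \<comment> \<open>Multiplication by a triangular matrix is known to preserve \<open>INS\<close>
      only from the left, so the factors are first interchanged.\<close>
    have "- x * s = s * - x" using s by (metis add_left_cancel)
    then show "INS (- x * s)" using INS_UT_times[OF UTs nx(2)] by simp
    show "(1 + x) * (1 + - x * s) = 1" "(1 + - x * s) * (1 + x) = 1"
      using inv s(1) by metis+
  qed
qed

section \<open>The equivalence relation on \<open>h\<close>\<close>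

definition unit_pair :: "'a :: ring_1 cfm \<Rightarrow> 'a cfm \<Rightarrow> bool" where
  "unit_pair p p' \<longleftrightarrow> UT p \<and> UT p' \<and> p * p' = 1 \<and> p' * p = 1"

text \<open>Setting \<open>p = r * a\<close> and \<open>q = r * b'\<close> with \<open>b'\<close>
  inverse to \<open>b\<close> turns \<open>h' = r * a * h * b * r'\<close> (\<open>r'\<close>
  inverse to \<open>r\<close>) into \<open>p * h = h' * q\<close>. The common Levi factor
  \<open>r\<close> survives only as \<open>NIL (p - q)\<close>, and no decomposition into Levi and
  unipotent parts is needed in calculations.\<close>

definition eqv :: "'a :: ring_1 cfm \<Rightarrow> 'a cfm \<Rightarrow> bool" where
  "eqv h h' \<longleftrightarrow> (\<exists>p p' q q'. unit_pair p p' \<and> unit_pair q q' \<and> NIL (p - q) \<and> p * h = h' * q)"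

lemma eqvI:
  "unit_pair p p' \<Longrightarrow> unit_pair q q' \<Longrightarrow> NIL (p - q) \<Longrightarrow> p * h = h' * q \<Longrightarrow> eqv h h'"
  unfolding eqv_def by blast

lemma unit_pair_sym: "unit_pair p p' \<Longrightarrow> unit_pair p' p"
  by (auto simp: unit_pair_def)

lemma unit_pair_one: "unit_pair 1 1"
  by (simp add: unit_pair_def UT_one)

lemma unit_pair_times:
  assumes "unit_pair p p'" "unit_pair q q'"
  shows "unit_pair (p * q) (q' * p')"
proof -
  have "p * q * (q' * p') = p * (q * q') * p'" "q' * p' * (p * q) = q' * (p' * p) * q"
    by (simp_all add: mult.assoc)
  then show ?thesis using assms by (auto simp: unit_pair_def UT_times)
qed

lemma NIL_unit_pair:
  assumes "NIL x" "INS x"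
  obtains z where "NIL z" "INS z" "unit_pair (1 + x) (1 + z)"
  by (rule NIL_inverse[OF assms]) (use assms that in \<open>auto simp: unit_pair_def intro: UT_add UT_one NIL_UT\<close>)

lemma square_zero_unit_pair:
  assumes "UT X" "X * X = 0"
  shows "unit_pair (1 + X) (1 - X)"
  using assms by (auto simp: unit_pair_def algebra_simps UT_add UT_minus UT_one)

text \<open>\<open>p' - q' = p' * (q - p) * q'\<close>, and \<open>NIL\<close> is an ideal of the
  block triangular matrices.\<close>

lemma NIL_diff_inverse:
  assumes "unit_pair p p'" "unit_pair q q'" "NIL (p - q)"
  shows "NIL (p' - q')"
proof -
  have "p' - q' = p' * (q * q') - p' * p * q'" using assms by (simp add: unit_pair_def)
  also have "\<dots> = p' * (- (p - q)) * q'" by (simp add: algebra_simps)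
  moreover have "NIL (p' * (- (p - q)))"
    using assms NIL_uminus by (auto simp: unit_pair_def simp del: minus_diff_eq intro: UT_times_NIL)
  ultimately show ?thesis
    using assms by (auto simp: unit_pair_def intro: NIL_times_UT)
qed

lemma eqv_refl: "eqv h h"
  by (rule eqvI[OF unit_pair_one unit_pair_one]) (auto simp: NIL_zero)

lemma eqv_sym:
  assumes "eqv h h'" shows "eqv h' h"
proof -
  obtain p p' q q' where *: "unit_pair p p'" "unit_pair q q'" "NIL (p - q)" "p * h = h' * q"
    using assms unfolding eqv_def by blast
  have "p' * h' = p' * (h' * q) * q'" using * by (simp add: mult.assoc unit_pair_def)
  also have "\<dots> = p' * p * h * q'" unfolding *(4)[symmetric] by (simp add: mult.assoc)
  also have "\<dots> = h * q'" using * by (simp add: unit_pair_def)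
  finally show ?thesis
    using * by (meson eqvI unit_pair_sym NIL_diff_inverse)
qed

lemma eqv_trans:
  assumes "eqv h h'" "eqv h' h''" shows "eqv h h''"
proof -
  obtain p p' q q' where *: "unit_pair p p'" "unit_pair q q'" "NIL (p - q)" "p * h = h' * q"
    using assms unfolding eqv_def by blast
  obtain r r' s s' where **: "unit_pair r r'" "unit_pair s s'" "NIL (r - s)" "r * h' = h'' * s"
    using assms unfolding eqv_def by blast
  show ?thesis
  proof (rule eqvI)
    show "unit_pair (r * p) (p' * r')" "unit_pair (s * q) (q' * s')"
      using * ** by (auto intro: unit_pair_times)
    have "r * p - s * q = r * (p - q) + (r - s) * q" by (simp add: algebra_simps)
    moreover have "NIL (r * (p - q))" using * ** by (auto simp: unit_pair_def intro: UT_times_NIL)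
    moreover have "NIL ((r - s) * q)" using * ** by (auto simp: unit_pair_def intro: NIL_times_UT)
    ultimately show "NIL (r * p - s * q)" by (simp add: NIL_add)
    show "r * p * h = h'' * (s * q)" using *(4) **(4) by (metis mult.assoc)
  qed
qed

lemma eqv_conj:
  assumes "unit_pair p p'"
  shows "eqv h (p * h * p')"
  by (rule eqvI[OF assms assms]) (use assms in \<open>auto simp: NIL_zero mult.assoc unit_pair_def\<close>)

end

section \<open>Reduction to monomial form\<close>

context blocks
begin

text \<open>
  With a generalized inverse \<open>G\<close> of the diagonal part \<open>d\<close>, the identity \<open>h * G * d = (1 + u * G) * d\<close>
  (\<open>u = h - d\<close>) shows that one row operation clears all pivot columns at once, and dually for rows.
\<close>

lemma clear_pivots:
  fixes h G d :: "'a :: ring_1 cfm"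
  assumes h: "UT h" "INS h" and d: "d = dp h" and G: "UT G" "INS G" "d * G * d = d"
  obtains u where "NIL u" "INS u" "eqv h (d + u)" "u * (G * d) = 0" "d * G * u = 0"
proof -
  define u where "u = h - d"
  have INSd: "INS d" using h d by (simp add: INS_dp)
  have u: "NIL u" "INS u" unfolding u_def using h INSd by (simp_all add: d NIL_minus_dp INS_minus)
  have "NIL (u * G)" "INS (u * G)" using u G by (auto intro: NIL_times_UT INS_times)
  then obtain z where z: "NIL z" "INS z" "unit_pair (1 + u * G) (1 + z)" by (rule NIL_unit_pair)
  define u1 where "u1 = (1 + z) * h - d"
  have "u1 = z * h + u" by (simp add: u1_def u_def algebra_simps)
  then have u1: "NIL u1" "INS u1" using z u h by (auto intro!: NIL_add NIL_times_UT INS_add INS_times)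
  have "h * (G * d) = (1 + u * G) * d"
  proof -
    have "h * (G * d) = d * G * d + u * G * d" by (simp add: u_def algebra_simps)
    then show ?thesis using G by (simp add: algebra_simps)
  qed
  then have "(1 + z) * h * (G * d) = (1 + z) * (1 + u * G) * d" by (simp add: mult.assoc)
  then have h1: "(1 + z) * h * (G * d) = d" using z by (simp add: unit_pair_def)
  have u1G: "u1 * (G * d) = 0"
    using h1 G by (simp add: u1_def left_diff_distrib mult.assoc)
  have "NIL (G * u1)" "INS (G * u1)" using u1 G by (auto intro: UT_times_NIL INS_times)
  then obtain y where y: "NIL y" "INS y" "unit_pair (1 + G * u1) (1 + y)" by (rule NIL_unit_pair)
  define h2 where "h2 = (d + u1) * (1 + y)"
  have h1': "(1 + z) * h = d + u1" by (simp add: u1_def)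
  have "d * G * (d + u1) = d * (1 + G * u1)" using G by (simp add: distrib_left mult.assoc)
  then have "d * G * h2 = d * ((1 + G * u1) * (1 + y))" by (simp add: h2_def flip: mult.assoc)
  then have L: "d * G * h2 = d" using y by (simp add: unit_pair_def)
  \<comment> \<open>Since \<open>u1\<close> annihilates \<open>G * d\<close>, the column operation
    \<open>1 + y\<close> fixes \<open>G * d\<close>; the pivot columns cleared by the row operation
    therefore stay clear.\<close>
  have "(1 + G * u1) * (G * d) = G * d" using u1G by (simp add: distrib_right mult.assoc)
  then have "(1 + y) * (G * d) = (1 + y) * (1 + G * u1) * (G * d)" by (simp add: mult.assoc)
  then have "(1 + y) * (G * d) = G * d" using y by (simp add: unit_pair_def)
  then have "h2 * (G * d) = (d + u1) * (G * d)" by (simp add: h2_def mult.assoc)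
  then have R: "h2 * (G * d) = d" using h1 h1' by simp
  have eqv: "eqv h h2"
  proof (rule eqvI[OF unit_pair_sym[OF z(3)] y(3)])
    show "NIL (1 + z - (1 + G * u1))" using z(1) \<open>NIL (G * u1)\<close> by (simp add: NIL_minus)
    show "(1 + z) * h = h2 * (1 + G * u1)"
      using y(3) by (simp add: h1' h2_def mult.assoc unit_pair_def)
  qed
  show thesis
  proof (rule that[of "h2 - d"])
    have "h2 - d = u1 + (d + u1) * y" by (simp add: h2_def algebra_simps)
    moreover have "UT (d + u1)" using u1 by (simp add: d UT_dp UT_add NIL_UT)
    moreover have "INS (d + u1)" using u1 INSd by (simp add: INS_add)
    ultimately show "NIL (h2 - d)" "INS (h2 - d)"
      using u1 y by (auto intro!: NIL_add UT_times_NIL INS_add INS_times)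
    show "eqv h (d + (h2 - d))" using eqv by simp
    show "(h2 - d) * (G * d) = 0" using R G by (simp add: left_diff_distrib mult.assoc)
    show "d * G * (h2 - d) = 0" using L G by (simp add: right_diff_distrib)
  qed
qed

end

text \<open>
  \<open>Zr\<close> and \<open>Zc\<close> are the pivot rows and pivot columns of the block-diagonal matrix \<open>d\<close>.
\<close>

locale pivots = blocks +
  fixes Zr Zc :: "nat set" and d :: "'a :: field cfm"
  assumes free_row: "blk a = blk a' \<Longrightarrow> a \<noteq> a' \<Longrightarrow> a \<notin> Zr \<Longrightarrow> a' \<notin> Zr \<Longrightarrow> a \<notin> Zc"
    and free_col: "blk a = blk a' \<Longrightarrow> a \<noteq> a' \<Longrightarrow> a \<notin> Zc \<Longrightarrow> a' \<notin> Zc \<Longrightarrow> a \<notin> Zr"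
    and d_pivots: "ent d i j \<noteq> 0 \<Longrightarrow> i \<in> Zr \<and> j \<in> Zc"
begin

section \<open>Coupled row and column operations away from the pivots\<close>

definition OFF :: "'a cfm \<Rightarrow> bool" where
  "OFF u \<longleftrightarrow> NIL u \<and> INS u \<and> (\<forall>i j. ent u i j \<noteq> 0 \<longrightarrow> i \<notin> Zr \<and> j \<notin> Zc)"

lemma OFF_D: "OFF u \<Longrightarrow> ent u i j \<noteq> 0 \<Longrightarrow> blk i < blk j \<and> i < j \<and> i < n \<and> j < n \<and> i \<notin> Zr \<and> j \<notin> Zc"
  unfolding OFF_def by (metis INS_D NIL_D blk_less_imp)

text \<open>\<open>1 + X\<close> acts on rows and \<open>1 - Y\<close> on columns. Vanishing squares
  make the inverses explicit, \<open>NIL (X - Y)\<close> is the coupling of the diagonal blocks, and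
  avoidance of the pivots gives \<open>X * d = 0\<close> and \<open>d * Y = 0\<close>, so that
  \<open>d\<close> is untouched.\<close>

definition op_pair :: "'a cfm \<Rightarrow> 'a cfm \<Rightarrow> bool" where
  "op_pair X Y \<longleftrightarrow> UT X \<and> UT Y \<and> INS X \<and> INS Y \<and> X * X = 0 \<and> Y * Y = 0 \<and> NIL (X - Y) \<and>
    (\<forall>i j. ent X i j \<noteq> 0 \<longrightarrow> i \<notin> Zr \<and> j \<notin> Zr) \<and> (\<forall>i j. ent Y i j \<noteq> 0 \<longrightarrow> i \<notin> Zc \<and> j \<notin> Zc)"

lemma op_pair_move:
  assumes "OFF u" "op_pair X Y"
  shows "eqv (d + u) (d + (1 + X) * u * (1 - Y))" "OFF ((1 + X) * u * (1 - Y))"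
proof -
  have XY: "UT X" "UT Y" "INS X" "INS Y" "X * X = 0" "Y * Y = 0" "NIL (X - Y)"
    "\<And>i j. ent X i j \<noteq> 0 \<Longrightarrow> i \<notin> Zr \<and> j \<notin> Zr" "\<And>i j. ent Y i j \<noteq> 0 \<Longrightarrow> i \<notin> Zc \<and> j \<notin> Zc"
    using assms(2) by (auto simp: op_pair_def)
  have u: "NIL u" "INS u" "\<And>i j. ent u i j \<noteq> 0 \<Longrightarrow> i \<notin> Zr \<and> j \<notin> Zc"
    using assms(1) by (auto simp: OFF_def)
  have Xd: "X * d = 0"
    by (rule cfm_eqI, rule ccontr) (metis XY(8) d_pivots ent_times_neq0 ent_zero)
  have dY: "d * Y = 0"
    by (rule cfm_eqI, rule ccontr) (metis XY(9) d_pivots ent_times_neq0 ent_zero)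
  let ?u = "(1 + X) * u * (1 - Y)"
  have "?u * (1 + Y) = (1 + X) * u * ((1 - Y) * (1 + Y))" by (simp add: mult.assoc)
  also have "(1 - Y) * (1 + Y) = 1" using XY by (simp add: algebra_simps)
  finally have "?u * (1 + Y) = (1 + X) * u" by simp
  then have "(1 + X) * (d + u) = (d + ?u) * (1 + Y)"
    using Xd dY by (simp add: distrib_left distrib_right)
  then show "eqv (d + u) (d + ?u)"
    using XY by (intro eqvI[OF square_zero_unit_pair square_zero_unit_pair]) auto
  have "?u = u + X * u - (u + X * u) * Y" by (simp add: algebra_simps)
  moreover have "NIL ?u" using u XY
    by (intro NIL_times_UT UT_times_NIL UT_add UT_minus UT_one)
  moreover have "INS (u + X * u - (u + X * u) * Y)" using u XY
    by (intro INS_minus INS_add INS_times)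
  moreover have "i \<notin> Zr \<and> j \<notin> Zc" if "ent (u + X * u - (u + X * u) * Y) i j \<noteq> 0" for i j
  proof -
    have w: "i \<notin> Zr \<and> j \<notin> Zc" if "ent (u + X * u) i j \<noteq> 0" for i j
      using that u(3) XY(8) by (metis add_cancel_left_left ent_add ent_times_neq0)
    show ?thesis
      using that w XY(9) by (metis diff_0_right ent_minus ent_times_neq0)
  qed
  ultimately show "OFF ?u" by (simp add: OFF_def)
qed

definition monomial :: "nat \<Rightarrow> 'a cfm \<Rightarrow> bool" where
  "monomial m u \<longleftrightarrow> (\<forall>i j j'. j < m \<longrightarrow> j' < m \<longrightarrow> ent u i j \<noteq> 0 \<longrightarrow> ent u i j' \<noteq> 0 \<longrightarrow> j = j') \<and>
    (\<forall>i i' j. j < m \<longrightarrow> ent u i j \<noteq> 0 \<longrightarrow> ent u i' j \<noteq> 0 \<longrightarrow> i = i')"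

lemma monomial_row: "monomial m u \<Longrightarrow> j < m \<Longrightarrow> j' < m \<Longrightarrow> ent u i j \<noteq> 0 \<Longrightarrow> ent u i j' \<noteq> 0 \<Longrightarrow> j = j'"
  unfolding monomial_def by blast

lemma monomial_col: "monomial m u \<Longrightarrow> j < m \<Longrightarrow> ent u i j \<noteq> 0 \<Longrightarrow> ent u i' j \<noteq> 0 \<Longrightarrow> i = i'"
  unfolding monomial_def by blast

text \<open>
  The transvection adding \<open>t\<close> times row \<open>a\<close> to row \<open>a'\<close> can be completed to an operation that
  preserves the first \<open>m\<close> columns, which are already monomial.
\<close>

definition transv :: "nat \<Rightarrow> 'a cfm \<Rightarrow> nat \<Rightarrow> nat \<Rightarrow> 'a \<Rightarrow> bool" where
  "transv m u a a' t \<longleftrightarrow> (\<exists>X Y. X * (u * pr {..<m}) = u * pr {..<m} * Y \<and>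
     NIL (mu a' a t + X - Y) \<and> (mu a' a t + X) * (mu a' a t + X) = 0 \<and> Y * Y = 0 \<and>
     (\<forall>i j. ent Y i j \<noteq> 0 \<longrightarrow> blk i \<le> blk j \<and> blk j \<le> blk a \<and> i < m \<and> j < m \<and> i < n \<and> j < n \<and>
        i \<notin> Zc \<and> j \<notin> Zc) \<and>
     (\<forall>i j. ent X i j \<noteq> 0 \<longrightarrow> blk i \<le> blk j \<and> blk j < blk a \<and> i < n \<and> j < n \<and> i \<notin> Zr \<and> j \<notin> Zr \<and>
        (\<exists>c<m. ent u j c \<noteq> 0)))"

lemma mu_times_mu: "mu a b x * mu c e y = (if b = c then mu a e (x * y) else 0)"
  by (rule cfm_eqI) (simp add: ent_mu_times ent_mu)

text \<open>The coupled column operation changes column \<open>a\<close> by a multiple of column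
  \<open>a'\<close>. If column \<open>a'\<close> is empty, no repair is necessary and
  \<open>X = 0\<close> works. That the operation also avoids the pivot columns comes from
  \<open>free_row\<close>: \<open>a\<close> and \<open>a'\<close> are two free rows of one
  block.\<close>

lemma transv_zero_column:
  assumes "blk a = blk a'" "a \<noteq> a'" "a < m" "a' < m" "a \<notin> Zr" "a' \<notin> Zr" "\<And>b. ent u b a' = 0"
  shows "transv m u a a' t"
  unfolding transv_def
proof (rule exI, rule exI, intro conjI allI impI)
  show "0 * (u * pr {..<m}) = u * pr {..<m} * mu a' a t"
    by (rule cfm_eqI) (simp add: ent_times_mu assms)
  show "NIL (mu a' a t + 0 - mu a' a t)" by (simp add: NIL_zero)
  show "(mu a' a t + 0) * (mu a' a t + 0) = 0" "mu a' a t * mu a' a t = 0"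
    using assms by (simp_all add: mu_times_mu)
  fix i j
  show "blk i \<le> blk j" "blk j \<le> blk a" "i < m" "j < m" "i < n" "j < n" "i \<notin> Zc" "j \<notin> Zc"
    if "ent (mu a' a t) i j \<noteq> 0"
    using that assms blk_eq_in[of a a'] free_row[of a a'] free_row[of a' a]
    by (auto simp: ent_mu split: if_splits)
qed auto

text \<open>The spoiled column \<open>a\<close> receives an entry in row \<open>b'\<close>. Among
  the first \<open>m\<close> columns, row \<open>b\<close> is occupied only at \<open>a\<close>, so
  adding \<open>x\<close> times row \<open>b\<close> to row \<open>b'\<close> compensates exactly
  this entry; \<open>x\<close> solves \<open>x * ent u b a = ent u b' a' * t\<close>. For
  \<open>blk b' < blk b\<close> this repair needs no column operation. Inside one block it is again
  a transvection, for the rows \<open>b\<close> and \<open>b'\<close>, and its completion is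
  appended.\<close>

lemma transv_step:
  assumes u: "OFF u" "monomial m u"
    and a: "blk a = blk a'" "a \<noteq> a'" "a < m" "a' < m" "a \<notin> Zr" "a' \<notin> Zr"
    and b: "ent u b a \<noteq> 0" "ent u b' a' \<noteq> 0" "blk b' < blk b \<or> blk b' = blk b \<and> (\<forall>x. transv m u b b' x)"
  shows "transv m u a a' t"
proof -
  define x where "x = ent u b' a' * t / ent u b a"
  have bb: "blk b < blk a" "blk b' < blk a" "b < n" "b' < n" "b \<notin> Zr" "b' \<notin> Zr" "a < n" "a' < n"
    "a \<notin> Zc" "a' \<notin> Zc"
    using OFF_D[OF u(1) b(1)] OFF_D[OF u(1) b(2)] a by auto
  have ne: "b \<noteq> b'" using monomial_row[OF u(2), of a a' b] a b by auto
  let ?u = "u * pr {..<m}"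
  have ub: "ent u b j = 0" if "j < m" "j \<noteq> a" for j
    using monomial_row[OF u(2), of j a b] that a b by auto
  have ua: "ent u i a' = 0" if "i \<noteq> b'" for i
    using monomial_col[OF u(2), of a' i b'] that a b by auto
  have mu: "mu b' b x * ?u = ?u * mu a' a t"
    by (rule cfm_eqI) (use b ub ua a in \<open>auto simp: ent_mu_times ent_times_mu x_def\<close>)
  have sq: "mu a' a t * mu a' a t = 0" "mu b' b x * mu b' b x = 0"
    "mu a' a t * mu b' b x = 0" "mu b' b x * mu a' a t = 0"
    using a ne bb by (auto simp: mu_times_mu)
  show ?thesis
  proof (cases "blk b' < blk b")
    case True
    show ?thesis
      unfolding transv_def
    proof (rule exI, rule exI, intro conjI allI impI)
      show "mu b' b x * ?u = ?u * mu a' a t" by (rule mu)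
      show "NIL (mu a' a t + mu b' b x - mu a' a t)"
        using True by (auto simp: NIL_def ent_mu)
      show "(mu a' a t + mu b' b x) * (mu a' a t + mu b' b x) = 0" "mu a' a t * mu a' a t = 0"
        using sq by (simp_all add: distrib_left distrib_right)
      fix i j
      show "blk i \<le> blk j" "blk j \<le> blk a" "i < m" "j < m" "i < n" "j < n" "i \<notin> Zc" "j \<notin> Zc"
        if "ent (mu a' a t) i j \<noteq> 0"
        using that a bb by (auto simp: ent_mu split: if_splits)
      show "blk i \<le> blk j" "blk j < blk a" "i < n" "j < n" "i \<notin> Zr" "j \<notin> Zr" "\<exists>c<m. ent u j c \<noteq> 0"
        if "ent (mu b' b x) i j \<noteq> 0"
        using that a bb True b(1) by (auto simp: ent_mu split: if_splits)
    qed
  next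
    case False
    then have "blk b' = blk b" "transv m u b b' x" using b(3) by auto
    then obtain X Y where X: "X * ?u = ?u * Y"
      "NIL (mu b' b x + X - Y)" "(mu b' b x + X) * (mu b' b x + X) = 0" "Y * Y = 0"
      "\<And>i j. ent Y i j \<noteq> 0 \<Longrightarrow> blk i \<le> blk j \<and> blk j \<le> blk b \<and> i < m \<and> j < m \<and> i < n \<and> j < n \<and>
         i \<notin> Zc \<and> j \<notin> Zc"
      "\<And>i j. ent X i j \<noteq> 0 \<Longrightarrow> blk i \<le> blk j \<and> blk j < blk b \<and> i < n \<and> j < n \<and> i \<notin> Zr \<and> j \<notin> Zr \<and>
         (\<exists>c<m. ent u j c \<noteq> 0)"
      unfolding transv_def by blast
    define W where "W = mu b' b x + X"
    have W: "blk i \<le> blk j \<and> blk j \<le> blk b" if "ent W i j \<noteq> 0" for i j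
      using that X(6)[of i j] \<open>blk b' = blk b\<close> by (fastforce simp: W_def ent_mu split: if_splits)
    \<comment> \<open>All entries of \<open>W\<close> and \<open>Y\<close> lie in blocks up to
      \<open>blk b\<close>, strictly below the block of \<open>a\<close> and \<open>a'\<close>. The
      mixed products with \<open>mu a' a t\<close> vanish for this reason, and the squares remain
      zero.\<close>
    have WE: "W * mu a' a t = 0" "mu a' a t * W = 0" if "\<And>i j. ent W i j \<noteq> 0 \<Longrightarrow> blk i \<le> blk j \<and> blk j \<le> blk b" for W
      by (rule cfm_eqI; use that[of a' _] that[of _ a'] that[of a _] that[of _ a] bb a in
        \<open>force simp: ent_times_mu ent_mu_times\<close>)+
    show ?thesis
      unfolding transv_def
    proof (rule exI, rule exI, intro conjI allI impI)
      show "W * ?u = ?u * (mu a' a t + Y)" using mu X(1) by (simp add: W_def distrib_left distrib_right)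
      show "NIL (mu a' a t + W - (mu a' a t + Y))" using X(2) by (simp add: W_def)
      show "(mu a' a t + W) * (mu a' a t + W) = 0"
        using sq WE[OF W] X(3) by (simp add: distrib_left distrib_right flip: W_def)
      show "(mu a' a t + Y) * (mu a' a t + Y) = 0"
        using sq WE[of Y] X(4,5) by (simp add: distrib_left distrib_right)
      fix i j
      show "blk i \<le> blk j" "blk j \<le> blk a" "i < m" "j < m" "i < n" "j < n" "i \<notin> Zc" "j \<notin> Zc"
        if "ent (mu a' a t + Y) i j \<noteq> 0"
      proof -
        have "i = a' \<and> j = a \<or> ent Y i j \<noteq> 0" using that by (auto simp: ent_mu split: if_splits)
        then show "blk i \<le> blk j" "blk j \<le> blk a" "i < m" "j < m" "i < n" "j < n" "i \<notin> Zc" "j \<notin> Zc"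
          using X(5)[of i j] a bb by auto
      qed
      show "blk i \<le> blk j" "blk j < blk a" "i < n" "j < n" "i \<notin> Zr" "j \<notin> Zr" "\<exists>c<m. ent u j c \<noteq> 0"
        if "ent W i j \<noteq> 0"
      proof -
        have "i = b' \<and> j = b \<or> ent X i j \<noteq> 0" using that by (auto simp: W_def ent_mu split: if_splits)
        then show "blk i \<le> blk j" "blk j < blk a" "i < n" "j < n" "i \<notin> Zr" "j \<notin> Zr" "\<exists>c<m. ent u j c \<noteq> 0"
          using X(6)[of i j] a bb b(1) \<open>blk b' = blk b\<close> by auto
      qed
    qed
  qed
qed

text \<open>Induction on the block. An empty column decides the direction; otherwise the rows
  \<open>b\<close>, \<open>b'\<close> of the two entries lie in earlier blocks. If these blocks
  differ, adding towards the earlier one is possible; if they coincide, the direction that works for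
  \<open>b\<close>, \<open>b'\<close> also works for \<open>a\<close>, \<open>a'\<close>.\<close>

lemma transv_exists:
  assumes u: "OFF u" "monomial m u"
    and a: "blk a = blk a'" "a \<noteq> a'" "a < m" "a' < m" "a \<notin> Zr" "a' \<notin> Zr"
  shows "(\<forall>t. transv m u a a' t) \<or> (\<forall>t. transv m u a' a t)"
  using a
proof (induction "blk a" arbitrary: a a' rule: less_induct)
  case less
  consider "\<And>b. ent u b a' = 0" | "\<And>b. ent u b a = 0" | b b' where "ent u b a \<noteq> 0" "ent u b' a' \<noteq> 0"
    by blast
  then show ?case
  proof cases
    case 1
    then show ?thesis using transv_zero_column[of a a' m u] less.prems by blast
  next
    case 2
    then show ?thesis using transv_zero_column[of a' a m u] less.prems by metis
  next
    case 3
    have b: "blk b < blk a" "b < a" "b' < a'" "b \<notin> Zr" "b' \<notin> Zr"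
      using OFF_D[OF u(1) 3(1)] OFF_D[OF u(1) 3(2)] by auto
    have ne: "b \<noteq> b'" using monomial_row[OF u(2), of a a' b] less.prems 3 by auto
    have IH: "(\<forall>t. transv m u b b' t) \<or> (\<forall>t. transv m u b' b t)" if "blk b = blk b'"
      using less.hyps[OF b(1) that ne] b less.prems by simp
    consider "blk b' < blk b" | "blk b < blk b'" | "blk b = blk b'" by linarith
    then show ?thesis
    proof cases
      case 1
      then show ?thesis using transv_step[OF u less.prems 3] by blast
    next
      case 2
      then show ?thesis
        using transv_step[OF u less.prems(1)[symmetric] less.prems(2)[symmetric] less.prems(4,3,6,5) 3(2,1)]
        by blast
    next
      case 3
      then show ?thesis
        using IH[OF 3] transv_step[OF u less.prems \<open>ent u b a \<noteq> 0\<close> \<open>ent u b' a' \<noteq> 0\<close>]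
          transv_step[OF u less.prems(1)[symmetric] less.prems(2)[symmetric] less.prems(4,3,6,5)
            \<open>ent u b' a' \<noteq> 0\<close> \<open>ent u b a \<noteq> 0\<close>]
        by metis
    qed
  qed
qed

text \<open>\<open>t\<close> is chosen to cancel the entry in row \<open>a'\<close> of column
  \<open>m\<close>. By \<open>T\<close>, row \<open>a\<close> is empty before column
  \<open>m\<close>, so the transvection itself leaves the first \<open>m\<close> columns alone; only
  its column companion disturbs them, and that is what \<open>transv\<close> repairs.\<close>

lemma kill_by_transv:
  assumes u: "OFF u" and a: "a \<noteq> a'" "ent u a m \<noteq> 0" "ent u a' m \<noteq> 0" "blk a = blk a'"
    and T: "\<And>i j. ent u i m \<noteq> 0 \<Longrightarrow> j < m \<Longrightarrow> ent u i j = 0"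
    and tr: "\<forall>t. transv m u a a' t"
  obtains u' where "OFF u'" "eqv (d + u) (d + u')" "\<And>i j. j < m \<Longrightarrow> ent u' i j = ent u i j"
    "\<And>i. ent u' i m = (if i = a' then 0 else ent u i m)"
proof -
  define t where "t = - ent u a' m / ent u a m"
  have an: "a \<notin> Zr" "a' \<notin> Zr" "a < n" "a' < n" using OFF_D[OF u] a by blast+
  let ?u = "u * pr {..<m}"
  obtain X Y where X: "X * ?u = ?u * Y"
      "NIL (mu a' a t + X - Y)" "(mu a' a t + X) * (mu a' a t + X) = 0" "Y * Y = 0"
      "\<And>i j. ent Y i j \<noteq> 0 \<Longrightarrow> blk i \<le> blk j \<and> blk j \<le> blk a \<and> i < m \<and> j < m \<and> i < n \<and> j < n \<and>
         i \<notin> Zc \<and> j \<notin> Zc"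
      "\<And>i j. ent X i j \<noteq> 0 \<Longrightarrow> blk i \<le> blk j \<and> blk j < blk a \<and> i < n \<and> j < n \<and> i \<notin> Zr \<and> j \<notin> Zr \<and>
         (\<exists>c<m. ent u j c \<noteq> 0)"
    using tr[rule_format, of t] unfolding transv_def by blast
  define W where "W = mu a' a t + X"
  have W: "i = a' \<and> j = a \<or> ent X i j \<noteq> 0" if "ent W i j \<noteq> 0" for i j
    using that by (auto simp: W_def ent_mu split: if_splits)
  have "op_pair W Y"
    unfolding op_pair_def UT_def INS_def
    using X(2-4) W X(5,6) a an by (fastforce simp flip: W_def)
  note mv = op_pair_move[OF u this]
  have Ypr: "Y * pr {..<m} = Y" "pr {..<m} * Y = Y"
    by (rule times_pr_eqI, use X(5) in blast, rule pr_times_eqI, use X(5) in blast)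
  have uY: "u * Y = ?u * Y" using Ypr by (metis mult.assoc)
  have "mu a' a t * ?u = 0"
    by (rule cfm_eqI) (use T[OF a(2)] in \<open>auto simp: ent_mu_times\<close>)
  then have W1: "(1 + W) * ?u = ?u + ?u * Y" using X(1) by (simp add: W_def distrib_right)
  let ?v = "(1 + W) * u * (1 - Y)"
  have "?v * pr {..<m} = (1 + W) * ?u - (1 + W) * (u * Y) * pr {..<m}"
    by (simp add: algebra_simps)
  also have "(1 + W) * (u * Y) * pr {..<m} = (1 + W) * ?u * (Y * pr {..<m})"
    unfolding uY by (simp add: mult.assoc)
  \<comment> \<open>On the first \<open>m\<close> columns the result is
    \<open>?u * (1 + Y) * (1 - Y)\<close>, and \<open>Y\<close> has square zero.\<close>
  also have "(1 + W) * ?u - \<dots> = ?u"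
    unfolding Ypr W1 using X(4) by (simp add: distrib_right mult.assoc)
  finally have v: "?v * pr {..<m} = ?u" .
  show thesis
  proof (rule that[OF mv(2,1)])
    show "ent ?v i j = ent u i j" if "j < m" for i j
      using arg_cong[OF v, of "\<lambda>A. ent A i j"] that by simp
    fix i
    have "ent ((1 + W) * u * Y) i m = 0"
      using X(5)[of _ m] by (metis ent_times_neq0 less_irrefl)
    then have "ent ?v i m = ent ((1 + W) * u) i m" by (simp add: right_diff_distrib)
    also have "\<dots> = ent u i m + ent (mu a' a t * u) i m + ent (X * u) i m"
      by (simp add: W_def distrib_right)
    \<comment> \<open>The rows used by \<open>X\<close> have an entry in an earlier column, hence by
      \<open>T\<close> none in column \<open>m\<close>: the repair does not reach the column under
      treatment.\<close>
    also have "ent (X * u) i m = 0"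
      using X(6) T by (metis ent_times_neq0)
    finally show "ent ?v i m = (if i = a' then 0 else ent u i m)"
      using a by (auto simp: ent_mu_times t_def)
  qed
qed

text \<open>Here the row operation is strictly block upper, so it comes without a column operation,
  and by \<open>T\<close> the row that is added is empty in the earlier columns.\<close>

lemma kill_by_row:
  assumes u: "OFF u" and a: "ent u a m \<noteq> 0" "ent u a' m \<noteq> 0" "blk a' < blk a"
    and T: "\<And>i j. ent u i m \<noteq> 0 \<Longrightarrow> j < m \<Longrightarrow> ent u i j = 0"
  obtains u' where "OFF u'" "eqv (d + u) (d + u')" "\<And>i j. j < m \<Longrightarrow> ent u' i j = ent u i j"
    "\<And>i. ent u' i m = (if i = a' then 0 else ent u i m)"
proof -
  define t where "t = - ent u a' m / ent u a m"
  have an: "a \<notin> Zr" "a' \<notin> Zr" "a < n" "a' < n" using OFF_D[OF u] a by blast+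
  have "NIL (mu a' a t)" using a by (auto simp: NIL_def ent_mu)
  then have "op_pair (mu a' a t) 0"
    unfolding op_pair_def using an a
    by (auto simp: INS_def ent_mu mu_times_mu UT_zero intro: NIL_UT split: if_splits)
  note mv = op_pair_move[OF u this]
  show thesis
  proof (rule that[OF mv(2,1)])
    show "ent ((1 + mu a' a t) * u * (1 - 0)) i j = ent u i j" if "j < m" for i j
      using T[OF a(1) that] by (simp add: distrib_right ent_mu_times)
    show "ent ((1 + mu a' a t) * u * (1 - 0)) i m = (if i = a' then 0 else ent u i m)" for i
      using a by (simp add: distrib_right ent_mu_times t_def)
  qed
qed

lemma kill_column:
  assumes "OFF u" "monomial m u" "\<And>i j. ent u i m \<noteq> 0 \<Longrightarrow> j < m \<Longrightarrow> ent u i j = 0"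
  shows "\<exists>u'. OFF u' \<and> eqv (d + u) (d + u') \<and> monomial (Suc m) u'"
  using assms
proof (induction "card {i. ent u i m \<noteq> 0}" arbitrary: u rule: less_induct)
  case less
  show ?case
  proof (cases "\<exists>a a'. a \<noteq> a' \<and> ent u a m \<noteq> 0 \<and> ent u a' m \<noteq> 0")
    case False
    have "monomial (Suc m) u"
      unfolding monomial_def
    proof (intro conjI allI impI)
      fix i j j' assume "j < Suc m" "j' < Suc m" "ent u i j \<noteq> 0" "ent u i j' \<noteq> 0"
      then show "j = j'"
        using less.prems(3)[of i j] less.prems(3)[of i j'] monomial_row[OF less.prems(2), of j j' i]
        by (auto simp: less_Suc_eq)
    next
      fix i i' j assume "j < Suc m" "ent u i j \<noteq> 0" "ent u i' j \<noteq> 0"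
      then show "i = i'"
        using False monomial_col[OF less.prems(2), of j i i'] by (auto simp: less_Suc_eq)
    qed
    then show ?thesis using less.prems eqv_refl by blast
  next
    case True
    then obtain a a' where a: "a \<noteq> a'" "ent u a m \<noteq> 0" "ent u a' m \<noteq> 0" by blast
    have an: "a \<notin> Zr" "a' \<notin> Zr" "a < m" "a' < m" using OFF_D[OF less.prems(1)] a by blast+
    have "\<exists>u' x. ent u x m \<noteq> 0 \<and> OFF u' \<and> eqv (d + u) (d + u') \<and>
        (\<forall>i j. j < m \<longrightarrow> ent u' i j = ent u i j) \<and> (\<forall>i. ent u' i m = (if i = x then 0 else ent u i m))"
    proof -
      consider "blk a' < blk a" | "blk a < blk a'" | "blk a = blk a'" by linarith
      then show ?thesis
      proof cases
        case 1
        then show ?thesis using kill_by_row[OF less.prems(1) a(2,3) 1 less.prems(3)] a by metis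
      next
        case 2
        then show ?thesis using kill_by_row[OF less.prems(1) a(3,2) 2 less.prems(3)] a by metis
      next
        case 3
        from transv_exists[OF less.prems(1,2) 3 a(1) an(3,4,1,2)] show ?thesis
        proof
          assume "\<forall>t. transv m u a a' t"
          from kill_by_transv[OF less.prems(1) a 3 less.prems(3) this] show ?thesis using a by metis
        next
          assume "\<forall>t. transv m u a' a t"
          from kill_by_transv[OF less.prems(1) a(1)[symmetric] a(3,2) 3[symmetric] less.prems(3) this]
          show ?thesis using a by metis
        qed
      qed
    qed
    then obtain u' x where u': "ent u x m \<noteq> 0" "OFF u'" "eqv (d + u) (d + u')"
      "\<And>i j. j < m \<Longrightarrow> ent u' i j = ent u i j" "\<And>i. ent u' i m = (if i = x then 0 else ent u i m)"
      by blast
    have "{i. ent u' i m \<noteq> 0} \<subset> {i. ent u i m \<noteq> 0}" using u'(1,5) by auto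
    then have "card {i. ent u' i m \<noteq> 0} < card {i. ent u i m \<noteq> 0}" by (simp add: psubset_card_mono)
    moreover have "monomial m u'" using less.prems(2) u'(4) unfolding monomial_def by simp
    moreover have "ent u' i j = 0" if "ent u' i m \<noteq> 0" "j < m" for i j
      using that u'(4,5) less.prems(3)[of i j] by (simp split: if_splits)
    ultimately obtain u'' where "OFF u''" "eqv (d + u') (d + u'')" "monomial (Suc m) u''"
      using less.hyps[of u'] u'(2) by blast
    then show ?thesis using u'(3) eqv_trans by blast
  qed
qed

text \<open>Earlier columns are subtracted from column \<open>m\<close> until every row occupied
  before has no entry in it. The coupled row operation \<open>X\<close> does no damage here: it adds
  multiples of row \<open>m\<close> only, and the entries of row \<open>m\<close> lie in columns
  beyond \<open>m\<close>.\<close>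

lemma clear_used_rows:
  assumes u: "OFF u" "monomial m u" and m: "m \<notin> Zc" "m < n"
  obtains u' where "OFF u'" "monomial m u'" "eqv (d + u) (d + u')"
    "\<And>i j. ent u' i m \<noteq> 0 \<Longrightarrow> j < m \<Longrightarrow> ent u' i j = 0"
proof -
  \<comment> \<open>The multiple of column \<open>c\<close> to be subtracted from column
    \<open>m\<close>. The row \<open>b\<close> is the only one occupied in column \<open>c\<close>
    when \<open>c < m\<close>; an empty column gets the multiple 0.\<close>
  define w where "w c = (if \<exists>b. ent u b c \<noteq> 0 then let b = SOME b. ent u b c \<noteq> 0 in ent u b m / ent u b c else 0)" for c
  have w: "w c = ent u b m / ent u b c" if "ent u b c \<noteq> 0" "c < m" for b c
  proof -
    have "ent u (SOME b. ent u b c \<noteq> 0) c \<noteq> 0" using that(1) by (rule someI)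
    then have "(SOME b. ent u b c \<noteq> 0) = b" using monomial_col[OF u(2) that(2)] that(1) by blast
    then show ?thesis using that by (auto simp: w_def Let_def)
  qed
  have w0: "c \<notin> Zc" if "w c \<noteq> 0" for c
    using that OFF_D[OF u(1)] by (auto simp: w_def split: if_splits)
  define Y where "Y = Cfm (\<lambda>c j. if j = m \<and> c < m then w c else 0)"
  have Y: "ent Y c j = (if j = m \<and> c < m then w c else 0)" for c j
    unfolding Y_def
  proof (subst ent_Cfm)
    fix j
    have "{i. (if j = m \<and> i < m then w i else 0) \<noteq> 0} \<subseteq> {..<m}" by auto
    then show "finite {i. (if j = m \<and> i < m then w i else 0) \<noteq> 0}" by (rule finite_subset) simp
  qed simp
  define X where "X = dp Y"
  have YY: "Z * Z' = 0" if "\<And>i j. ent Z i j \<noteq> 0 \<Longrightarrow> i < m \<and> j = m" "\<And>i j. ent Z' i j \<noteq> 0 \<Longrightarrow> i < m \<and> j = m" for Z Z' :: "'a cfm"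
    by (rule cfm_eqI, rule ccontr) (metis ent_times_neq0 ent_zero less_irrefl that)
  have UTY: "UT Y" by (auto simp: UT_def Y intro: blk_mono)
  have X0: "i < m \<and> j = m \<and> blk i = blk m \<and> ent Y i j \<noteq> 0" if "ent X i j \<noteq> 0" for i j
    using that by (auto simp: X_def ent_dp Y split: if_splits)
  have Y0: "i < m \<and> j = m \<and> i \<notin> Zc" if "ent Y i j \<noteq> 0" for i j
    using that w0 by (auto simp: Y split: if_splits)
  have "op_pair X Y"
    unfolding op_pair_def
  proof (intro conjI allI impI)
    show "UT X" by (simp add: X_def UT_dp)
    show "UT Y" by (rule UTY)
    show "INS Y" using Y0 m by (fastforce simp: INS_def)
    then show "INS X" unfolding X_def by (rule INS_dp)
    show "X * X = 0" "Y * Y = 0" using YY X0 Y0 by blast+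
    have "X - Y = - (Y - dp Y)" by (simp add: X_def)
    then show "NIL (X - Y)" using NIL_minus_dp[OF UTY] NIL_uminus by metis
    fix i j
    show "i \<notin> Zc" "j \<notin> Zc" if "ent Y i j \<noteq> 0" using Y0[OF that] m by auto
    show "i \<notin> Zr" "j \<notin> Zr" if "ent X i j \<noteq> 0"
      using X0[OF that] Y0[of i j] m free_col[of i m] free_col[of m i] by auto
  qed
  note mv = op_pair_move[OF u(1) this]
  let ?v = "(1 + X) * u * (1 - Y)"
  have XU: "ent ((1 + X) * u) i j = ent u i j" if "j \<le> m" for i j
  proof -
    \<comment> \<open>\<open>X\<close> picks out row \<open>m\<close> of \<open>u\<close>, and
      \<open>u\<close> is strictly upper triangular.\<close>
    have "ent (X * u) i j = 0"
      using X0 OFF_D[OF u(1)] that by (metis ent_times_neq0 linorder_not_less)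
    then show ?thesis by (simp add: distrib_right)
  qed
  have v: "ent ?v i j = ent u i j - ent ((1 + X) * u * Y) i j" if "j \<le> m" for i j
    using XU[OF that] by (simp add: right_diff_distrib)
  have v1: "ent ?v i j = ent u i j" if "j < m" for i j
  proof -
    have "ent ((1 + X) * u * Y) i j = 0" using Y0 that by (metis ent_times_neq0 less_irrefl)
    then show ?thesis using v that by simp
  qed
  show thesis
  proof (rule that[OF mv(2) _ mv(1)])
    show "monomial m ?v" using u(2) v1 by (simp add: monomial_def)
    fix i j assume *: "ent ?v i m \<noteq> 0" "j < m"
    show "ent ?v i j = 0"
    proof (rule ccontr)
      assume "ent ?v i j \<noteq> 0"
      then have ij: "ent u i j \<noteq> 0" using v1 * by simp
      have "ent ((1 + X) * u * Y) i m = (\<Sum>c\<in>{j}. ent ((1 + X) * u) i c * ent Y c m)"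
      proof (rule ent_times_sum)
        fix c assume "ent Y c m \<noteq> 0" "ent ((1 + X) * u) i c \<noteq> 0"
        then have "c < m" "ent u i c \<noteq> 0" using Y0[of c m] XU[of c i] by simp_all
        then show "c \<in> {j}" using monomial_row[OF u(2) _ *(2), of c i] ij by simp
      qed simp
      also have "\<dots> = ent u i m" using XU *(2) w[OF ij *(2)] ij by (simp add: Y)
      finally show False using * v by simp
    qed
  qed
qed

lemma monomial_form:
  assumes "OFF u"
  obtains u' where "OFF u'" "eqv (d + u) (d + u')" "\<And>m. monomial m u'"
proof -
  have "\<exists>u'. OFF u' \<and> eqv (d + u) (d + u') \<and> monomial m u'" for m
  proof (induction m)
    case 0
    then show ?case using assms eqv_refl by (auto simp: monomial_def)
  next
    case (Suc m)
    then obtain u' where u': "OFF u'" "eqv (d + u) (d + u')" "monomial m u'" by blast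
    show ?case
    proof (cases "m \<notin> Zc \<and> m < n")
      case True
      then obtain v where v: "OFF v" "monomial m v" "eqv (d + u') (d + v)"
        "\<And>i j. ent v i m \<noteq> 0 \<Longrightarrow> j < m \<Longrightarrow> ent v i j = 0"
        using clear_used_rows[OF u'(1,3)] by metis
      from kill_column[OF v(1,2,4)] show ?thesis using u'(2) v(3) eqv_trans by blast
    next
      case False
      then have "ent u' i m = 0" for i using OFF_D[OF u'(1)] by blast
      then have "monomial (Suc m) u'" using u'(3) unfolding monomial_def by (metis less_Suc_eq)
      then show ?thesis using u' by blast
    qed
  qed
  then obtain u' where u': "OFF u'" "eqv (d + u) (d + u')" "monomial n u'" by blast
  have "monomial m u'" for m
    using u'(3) OFF_D[OF u'(1)] unfolding monomial_def by blast
  then show thesis using that u' by blast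
qed

end

section \<open>Chains of roots and the uniqueness of the rook placement\<close>

text \<open>\<open>Top\<close> stands for a pivot column, \<open>Bot\<close> for an index without
  pivot and without a root in its column, and \<open>Step k x\<close> for a root leading down to
  block \<open>k\<close>, where the rest of the chain reads \<open>x\<close>.\<close>

datatype chain_word = Top | Bot | Step nat chain_word

instantiation chain_word :: linorder
begin

text \<open>Lexicographic, with \<open>Bot\<close> least and \<open>Top\<close> greatest. A smaller
  word means that \<open>h\<close> pushes a basis vector further down the flag: to 0, or to an
  earlier block, or to the same block with a smaller word there. A pivot is not pushed down at
  all.\<close>

fun less_eq_chain_word :: "chain_word \<Rightarrow> chain_word \<Rightarrow> bool" where
  "less_eq_chain_word Bot w \<longleftrightarrow> True"
| "less_eq_chain_word Top w \<longleftrightarrow> w = Top"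
| "less_eq_chain_word (Step k x) Top \<longleftrightarrow> True"
| "less_eq_chain_word (Step k x) Bot \<longleftrightarrow> False"
| "less_eq_chain_word (Step k x) (Step k' x') \<longleftrightarrow> k < k' \<or> k = k' \<and> less_eq_chain_word x x'"

definition less_chain_word :: "chain_word \<Rightarrow> chain_word \<Rightarrow> bool" where
  "less_chain_word x y \<longleftrightarrow> x \<le> y \<and> \<not> y \<le> x"

instance
proof
  fix x y z :: chain_word
  show "(x < y) = (x \<le> y \<and> \<not> y \<le> x)" by (rule less_chain_word_def)
  show "x \<le> x" by (induction x) auto
  show "x \<le> y \<Longrightarrow> y \<le> z \<Longrightarrow> x \<le> z"
  proof (induction x arbitrary: y z)
    case (Step k x)
    then show ?case by (cases y; cases z) auto
  qed (cases y; cases z; auto)+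
  show "x \<le> y \<Longrightarrow> y \<le> x \<Longrightarrow> x = y"
  proof (induction x arbitrary: y)
    case Top
    then show ?case by simp
  next
    case Bot
    then show ?case by (cases y) auto
  next
    case (Step k x)
    then show ?case by (cases y) auto
  qed
  show "x \<le> y \<or> y \<le> x"
  proof (induction x arbitrary: y)
    case Top
    then show ?case by (cases y) simp_all
  next
    case Bot
    then show ?case by simp
  next
    case (Step k x)
    show ?case
    proof (cases y)
      case (Step k' x')
      then show ?thesis using Step.IH[of x'] by auto
    qed simp_all
  qed
qed

end

lemma le_Top: "w \<le> Top"
  by (cases w) auto

lemma le_Bot: "w \<le> Bot \<longleftrightarrow> w = Bot"
  by (cases w) auto

text \<open>A level set is a difference of sublevel sets, and the indices strictly below
  \<open>w\<close> form the sublevel set of the largest value below \<open>w\<close> taken by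
  \<open>f\<close> or \<open>g\<close>. Equality of counts is therefore needed only at values
  actually taken, which in the application are words of chains.\<close>

lemma level_sets_card_eq:
  fixes f g :: "'b \<Rightarrow> 'c :: linorder"
  assumes "finite A" and le: "\<And>w. w \<in> f ` A \<union> g ` A \<Longrightarrow> card {a \<in> A. f a \<le> w} = card {a \<in> A. g a \<le> w}"
  shows "card {a \<in> A. f a = w} = card {a \<in> A. g a = w}"
proof (cases "w \<in> f ` A \<union> g ` A")
  case False
  then have "{a \<in> A. f a = w} = {}" "{a \<in> A. g a = w} = {}" by auto
  then show ?thesis by (simp only:)
next
  case True
  define L where "L = {x \<in> f ` A \<union> g ` A. x < w}"
  have fin: "finite L" using assms(1) by (simp add: L_def)
  have less: "card {a \<in> A. f a < w} = card {a \<in> A. g a < w}"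
  proof (cases "L = {}")
    case True
    then have "{a \<in> A. f a < w} = {}" "{a \<in> A. g a < w} = {}" by (auto simp: L_def)
    then show ?thesis by (simp only:)
  next
    case False
    have m: "Max L \<in> L" "\<And>x. x \<in> L \<Longrightarrow> x \<le> Max L" using fin False by auto
    have "{a \<in> A. f a < w} = {a \<in> A. f a \<le> Max L}" "{a \<in> A. g a < w} = {a \<in> A. g a \<le> Max L}"
      using m by (auto simp: L_def)
    then show ?thesis using le[of "Max L"] m by (simp add: L_def)
  qed
  have split: "card {a \<in> A. k a = w} = card {a \<in> A. k a \<le> w} - card {a \<in> A. k a < w}" for k :: "'b \<Rightarrow> 'c"
  proof -
    have "{a \<in> A. k a = w} = {a \<in> A. k a \<le> w} - {a \<in> A. k a < w}" by auto
    then show ?thesis using assms(1) by (simp add: card_Diff_subset less_imp_le subset_iff)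
  qed
  show ?thesis by (simp add: split less le[OF True])
qed

lemma label_preserving_bij:
  assumes "finite A" "finite B" and c: "\<And>x. card {a \<in> A. f a = x} = card {b \<in> B. g b = x}"
  obtains \<pi> where "bij_betw \<pi> A B" "\<And>a. a \<in> A \<Longrightarrow> g (\<pi> a) = f a"
proof -
  have "\<exists>\<pi>. bij_betw \<pi> {a \<in> A. f a = x} {b \<in> B. g b = x}" for x
    using c assms by (intro finite_same_card_bij) auto
  then obtain \<pi> where \<pi>: "\<And>x. bij_betw (\<pi> x) {a \<in> A. f a = x} {b \<in> B. g b = x}" by metis
  let ?p = "\<lambda>a. \<pi> (f a) a"
  have p: "?p a \<in> B" "g (?p a) = f a" if "a \<in> A" for a
    using bij_betwE[OF \<pi>[of "f a"]] that by auto
  have "bij_betw ?p A B"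
    unfolding bij_betw_def
  proof
    show "inj_on ?p A"
    proof (rule inj_onI)
      fix a a' assume a: "a \<in> A" "a' \<in> A" "?p a = ?p a'"
      then have "f a = f a'" using p by metis
      then show "a = a'" using bij_betw_imp_inj_on[OF \<pi>[of "f a"]] a by (auto simp: inj_on_def)
    qed
    show "?p ` A = B"
    proof
      show "?p ` A \<subseteq> B" using p by auto
      show "B \<subseteq> ?p ` A"
      proof
        fix b assume "b \<in> B"
        then have "b \<in> \<pi> (g b) ` {a \<in> A. f a = g b}"
          using bij_betw_imp_surj_on[OF \<pi>[of "g b"]] by simp
        then obtain a where "a \<in> A" "f a = g b" "b = \<pi> (g b) a" by auto
        then have "b = ?p a" by simp
        then show "b \<in> ?p ` A" using \<open>a \<in> A\<close> by (rule image_eqI)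
      qed
    qed
  qed
  then show thesis using that p by blast
qed

lemma label_count:
  assumes "finite A" "finite B" and c: "\<And>x. card {a \<in> A. f a = x} = card {b \<in> B. g b = x}"
  shows "card {a \<in> A. P (f a)} = card {b \<in> B. P (g b)}"
proof -
  obtain \<pi> where \<pi>: "bij_betw \<pi> A B" "\<And>a. a \<in> A \<Longrightarrow> g (\<pi> a) = f a"
    using label_preserving_bij[OF assms] by metis
  have "bij_betw \<pi> {a \<in> A. P (f a)} {b \<in> B. P (g b)}"
    unfolding bij_betw_def
  proof
    show "inj_on \<pi> {a \<in> A. P (f a)}" using \<pi>(1) by (auto simp: bij_betw_def inj_on_def)
    show "\<pi> ` {a \<in> A. P (f a)} = {b \<in> B. P (g b)}"
      using \<pi>(2) bij_betw_imp_surj_on[OF \<pi>(1)] by (auto simp: image_iff)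
  qed
  then show ?thesis by (rule bij_betw_same_card)
qed

text \<open>
  Extends \<open>\<phi>\<close>, given on the indices without a root in their row, along the chains of \<open>D\<close>.
\<close>

function chain_ext :: "nat \<Rightarrow> (nat \<times> nat) set \<Rightarrow> (nat \<times> nat) set \<Rightarrow> (nat \<Rightarrow> nat) \<Rightarrow> nat \<Rightarrow> nat" where
  "chain_ext n D D' \<phi> a = (if \<exists>c. a < c \<and> c < n \<and> (a, c) \<in> D
     then SOME b. (b, chain_ext n D D' \<phi> (SOME c. a < c \<and> c < n \<and> (a, c) \<in> D)) \<in> D' else \<phi> a)"
  by pat_completeness auto
termination
proof (relation "measure (\<lambda>(n, D, D', \<phi>, a). n - a)", simp)
  fix n a :: nat and D D' :: "(nat \<times> nat) set" and \<phi> :: "nat \<Rightarrow> nat"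
  assume "\<exists>c. a < c \<and> c < n \<and> (a, c) \<in> D"
  then have "a < (SOME c. a < c \<and> c < n \<and> (a, c) \<in> D) \<and> (SOME c. a < c \<and> c < n \<and> (a, c) \<in> D) < n"
    by (rule someI2_ex) simp
  then have "n - (SOME c. a < c \<and> c < n \<and> (a, c) \<in> D) < n - a" by linarith
  then show "((n, D, D', \<phi>, SOME c. a < c \<and> c < n \<and> (a, c) \<in> D), n, D, D', \<phi>, a)
    \<in> measure (\<lambda>(n, D, D', \<phi>, a). n - a)" by simp
qed

declare chain_ext.simps [simp del]

definition chains :: "nat \<Rightarrow> (nat \<times> nat) set \<Rightarrow> bool" where
  "chains n D \<longleftrightarrow> (\<forall>b a. (b, a) \<in> D \<longrightarrow> b < a \<and> a < n) \<and>
    (\<forall>b a a'. (b, a) \<in> D \<longrightarrow> (b, a') \<in> D \<longrightarrow> a = a') \<and>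
    (\<forall>b b' a. (b, a) \<in> D \<longrightarrow> (b', a) \<in> D \<longrightarrow> b = b')"

text \<open>The label of an index determines, through \<open>rt\<close>, the label of its
  predecessor in the chain. Hence the label counts also determine how many indices of each label
  have no root in their row. A label-preserving bijection between these upper ends is extended
  downwards: the image of \<open>a\<close> with root \<open>(a, c)\<close> is the predecessor of the
  image of \<open>c\<close>, which exists because labels agree.\<close>

lemma chain_isomorphism:
  fixes f f' :: "nat \<Rightarrow> 'l"
  assumes D: "chains n D" and D': "chains n D'"
    and cnt: "\<And>x. card {a \<in> {..<n}. f a = x} = card {a \<in> {..<n}. f' a = x}"
    and rt: "\<And>a x. a < n \<Longrightarrow> (\<exists>b. (b, a) \<in> D \<and> f b = x) \<longleftrightarrow> rt (f a) = Some x"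
    and rt': "\<And>a x. a < n \<Longrightarrow> (\<exists>b. (b, a) \<in> D' \<and> f' b = x) \<longleftrightarrow> rt (f' a) = Some x"
  obtains w where "w permutes {..<n}" "\<And>a. a < n \<Longrightarrow> f' (w a) = f a" "map_prod w w ` D = D'"
proof -
  have DD: "\<And>b a. (b, a) \<in> D \<Longrightarrow> b < a \<and> a < n" "\<And>b a a'. (b, a) \<in> D \<Longrightarrow> (b, a') \<in> D \<Longrightarrow> a = a'"
    "\<And>b b' a. (b, a) \<in> D \<Longrightarrow> (b', a) \<in> D \<Longrightarrow> b = b'"
    using D unfolding chains_def by blast+
  have DD': "\<And>b a. (b, a) \<in> D' \<Longrightarrow> b < a \<and> a < n" "\<And>b a a'. (b, a) \<in> D' \<Longrightarrow> (b, a') \<in> D' \<Longrightarrow> a = a'"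
    "\<And>b b' a. (b, a) \<in> D' \<Longrightarrow> (b', a) \<in> D' \<Longrightarrow> b = b'"
    using D' unfolding chains_def by blast+
  define H where "H = (\<lambda>D. {a. a < n \<and> \<not> (\<exists>c. (a, c) \<in> (D :: (nat \<times> nat) set))})"
  \<comment> \<open>Indices labelled \<open>x\<close> that have a root in their row correspond to
    the columns \<open>c\<close> whose label predicts a predecessor labelled \<open>x\<close>;
    subtracting them leaves the upper ends.\<close>
  have heads: "card {a \<in> H D. f a = x} = card {a \<in> {..<n}. f a = x} - card {a \<in> {..<n}. rt (f a) = Some x}"
    if D: "chains n D" and rt: "\<And>a x. a < n \<Longrightarrow> (\<exists>b. (b, a) \<in> D \<and> f b = x) \<longleftrightarrow> rt (f a) = Some x"
    for D and f :: "nat \<Rightarrow> 'l" and x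
  proof -
    have DD: "\<And>b a. (b, a) \<in> D \<Longrightarrow> b < a \<and> a < n" "\<And>b a a'. (b, a) \<in> D \<Longrightarrow> (b, a') \<in> D \<Longrightarrow> a = a'"
      "\<And>b b' a. (b, a) \<in> D \<Longrightarrow> (b', a) \<in> D \<Longrightarrow> b = b'"
      using D unfolding chains_def by blast+
    let ?R = "{a. a < n \<and> f a = x \<and> (\<exists>c. (a, c) \<in> D)}"
    have "bij_betw (\<lambda>a. THE c. (a, c) \<in> D) ?R {c \<in> {..<n}. rt (f c) = Some x}"
    proof (rule bij_betw_byWitness[where f' = "\<lambda>c. THE a. (a, c) \<in> D"])
      have T: "(THE c. (a, c) \<in> D) = c" "(THE a. (a, c) \<in> D) = a" if "(a, c) \<in> D" for a c
        using that DD by blast+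
      show "\<forall>a\<in>?R. (THE a'. (a', THE c. (a, c) \<in> D) \<in> D) = a" using T by auto
      have R: "\<exists>b. (b, c) \<in> D \<and> f b = x \<and> b < n" if "c < n" "rt (f c) = Some x" for c
        using rt[of c x] that DD(1) by fastforce
      show "\<forall>a'\<in>{c \<in> {..<n}. rt (f c) = Some x}. (THE c. (THE a. (a, a') \<in> D, c) \<in> D) = a'"
      proof
        fix c assume "c \<in> {c \<in> {..<n}. rt (f c) = Some x}"
        then obtain b where "(b, c) \<in> D" using R by auto
        then show "(THE c'. (THE a. (a, c) \<in> D, c') \<in> D) = c" using T by simp
      qed
      show "(\<lambda>a. THE c. (a, c) \<in> D) ` ?R \<subseteq> {c \<in> {..<n}. rt (f c) = Some x}"
      proof
        fix c assume "c \<in> (\<lambda>a. THE c. (a, c) \<in> D) ` ?R"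
        then obtain a where "f a = x" "(a, c) \<in> D" using T by auto
        then show "c \<in> {c \<in> {..<n}. rt (f c) = Some x}" using DD(1) rt[of c x] by auto
      qed
      show "(\<lambda>c. THE a. (a, c) \<in> D) ` {c \<in> {..<n}. rt (f c) = Some x} \<subseteq> ?R"
      proof
        fix a assume "a \<in> (\<lambda>c. THE a. (a, c) \<in> D) ` {c \<in> {..<n}. rt (f c) = Some x}"
        then obtain c where c: "c < n" "rt (f c) = Some x" "a = (THE a. (a, c) \<in> D)" by auto
        then obtain b where "(b, c) \<in> D" "f b = x" "b < n" using R by blast
        then show "a \<in> ?R" using T c(3) by auto
      qed
    qed
    then have "card ?R = card {c \<in> {..<n}. rt (f c) = Some x}" by (rule bij_betw_same_card)
    moreover have "{a \<in> H D. f a = x} = {a \<in> {..<n}. f a = x} - ?R" by (auto simp: H_def)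
    moreover have "?R \<subseteq> {a \<in> {..<n}. f a = x}" "finite ?R" by auto
    ultimately show ?thesis by (simp add: card_Diff_subset)
  qed
  have "card {a \<in> H D. f a = x} = card {a \<in> H D'. f' a = x}" for x
    using heads[OF D rt, of x] heads[OF D' rt', of x] cnt
      label_count[of "{..<n}" "{..<n}" f f' "\<lambda>y. rt y = Some x"] by simp
  then obtain \<phi> where \<phi>: "bij_betw \<phi> (H D) (H D')" "\<And>a. a \<in> H D \<Longrightarrow> f' (\<phi> a) = f a"
    using label_preserving_bij[of "H D" "H D'" f f'] by (auto simp: H_def)
  define w where "w = chain_ext n D D' \<phi>"
  have w_head: "w a = \<phi> a" if "a \<in> H D" for a
    unfolding w_def by (subst chain_ext.simps) (use that in \<open>auto simp: H_def\<close>)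
  have w_root: "w a = (SOME b. (b, w c) \<in> D')" if "(a, c) \<in> D" for a c
  proof -
    have "(SOME c. a < c \<and> c < n \<and> (a, c) \<in> D) = c" using DD that by (intro some_equality) blast+
    then show ?thesis
      unfolding w_def by (subst chain_ext.simps) (use that DD(1) in auto)
  qed
  have w: "w a < n \<and> f' (w a) = f a \<and> (\<forall>c. (a, c) \<in> D \<longrightarrow> (w a, w c) \<in> D')" if "a < n" for a
    using that
  proof (induction "n - a" arbitrary: a rule: less_induct)
    case less
    show ?case
    proof (cases "a \<in> H D")
      case True
      then show ?thesis using w_head[OF True] \<phi>(2)[OF True] bij_betwE[OF \<phi>(1)] by (auto simp: H_def)
    next
      case False
      then obtain c where c: "(a, c) \<in> D" using less.prems by (auto simp: H_def)
      have "w c < n" "f' (w c) = f c" using less.hyps[of c] DD(1)[OF c] by auto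
      then have "\<exists>b. (b, w c) \<in> D' \<and> f' b = f a"
        using rt[of c "f a"] rt'[of "w c" "f a"] DD(1)[OF c] c by auto
      then obtain b where b: "(b, w c) \<in> D'" "f' b = f a" by blast
      then have "w a = b" unfolding w_root[OF c] using DD'(3) by (intro some_equality) blast+
      then show ?thesis using b DD'(1)[OF b(1)] DD(2) c by auto
    qed
  qed
  have w_row: "a \<in> H D \<longleftrightarrow> w a \<in> H D'" if "a < n" for a
    using w[OF that] w_head[of a] bij_betwE[OF \<phi>(1)] that by (auto simp: H_def)
  have inj: "a = a'" if "a < n" "a' < n" "w a = w a'" for a a'
    using that
  proof (induction "n - a" arbitrary: a a' rule: less_induct)
    case less
    show ?case
    proof (cases "a \<in> H D")
      case True
      then have "a' \<in> H D" using w_row[OF less.prems(1)] w_row[OF less.prems(2)] less.prems(3) by simp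
      then show ?thesis
        using True less.prems(3) bij_betw_imp_inj_on[OF \<phi>(1)] by (simp add: w_head inj_on_def)
    next
      case False
      then have "a' \<notin> H D" using w_row[OF less.prems(1)] w_row[OF less.prems(2)] less.prems(3) by simp
      then obtain c c' where c: "(a, c) \<in> D" "(a', c') \<in> D"
        using False less.prems by (auto simp: H_def)
      then have "(w a, w c) \<in> D'" "(w a', w c') \<in> D'" using w less.prems by blast+
      then have "w c = w c'" using DD'(2) less.prems(3) by metis
      moreover have "n - c < n - a" "c < n" "c' < n" using DD(1)[OF c(1)] DD(1)[OF c(2)] by linarith+
      ultimately have "c = c'" using less.hyps by blast
      then show ?thesis using c DD(3) by blast
    qed
  qed
  define v where "v a = (if a < n then w a else a)" for a
  have "inj_on v {..<n}" using inj by (auto simp: inj_on_def v_def)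
  moreover have "v ` {..<n} \<subseteq> {..<n}" using w by (auto simp: v_def)
  ultimately have "bij_betw v {..<n} {..<n}" by (simp add: bij_betw_def endo_inj_surj)
  then have perm: "v permutes {..<n}" by (rule bij_imp_permutes) (simp add: v_def)
  show thesis
  proof (rule that[OF perm])
    show "f' (v a) = f a" if "a < n" for a using w that by (simp add: v_def)
    show "map_prod v v ` D = D'"
    proof
      show "map_prod v v ` D \<subseteq> D'"
      proof
        fix p assume "p \<in> map_prod v v ` D"
        then obtain b a where ba: "(b, a) \<in> D" "p = (v b, v a)" by auto
        moreover have "b < n" "a < n" using DD(1)[OF ba(1)] by auto
        ultimately show "p \<in> D'" using w[of b] by (simp add: v_def)
      qed
      show "D' \<subseteq> map_prod v v ` D"
      proof
        fix p assume p: "p \<in> D'"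
        obtain b' a' where ba: "p = (b', a')" by (cases p)
        have "a' < n" using DD'(1) p ba by blast
        then have "a' \<in> v ` {..<n}" using permutes_image[OF perm] by simp
        then obtain a where a: "a < n" "v a = a'" by auto
        then have "rt (f a) = Some (f' b')"
          using rt'[OF \<open>a' < n\<close>, of "f' b'"] p ba w[OF a(1)] by (auto simp: v_def)
        then obtain b where b: "(b, a) \<in> D" using rt[OF a(1)] by blast
        then have "b < n" using DD(1) by fastforce
        moreover from this have "(w b, w a) \<in> D'" using w b by blast
        ultimately have "(v b, a') \<in> D'" using a by (simp add: v_def)
        then have "v b = b'" using DD'(3) p ba by blast
        then show "p \<in> map_prod v v ` D" using b a ba by (auto intro!: image_eqI[of _ _ "(b, a)"])
      qed
    qed
  qed
qed

text \<open>A vector is a matrix supported in column 0, so that applying \<open>h\<close> is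
  multiplication in the ring.\<close>

definition colvecs :: "nat set \<Rightarrow> 'a :: ring_1 cfm set" where
  "colvecs A = {v. \<forall>i j. ent v i j \<noteq> 0 \<longrightarrow> i \<in> A \<and> j = 0}"

lemma card_colvecs:
  assumes "finite A"
  shows "finite (colvecs A :: 'a :: {finite, ring_1} cfm set)"
    and "card (colvecs A :: 'a cfm set) = card (UNIV :: 'a set) ^ card A"
proof -
  let ?F = "A \<rightarrow>\<^sub>E (UNIV :: 'a set)"
  define g :: "(nat \<Rightarrow> 'a) \<Rightarrow> 'a cfm" where "g f = Cfm (\<lambda>i j. if i \<in> A \<and> j = 0 then f i else 0)" for f
  have g: "ent (g f) i j = (if i \<in> A \<and> j = 0 then f i else 0)" for f i j
    unfolding g_def
  proof (subst ent_Cfm)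
    fix j :: nat
    have "{i. (if i \<in> A \<and> j = 0 then f i else 0) \<noteq> 0} \<subseteq> A" by auto
    then show "finite {i. (if i \<in> A \<and> j = 0 then f i else 0) \<noteq> 0}"
      using assms by (rule finite_subset)
  qed simp
  have bij: "bij_betw g ?F (colvecs A)"
  proof (rule bij_betw_byWitness[where f' = "\<lambda>v. \<lambda>i\<in>A. ent v i 0"])
    show "\<forall>f\<in>?F. (\<lambda>i\<in>A. ent (g f) i 0) = f" by (auto simp: g PiE_def extensional_def restrict_def)
    show "\<forall>v\<in>colvecs A. g (\<lambda>i\<in>A. ent v i 0) = v"
    proof (intro ballI cfm_eqI)
      fix v :: "'a cfm" and i j assume "v \<in> colvecs A"
      then show "ent (g (\<lambda>i\<in>A. ent v i 0)) i j = ent v i j" unfolding g by (auto simp: colvecs_def)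
    qed
    show "g ` ?F \<subseteq> colvecs A" by (auto simp: colvecs_def g split: if_splits)
    show "(\<lambda>v. \<lambda>i\<in>A. ent v i 0) ` colvecs A \<subseteq> ?F" by auto
  qed
  show "finite (colvecs A :: 'a cfm set)"
    using bij_betw_finite[OF bij] assms by (simp add: finite_PiE)
  show "card (colvecs A :: 'a cfm set) = card (UNIV :: 'a set) ^ card A"
    using bij_betw_same_card[OF bij] assms by (simp add: card_PiE)
qed

text \<open>A field has at least two elements, so the exponent can be read off from the
  power.\<close>

lemma colvecs_card_inj:
  assumes "finite A" "finite B" "card (colvecs A :: 'a :: {finite, field} cfm set) = card (colvecs B :: 'a cfm set)"
  shows "card A = card B"
proof -
  have "card {0, 1 :: 'a} \<le> card (UNIV :: 'a set)" by (rule card_mono) auto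
  then have "1 < card (UNIV :: 'a set)" by simp
  then show ?thesis using assms by (simp add: card_colvecs)
qed

section \<open>Subquotients of the flag of column vectors\<close>

context blocks
begin

text \<open>\<open>Ble l\<close> indexes the \<open>l\<close>-th step of the flag and
  \<open>Beq l\<close> its graded piece; \<open>pl l\<close> is the projection from the step to the
  piece, realised on coordinates.\<close>

definition Ble :: "nat \<Rightarrow> nat set" where "Ble l = {i. i < n \<and> blk i \<le> l}"
definition Beq :: "nat \<Rightarrow> nat set" where "Beq l = {i. i < n \<and> blk i = l}"
definition pl :: "nat \<Rightarrow> 'a :: ring_1 cfm \<Rightarrow> 'a cfm" where "pl l v = pr {i. blk i = l} * v"

text \<open>
  Subquotients of the \<open>l\<close>-th graded piece of the flag of column vectors, cut out by following \<open>h\<close>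
  downwards along a word. They depend on \<open>h\<close> functorially.
\<close>

primrec chain_space :: "'a :: ring_1 cfm \<Rightarrow> chain_word \<Rightarrow> nat \<Rightarrow> 'a cfm set" where
  "chain_space h Top l = colvecs (Beq l)"
| "chain_space h Bot l = {pl l v | v. v \<in> colvecs (Ble l) \<and> h * v = 0}"
| "chain_space h (Step k x) l = {pl l v | v. v \<in> colvecs (Ble l) \<and> h * v \<in> colvecs (Ble k) \<and>
     pl k (h * v) \<in> chain_space h x k}"

lemma ent_pl: "ent (pl l v) i j = (if blk i = l then ent v i j else 0)"
  by (simp add: pl_def)

lemma pl_colvecs: "v \<in> colvecs (Ble l) \<Longrightarrow> pl l v \<in> colvecs (Beq l)"
  by (auto simp: colvecs_def Ble_def Beq_def ent_pl)

lemma Beq_Ble: "v \<in> colvecs (Beq l) \<Longrightarrow> v \<in> colvecs (Ble l)"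
  by (auto simp: colvecs_def Ble_def Beq_def)

lemma pl_id: "v \<in> colvecs (Beq l) \<Longrightarrow> pl l v = v"
  by (rule cfm_eqI) (auto simp: colvecs_def Beq_def ent_pl)

lemma UT_colvecs: "UT q \<Longrightarrow> v \<in> colvecs (Ble l) \<Longrightarrow> q * v \<in> colvecs (Ble l)"
  unfolding colvecs_def Ble_def
  by (clarsimp, elim ent_times_neq0) (metis UT_D blk_le_in order_trans)

text \<open>A triangular \<open>q\<close> does not move coordinates from earlier blocks up into
  block \<open>l\<close>. Thus \<open>q\<close> induces a map on the graded piece.\<close>

lemma pl_times_pl:
  assumes "UT q" "v \<in> colvecs (Ble l)"
  shows "pl l (q * pl l v) = pl l (q * v)"
proof (rule cfm_eqI)
  fix i j
  have "ent (q * (v - pl l v)) i j = 0" if "blk i = l"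
  proof (rule ccontr)
    assume "ent (q * (v - pl l v)) i j \<noteq> 0"
    then obtain k where k: "ent q i k \<noteq> 0" "ent (v - pl l v) k j \<noteq> 0" by (rule ent_times_neq0)
    then have "blk k \<noteq> l" "ent v k j \<noteq> 0" by (auto simp: ent_pl split: if_splits)
    then have "blk k < l" using assms(2) by (fastforce simp: colvecs_def Ble_def)
    then show False using UT_D[OF assms(1) k(1)] that by simp
  qed
  then show "ent (pl l (q * pl l v)) i j = ent (pl l (q * v)) i j"
    by (simp add: ent_pl right_diff_distrib)
qed

text \<open>Matrices with the same diagonal blocks induce the same map on each graded piece.\<close>

lemma pl_NIL:
  assumes "NIL (p - q)" "v \<in> colvecs (Ble l)"
  shows "pl l (p * v) = pl l (q * v)"
proof (rule cfm_eqI)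
  fix i j
  have "ent ((p - q) * v) i j = 0" if "blk i = l"
  proof (rule ccontr)
    assume "ent ((p - q) * v) i j \<noteq> 0"
    then obtain k where k: "ent (p - q) i k \<noteq> 0" "ent v k j \<noteq> 0" by (rule ent_times_neq0)
    then have "blk k \<le> l" using assms(2) by (fastforce simp: colvecs_def Ble_def)
    then show False using NIL_D[OF assms(1) k(1)] that by simp
  qed
  then show "ent (pl l (p * v)) i j = ent (pl l (q * v)) i j"
    by (simp add: ent_pl left_diff_distrib)
qed

text \<open>In \<open>h' * (q * u) = p * (h * u)\<close> the argument is moved by \<open>q\<close>
  but the value by \<open>p\<close>. The next level of the recursion sees only the leading part of
  the value, where \<open>p\<close> and \<open>q\<close> agree by \<open>pl_NIL\<close>; so
  \<open>q\<close> alone can be carried through the induction.\<close>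

lemma chain_space_transport:
  assumes p: "UT p" and q: "UT q" and pq: "NIL (p - q)" "p * h = h' * q"
    and v: "v \<in> chain_space h w l"
  shows "pl l (q * v) \<in> chain_space h' w l"
  using v
proof (induction w arbitrary: l v)
  case Top
  then show ?case using UT_colvecs[OF q] Beq_Ble by (auto intro!: pl_colvecs)
next
  case Bot
  then obtain u where u: "v = pl l u" "u \<in> colvecs (Ble l)" "h * u = 0" by auto
  have "h' * (q * u) = p * (h * u)" by (simp add: pq(2) flip: mult.assoc)
  then have "h' * (q * u) = 0" using u by simp
  then show ?case using UT_colvecs[OF q u(2)] pl_times_pl[OF q u(2)] u(1) by auto
next
  case (Step k x)
  then obtain u where u: "v = pl l u" "u \<in> colvecs (Ble l)" "h * u \<in> colvecs (Ble k)"
    "pl k (h * u) \<in> chain_space h x k" by auto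
  have hu: "h' * (q * u) = p * (h * u)" by (simp add: pq(2) flip: mult.assoc)
  have "pl k (h' * (q * u)) = pl k (q * pl k (h * u))"
    unfolding hu pl_NIL[OF pq(1) u(3)] pl_times_pl[OF q u(3)] ..
  then have "pl k (h' * (q * u)) \<in> chain_space h' x k" using Step.IH[OF u(4)] by simp
  moreover have "h' * (q * u) \<in> colvecs (Ble k)" using hu UT_colvecs[OF p u(3)] by simp
  ultimately show ?case using UT_colvecs[OF q u(2)] pl_times_pl[OF q u(2)] u(1) by auto
qed

lemma chain_space_subset: "chain_space h w l \<subseteq> colvecs (Beq l)"
  by (cases w) (auto intro: pl_colvecs)

lemma chain_space_card_le:
  fixes h h' :: "'a :: {finite, field} cfm"
  assumes "eqv h h'"
  shows "card (chain_space h w l) \<le> card (chain_space h' w l)"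
proof -
  obtain p p' q q' where *: "unit_pair p p'" "unit_pair q q'" "NIL (p - q)" "p * h = h' * q"
    using assms unfolding eqv_def by blast
  then have UT: "UT p" "UT q" "UT q'" "q' * q = 1" by (auto simp: unit_pair_def)
  have "finite (colvecs (Beq l) :: 'a cfm set)" by (rule card_colvecs) (simp add: Beq_def)
  then have fin: "finite (chain_space h' w l)" by (rule finite_subset[OF chain_space_subset])
  have "inj_on (\<lambda>v. pl l (q * v)) (chain_space h w l)"
  proof (rule inj_on_inverseI[where g = "\<lambda>v. pl l (q' * v)"])
    fix v assume "v \<in> chain_space h w l"
    then have v: "v \<in> colvecs (Beq l)" using chain_space_subset by blast
    have "pl l (q' * pl l (q * v)) = pl l (q' * (q * v))"
      using pl_times_pl[OF UT(3) UT_colvecs[OF UT(2) Beq_Ble[OF v]]] .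
    also have "q' * (q * v) = v" using UT(4) by (simp flip: mult.assoc)
    finally show "pl l (q' * pl l (q * v)) = v" using pl_id[OF v] by simp
  qed
  moreover have "(\<lambda>v. pl l (q * v)) ` chain_space h w l \<subseteq> chain_space h' w l"
    using chain_space_transport[OF UT(1,2) *(3,4)] by auto
  ultimately show ?thesis using fin by (rule card_inj_on_le)
qed

end

text \<open>
  Here \<open>Z\<close> is the set of pivot columns of the block-diagonal matrix \<open>d\<close>, which are linearly
  independent because of \<open>G * d = pr Z\<close>.
\<close>

locale normal_form = blocks +
  fixes D :: "(nat \<times> nat) set" and Z :: "nat set" and d G h :: "'a :: {finite, field} cfm"
  assumes chains: "chains n D"
    and D_blk: "(b, a) \<in> D \<Longrightarrow> blk b < blk a"
    and d_blk: "ent d i j \<noteq> 0 \<Longrightarrow> blk i = blk j \<and> j \<in> Z"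
    and D_row: "(b, a) \<in> D \<Longrightarrow> ent d b j = 0"
    and D_col: "(b, a) \<in> D \<Longrightarrow> a \<notin> Z"
    and G: "G * d = pr Z"
    and h: "ent h i j = ent d i j + (if (i, j) \<in> D then 1 else 0)"
begin

lemma D_D: "(b, a) \<in> D \<Longrightarrow> b < a \<and> a < n" "(b, a) \<in> D \<Longrightarrow> (b, a') \<in> D \<Longrightarrow> a = a'"
    "(b, a) \<in> D \<Longrightarrow> (b', a) \<in> D \<Longrightarrow> b = b'"
  using chains unfolding chains_def by blast+

text \<open>The guard \<open>b < a\<close> ensures termination; roots of \<open>D\<close> satisfy it
  by \<open>chains\<close>. Roots are read from column to row, so the word of \<open>a\<close>
  describes the images of the basis vector at \<open>a\<close> under repeated application of
  \<open>h\<close>.\<close>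

function wd :: "nat \<Rightarrow> chain_word" where
  "wd a = (if a \<in> Z then Top else if \<exists>b. b < a \<and> (b, a) \<in> D
     then Step (blk (SOME b. b < a \<and> (b, a) \<in> D)) (wd (SOME b. b < a \<and> (b, a) \<in> D)) else Bot)"
  by pat_completeness auto
termination
proof (relation "measure (\<lambda>a. a)", simp)
  fix a assume "\<exists>b. b < a \<and> (b, a) \<in> D"
  then have "(SOME b. b < a \<and> (b, a) \<in> D) < a" by (rule someI2_ex) simp
  then show "(SOME b. b < a \<and> (b, a) \<in> D, a) \<in> measure (\<lambda>a. a)" by simp
qed

declare wd.simps [simp del]

lemma wd_pivot: "a \<in> Z \<Longrightarrow> wd a = Top"
  by (subst wd.simps) simp

lemma wd_root:
  assumes "(b, a) \<in> D" shows "wd a = Step (blk b) (wd b)"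
proof -
  have "(SOME b. b < a \<and> (b, a) \<in> D) = b" using D_D assms by (intro some_equality) blast+
  moreover have "\<exists>b. b < a \<and> (b, a) \<in> D" "a \<notin> Z" using assms D_D D_col by blast+
  ultimately show ?thesis by (subst wd.simps) simp
qed

lemma wd_none: "a \<notin> Z \<Longrightarrow> \<nexists>b. (b, a) \<in> D \<Longrightarrow> wd a = Bot"
  by (subst wd.simps) auto

lemma wd_cases:
  obtains "a \<in> Z" "wd a = Top" | b where "a \<notin> Z" "(b, a) \<in> D" "wd a = Step (blk b) (wd b)"
  | "a \<notin> Z" "\<nexists>b. (b, a) \<in> D" "wd a = Bot"
  using wd_pivot wd_root wd_none D_col by metis

text \<open>Along a chain the block numbers decrease strictly. For such words the value
  \<open>h * v\<close> in the recursion of \<open>chain_space\<close> has no part left in the block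
  of \<open>v\<close>, which is what excludes pivot coordinates.\<close>

primrec descending :: "chain_word \<Rightarrow> nat \<Rightarrow> bool" where
  "descending Top l = True"
| "descending Bot l = True"
| "descending (Step k x) l = (k < l \<and> descending x k)"

lemma descending_wd: "descending (wd a) (blk a)"
proof (induction a rule: less_induct)
  case (less a)
  show ?case
  proof (cases a rule: wd_cases)
    case (2 b)
    then show ?thesis using less[of b] D_D(1) D_blk by simp
  qed auto
qed

text \<open>On the graded piece of block \<open>l\<close> only \<open>d\<close> acts, since a root
  from block \<open>l\<close> ends in a later block. So \<open>d\<close> annihilates the leading
  part of \<open>v\<close>, and multiplying by \<open>G\<close> isolates its pivot
  coordinates.\<close>

lemma pivot_coordinates:
  assumes v: "v \<in> colvecs (Ble l)" and z: "pl l (h * v) = 0" and a: "a \<in> Z" "blk a = l"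
  shows "ent v a 0 = 0"
proof -
  have "d * pl l v = pl l (h * v)"
  proof (rule cfm_eqI)
    fix i j
    let ?S = "{k. ent v k j \<noteq> 0}"
    have "ent (d * pl l v) i j = (\<Sum>k\<in>?S. ent d i k * ent (pl l v) k j)"
      by (rule ent_times_sum) (auto simp: ent_pl split: if_splits)
    also have "\<dots> = (if blk i = l then \<Sum>k\<in>?S. ent h i k * ent v k j else 0)"
    proof (cases "blk i = l")
      case True
      have "ent d i k * ent (pl l v) k j = ent h i k * ent v k j" if "k \<in> ?S" for k
      proof -
        have "blk k \<le> l" using v that by (auto simp: colvecs_def Ble_def)
        then have "(i, k) \<notin> D" using D_blk[of i k] True by auto
        then have "ent h i k = ent d i k" by (simp add: h)
        then show ?thesis using d_blk[of i k] True by (cases "blk k = l") (auto simp: ent_pl)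
      qed
      then show ?thesis using True by simp
    next
      case False
      have "ent d i k * ent (pl l v) k j = 0" for k
        using d_blk[of i k] False by (auto simp: ent_pl)
      then have "(\<Sum>k\<in>?S. ent d i k * ent (pl l v) k j) = 0" by (intro sum.neutral) blast
      then show ?thesis using False by simp
    qed
    finally show "ent (d * pl l v) i j = ent (pl l (h * v)) i j" by (simp add: ent_pl ent_times)
  qed
  then have "pr Z * pl l v = 0" using z G by (metis mult.assoc mult_zero_right)
  then have "ent (pr Z * pl l v) a 0 = 0" by simp
  then show ?thesis using a by (simp add: ent_pl)
qed

text \<open>Row \<open>b\<close> of \<open>d\<close> vanishes and \<open>D\<close> has only one root
  in it, so row \<open>b\<close> of \<open>h\<close> is a unit vector.\<close>

lemma root_coordinate:
  assumes "(b, a) \<in> D" shows "ent (h * v) b j = ent v a j"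
proof -
  have hb: "ent h b k = (if k = a then 1 else 0)" for k
  proof -
    have "(b, k) \<in> D \<longleftrightarrow> k = a" using D_D(2)[OF assms, of k] assms by blast
    then show ?thesis using D_row[OF assms, of k] by (simp add: h)
  qed
  have "ent (h * v) b j = (\<Sum>k\<in>{a}. ent h b k * ent v k j)"
    by (rule ent_times_sum) (auto simp: hb split: if_splits)
  then show ?thesis by (simp add: hb)
qed

text \<open>Upper bound: pivot coordinates vanish by \<open>pivot_coordinates\<close>, and a
  coordinate of \<open>v\<close> at the column of a root reappears in \<open>h * v\<close> at its
  row, where the condition on \<open>h * v\<close> bounds the rest of the word. Lower bound: a
  vector spanned by indices with small words is its own lift to the flag.\<close>

lemma chain_space_eq:
  assumes "descending w l"
  shows "chain_space h w l = colvecs {a \<in> Beq l. wd a \<le> w}"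
  using assms
proof (induction w arbitrary: l)
  case Top
  then show ?case by (simp add: le_Top)
next
  case Bot
  show ?case
  proof
    show "chain_space h Bot l \<subseteq> colvecs {a \<in> Beq l. wd a \<le> Bot}"
    proof
      fix u assume "u \<in> chain_space h Bot l"
      then obtain v where v: "u = pl l v" "v \<in> colvecs (Ble l)" "h * v = 0" by auto
      have "wd a = Bot" if "ent v a 0 \<noteq> 0" "blk a = l" for a
        using that pivot_coordinates[OF v(2) _ _ that(2)] root_coordinate[of _ a v 0] v(3)
        by (cases a rule: wd_cases) (auto simp: pl_def)
      then show "u \<in> colvecs {a \<in> Beq l. wd a \<le> Bot}"
        using pl_colvecs[OF v(2)] v(1) by (auto simp: colvecs_def le_Bot ent_pl split: if_splits)
    qed
    show "colvecs {a \<in> Beq l. wd a \<le> Bot} \<subseteq> chain_space h Bot l"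
    proof
      fix v :: "'a cfm" assume v: "v \<in> colvecs {a \<in> Beq l. wd a \<le> Bot}"
      then have vB: "v \<in> colvecs (Beq l)" by (auto simp: colvecs_def)
      have "h * v = 0"
      proof (rule cfm_eqI, rule ccontr)
        fix i j assume "ent (h * v) i j \<noteq> ent 0 i j"
        then obtain a where a: "ent h i a \<noteq> 0" "ent v a j \<noteq> 0" by (auto elim: ent_times_neq0)
        then have "wd a = Bot" using v by (auto simp: colvecs_def le_Bot)
        then show False using a(1) d_blk[of i a] wd_pivot[of a] wd_root[of i a]
          by (auto simp: h split: if_splits)
      qed
      then show "v \<in> chain_space h Bot l" using pl_id[OF vB] Beq_Ble[OF vB] by (auto intro!: exI[of _ v])
    qed
  qed
next
  case (Step k x)
  then have kl: "k < l" and IH: "chain_space h x k = colvecs {a \<in> Beq k. wd a \<le> x}" by auto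
  show ?case
  proof
    show "chain_space h (Step k x) l \<subseteq> colvecs {a \<in> Beq l. wd a \<le> Step k x}"
    proof
      fix u assume "u \<in> chain_space h (Step k x) l"
      then obtain v where v: "u = pl l v" "v \<in> colvecs (Ble l)" "h * v \<in> colvecs (Ble k)"
        "pl k (h * v) \<in> colvecs {a \<in> Beq k. wd a \<le> x}" using IH by auto
      have z: "pl l (h * v) = 0"
      proof (rule cfm_eqI)
        fix i j
        have "ent (h * v) i j \<noteq> 0 \<Longrightarrow> blk i \<le> k"
          using v(3) unfolding colvecs_def Ble_def by blast
        then show "ent (pl l (h * v)) i j = ent 0 i j"
          using kl by (cases "ent (h * v) i j = 0") (auto simp: ent_pl)
      qed
      have "wd a \<le> Step k x" if a: "ent v a 0 \<noteq> 0" "blk a = l" for a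
      proof (cases a rule: wd_cases)
        case 1
        then show ?thesis using pivot_coordinates[OF v(2) z _ a(2)] a by simp
      next
        case (2 b)
        then have b: "ent (h * v) b 0 \<noteq> 0" using root_coordinate a by simp
        then have "blk b \<le> k" using v(3) by (auto simp: colvecs_def Ble_def)
        moreover have "wd b \<le> x" if "blk b = k"
          using v(4) b that by (auto simp: colvecs_def ent_pl)
        ultimately show ?thesis using 2 by auto
      qed simp
      then show "u \<in> colvecs {a \<in> Beq l. wd a \<le> Step k x}"
        using pl_colvecs[OF v(2)] v(1) by (auto simp: colvecs_def ent_pl split: if_splits)
    qed
    show "colvecs {a \<in> Beq l. wd a \<le> Step k x} \<subseteq> chain_space h (Step k x) l"
    proof
      fix v :: "'a cfm" assume v: "v \<in> colvecs {a \<in> Beq l. wd a \<le> Step k x}"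
      then have vB: "v \<in> colvecs (Beq l)" by (auto simp: colvecs_def)
      \<comment> \<open>No index in the support of \<open>v\<close> is a pivot, so \<open>h\<close>
        only follows roots on it: every contributing entry of \<open>h\<close> is a root
        \<open>(i, a)\<close>, and comparing words lexicographically gives the two
        alternatives.\<close>
      have hv: "i < n \<and> j = 0 \<and> (blk i < k \<or> blk i = k \<and> wd i \<le> x)" if ne: "ent (h * v) i j \<noteq> 0" for i j
      proof -
        obtain a where a: "ent h i a \<noteq> 0" "ent v a j \<noteq> 0" using ent_times_neq0[OF ne] by metis
        then have w: "wd a \<le> Step k x" "j = 0" using v by (auto simp: colvecs_def)
        then have "a \<notin> Z" using wd_pivot[of a] by auto
        then have "(i, a) \<in> D" using a(1) d_blk[of i a] by (auto simp: h split: if_splits)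
        then show ?thesis using w wd_root[of i a] D_D(1)[of i a] by auto
      qed
      have "h * v \<in> colvecs (Ble k)"
        unfolding colvecs_def Ble_def mem_Collect_eq
      proof (intro allI impI)
        fix i j assume "ent (h * v) i j \<noteq> 0"
        from hv[OF this] show "(i < n \<and> blk i \<le> k) \<and> j = 0" by auto
      qed
      moreover have "pl k (h * v) \<in> chain_space h x k"
        unfolding IH colvecs_def Beq_def mem_Collect_eq
      proof (intro allI impI)
        fix i j assume "ent (pl k (h * v)) i j \<noteq> 0"
        then have "ent (h * v) i j \<noteq> 0" "blk i = k" by (auto simp: ent_pl split: if_splits)
        with hv[OF this(1)] show "((i < n \<and> blk i = k) \<and> wd i \<le> x) \<and> j = 0" by auto
      qed
      ultimately show "v \<in> chain_space h (Step k x) l"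
        using pl_id[OF vB] Beq_Ble[OF vB] by (auto intro!: exI[of _ v])
    qed
  qed
qed

end

section \<open>Invariance of the label counts\<close>

definition next_label :: "nat \<times> chain_word \<Rightarrow> (nat \<times> chain_word) option" where
  "next_label p = (case snd p of Step k x \<Rightarrow> Some (k, x) | _ \<Rightarrow> None)"

lemma normal_form_unique:
  fixes h h' :: "'a :: {finite, field} cfm"
  assumes "normal_form n blk D Z d G h" "normal_form n blk D' Z' d' G' h'" "blocks.eqv blk h h'"
  obtains w where "w permutes {..<n}" "\<And>a. a < n \<Longrightarrow> blk (w a) = blk a" "map_prod w w ` D = D'"
proof -
  interpret A: normal_form n blk D Z d G h by (rule assms)
  interpret B: normal_form n blk D' Z' d' G' h' by (rule assms)
  have desc: "A.descending = B.descending"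
  proof (intro ext)
    fix w l show "A.descending w l = B.descending w l"
      by (induction w arbitrary: l) (simp_all only: A.descending.simps B.descending.simps)
  qed
  have ceq: "card (A.chain_space h w l) = card (A.chain_space h' w l)" for w l
    using A.chain_space_card_le[OF assms(3)] A.chain_space_card_le[OF A.eqv_sym[OF assms(3)]]
    by (simp add: le_antisym)
  have "card {a \<in> A.Beq l. A.wd a \<le> w} = card {a \<in> A.Beq l. B.wd a \<le> w}"
    if "A.descending w l" for w l
  proof (rule colvecs_card_inj[where ?'a = 'a])
    show "card (colvecs {a \<in> A.Beq l. A.wd a \<le> w} :: 'a cfm set) = card (colvecs {a \<in> A.Beq l. B.wd a \<le> w} :: 'a cfm set)"
      using ceq[of w l] A.chain_space_eq[OF that] B.chain_space_eq[of w l] that desc by metis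
  qed (auto simp: A.Beq_def)
  then have eq: "card {a \<in> A.Beq l. A.wd a = w} = card {a \<in> A.Beq l. B.wd a = w}" for w l
    by (intro level_sets_card_eq) (use A.descending_wd B.descending_wd desc in \<open>auto simp: A.Beq_def\<close>)
  \<comment> \<open>Block and word together determine the block and word of the predecessor;
    \<open>next_label\<close> is the function \<open>rt\<close> required by
    \<open>chain_isomorphism\<close>.\<close>
  let ?f = "\<lambda>a. (blk a, A.wd a)" and ?f' = "\<lambda>a. (blk a, B.wd a)"
  have cnt: "card {a \<in> {..<n}. ?f a = x} = card {a \<in> {..<n}. ?f' a = x}" for x
  proof -
    have "{a \<in> {..<n}. ?f a = x} = {a \<in> A.Beq (fst x). A.wd a = snd x}"
      "{a \<in> {..<n}. ?f' a = x} = {a \<in> A.Beq (fst x). B.wd a = snd x}"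
      by (auto simp: A.Beq_def prod_eq_iff)
    then show ?thesis using eq by simp
  qed
  have rtA: "(\<exists>b. (b, a) \<in> D \<and> ?f b = x) \<longleftrightarrow> next_label (?f a) = Some x" for a x
  proof (cases a rule: A.wd_cases)
    case (2 b)
    then have "(\<exists>b. (b, a) \<in> D \<and> ?f b = x) \<longleftrightarrow> ?f b = x" using A.D_D(3)[of _ a b] by blast
    then show ?thesis using 2 by (auto simp: next_label_def)
  qed (use A.D_col in \<open>auto simp: next_label_def\<close>)
  have rtB: "(\<exists>b. (b, a) \<in> D' \<and> ?f' b = x) \<longleftrightarrow> next_label (?f' a) = Some x" for a x
  proof (cases a rule: B.wd_cases)
    case (2 b)
    then have "(\<exists>b. (b, a) \<in> D' \<and> ?f' b = x) \<longleftrightarrow> ?f' b = x" using B.D_D(3)[of _ a b] by blast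
    then show ?thesis using 2 by (auto simp: next_label_def)
  qed (use B.D_col in \<open>auto simp: next_label_def\<close>)
  obtain w where "w permutes {..<n}" "\<And>a. a < n \<Longrightarrow> ?f' (w a) = ?f a" "map_prod w w ` D = D'"
    using chain_isomorphism[OF A.chains B.chains cnt rtA rtB] by metis
  then show thesis using that by simp
qed

section \<open>Parabolic subgroups\<close>

definition emb :: "'a :: ring_1 mat \<Rightarrow> 'a cfm" where
  "emb A = Cfm (\<lambda>i j. if i < dim_row A \<and> j < dim_col A then A $$ (i, j) else 0)"

lemma ent_emb: "ent (emb A) i j = (if i < dim_row A \<and> j < dim_col A then A $$ (i, j) else 0)"
  unfolding emb_def
proof (subst ent_Cfm)
  fix j
  have "{i. (if i < dim_row A \<and> j < dim_col A then A $$ (i, j) else 0) \<noteq> 0} \<subseteq> {..<dim_row A}" by auto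
  then show "finite {i. (if i < dim_row A \<and> j < dim_col A then A $$ (i, j) else 0) \<noteq> 0}"
    by (rule finite_subset) simp
qed simp

lemma emb_times:
  assumes "A \<in> carrier_mat n n" "B \<in> carrier_mat n n"
  shows "emb (A * B) = emb A * emb B"
proof (rule cfm_eqI)
  fix i j
  have "ent (emb A * emb B) i j = (\<Sum>k\<in>{0..<n}. ent (emb A) i k * ent (emb B) k j)"
    by (rule ent_times_sum) (use assms in \<open>auto simp: ent_emb split: if_splits\<close>)
  then show "ent (emb (A * B)) i j = ent (emb A * emb B) i j"
    using assms by (auto simp: ent_emb scalar_prod_def)
qed

lemma emb_add: "A \<in> carrier_mat n n \<Longrightarrow> B \<in> carrier_mat n n \<Longrightarrow> emb (A + B) = emb A + emb B"
  by (rule cfm_eqI) (auto simp: ent_emb)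

lemma emb_minus: "A \<in> carrier_mat n n \<Longrightarrow> B \<in> carrier_mat n n \<Longrightarrow> emb (A - B) = emb A - emb B"
  by (rule cfm_eqI) (auto simp: ent_emb)

lemma emb_one: "emb (1\<^sub>m n) = pr {..<n}"
  by (rule cfm_eqI) (auto simp: ent_emb ent_dg)

definition trunc :: "nat \<Rightarrow> 'a :: ring_1 cfm \<Rightarrow> 'a mat" where
  "trunc n X = mat n n (\<lambda>(i, j). ent X i j)"

lemma trunc_carrier [simp]: "trunc n X \<in> carrier_mat n n"
  by (simp add: trunc_def)

lemma trunc_emb: "A \<in> carrier_mat n n \<Longrightarrow> trunc n (emb A) = A"
  by (rule eq_matI) (auto simp: trunc_def ent_emb)

lemma trunc_one: "trunc n 1 = 1\<^sub>m n"
  by (rule eq_matI) (auto simp: trunc_def ent_one)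

lemma trunc_add: "trunc n (X + Y) = trunc n X + trunc n Y"
  by (rule eq_matI) (auto simp: trunc_def)

lemma finite_carrier_mat: "finite (carrier_mat n n :: 'a :: finite mat set)"
proof (rule finite_imageD)
  let ?f = "\<lambda>A :: 'a mat. restrict (\<lambda>p. A $$ p) ({..<n} \<times> {..<n})"
  have "?f ` carrier_mat n n \<subseteq> ({..<n} \<times> {..<n}) \<rightarrow>\<^sub>E (UNIV :: 'a set)"
    by (intro image_subsetI restrict_PiE_iff[THEN iffD2]) simp
  then show "finite (?f ` carrier_mat n n)" by (rule finite_subset) (simp add: finite_PiE)
  show "inj_on ?f (carrier_mat n n)"
  proof (rule inj_onI)
    fix A B :: "'a mat" assume AB: "A \<in> carrier_mat n n" "B \<in> carrier_mat n n" "?f A = ?f B"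
    show "A = B"
    proof (rule eq_matI)
      fix i j assume "i < dim_row B" "j < dim_col B"
      then show "A $$ (i, j) = B $$ (i, j)"
        using fun_cong[OF AB(3), of "(i, j)"] AB(1,2) by simp
    qed (use AB in auto)
  qed
qed

locale block_type =
  fixes ns :: "nat list"
begin

text \<open>Indices outside the matrix form blocks of their own, so that \<open>bn\<close> is monotone on all of \<open>nat\<close>.\<close>

definition bn :: "nat \<Rightarrow> nat" where
  "bn i = (if i < sum_list ns then LEAST k. i < offset ns (Suc k) else length ns + i)"

abbreviation N :: nat where "N \<equiv> sum_list ns"

lemma offset_Suc: "k < length ns \<Longrightarrow> offset ns (Suc k) = offset ns k + ns ! k"
  by (simp add: offset_def take_Suc_conv_app_nth)

lemma offset_length: "length ns \<le> k \<Longrightarrow> offset ns k = N"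
  by (simp add: offset_def)

lemma offset_mono: "k \<le> l \<Longrightarrow> offset ns k \<le> offset ns l"
proof (induction l)
  case (Suc l)
  have "offset ns l \<le> offset ns (Suc l)"
    by (cases "l < length ns") (simp_all add: offset_Suc offset_length)
  then show ?case using Suc by (cases "k = Suc l") auto
qed simp

lemma bn_segment:
  assumes "i < N" shows "bn i < length ns" "i \<in> segment ns (bn i)"
proof -
  have ne: "ns \<noteq> []" using assms by auto
  then have ex: "i < offset ns (Suc (length ns - 1))" using assms by (simp add: offset_length)
  have bi: "bn i = (LEAST k. i < offset ns (Suc k))" using assms by (simp add: bn_def)
  have "bn i \<le> length ns - 1" unfolding bi using ex by (rule Least_le)
  then show "bn i < length ns" using ne by (simp add: le_less_trans)
  have u: "i < offset ns (Suc (bn i))" unfolding bi using ex by (rule LeastI)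
  have "offset ns (bn i) \<le> i"
  proof (cases "bn i")
    case (Suc k)
    then have "\<not> i < offset ns (Suc k)" unfolding bi by (metis lessI not_less_Least)
    then show ?thesis using Suc by simp
  qed (simp add: offset_def)
  then show "i \<in> segment ns (bn i)" using u by (simp add: segment_def)
qed

lemma bn_eqI:
  assumes "i \<in> segment ns k" "k < length ns" shows "bn i = k" "i < N"
proof -
  have i: "offset ns k \<le> i" "i < offset ns (Suc k)" using assms by (auto simp: segment_def)
  show iN: "i < N" using i(2) offset_mono[of "Suc k" "length ns"] assms(2) by (simp add: offset_length)
  have b: "offset ns (bn i) \<le> i" "i < offset ns (Suc (bn i))"
    using bn_segment(2)[OF iN] by (auto simp: segment_def)
  show "bn i = k"
  proof (rule linorder_cases[of "bn i" k])
    assume "bn i < k"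
    then show ?thesis using offset_mono[of "Suc (bn i)" k] b i by simp
  next
    assume "k < bn i"
    then show ?thesis using offset_mono[of "Suc k" "bn i"] b i by simp
  qed
qed

lemma segment_iff: "k < length ns \<Longrightarrow> i \<in> segment ns k \<longleftrightarrow> i < N \<and> bn i = k"
  using bn_segment bn_eqI by metis

lemma segment_image: "k < length ns \<Longrightarrow> segment ns k = (+) (offset ns k) ` {..<ns ! k}"
  by (auto simp: segment_def offset_Suc image_iff intro: le_Suc_ex dest: less_imp_add_positive)
    (metis add_less_cancel_left le_Suc_ex lessThan_iff)

sublocale blocks N bn
proof
  fix i j :: nat
  show "bn i \<le> bn j" if "i \<le> j"
  proof (cases "j < N")
    case True
    then have "i < N" using that by simp
    show ?thesis
    proof (rule ccontr)
      assume "\<not> bn i \<le> bn j"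
      then have "offset ns (Suc (bn j)) \<le> offset ns (bn i)" by (intro offset_mono) simp
      then show False using bn_segment(2)[OF True] bn_segment(2)[OF \<open>i < N\<close>] that
        by (auto simp: segment_def)
    qed
  next
    case False
    then show ?thesis using that bn_segment(1)[of i] by (cases "i < N") (auto simp: bn_def)
  qed
  show "bn i < bn j" if "i < j" "N \<le> j"
    using that bn_segment(1)[of i] by (cases "i < N") (auto simp: bn_def)
qed

lemma roots_iff: "(i, j) \<in> roots ns \<longleftrightarrow> i < N \<and> j < N \<and> bn i < bn j"
proof
  assume "(i, j) \<in> roots ns"
  then obtain k l where "l < length ns" "k < l" "i \<in> segment ns k" "j \<in> segment ns l"
    by (auto simp: roots_def)
  then show "i < N \<and> j < N \<and> bn i < bn j" using segment_iff[of l j] segment_iff[of k i] by simp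
next
  assume "i < N \<and> j < N \<and> bn i < bn j"
  then show "(i, j) \<in> roots ns" using bn_segment unfolding roots_def by blast
qed

lemma diag_positions_iff: "(i, j) \<in> diag_positions ns \<longleftrightarrow> i < N \<and> j < N \<and> bn i = bn j"
proof
  assume "(i, j) \<in> diag_positions ns"
  then obtain k where "k < length ns" "i \<in> segment ns k" "j \<in> segment ns k"
    by (auto simp: diag_positions_def)
  then show "i < N \<and> j < N \<and> bn i = bn j" using segment_iff[of k j] segment_iff[of k i] by simp
next
  assume a: "i < N \<and> j < N \<and> bn i = bn j"
  then have "i \<in> segment ns (bn i)" "j \<in> segment ns (bn i)" "bn i < length ns"
    using bn_segment by metis+
  then show "(i, j) \<in> diag_positions ns" unfolding diag_positions_def by blast
qed

lemma INS_emb: "A \<in> carrier_mat N N \<Longrightarrow> INS (emb A)"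
  by (auto simp: INS_def ent_emb split: if_splits)

lemma UT_emb:
  "A \<in> carrier_mat N N \<Longrightarrow> supported_on A (diag_positions ns \<union> roots ns) \<longleftrightarrow> UT (emb A)"
  by (auto simp: supported_on_def UT_def ent_emb roots_iff diag_positions_iff le_less)

lemma NIL_emb:
  "A \<in> carrier_mat N N \<Longrightarrow> supported_on A (roots ns) \<longleftrightarrow> NIL (emb A)"
  by (auto simp: supported_on_def NIL_def ent_emb roots_iff)

lemma supported_trunc:
  "UT X \<Longrightarrow> supported_on (trunc N X) (diag_positions ns \<union> roots ns)"
  "NIL X \<Longrightarrow> supported_on (trunc N X) (roots ns)"
  "supported_on (trunc N (dp X)) (diag_positions ns)"
  by (auto simp: supported_on_def trunc_def roots_iff diag_positions_iff UT_def NIL_def ent_dp le_less)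

text \<open>Below \<open>N\<close>, a column of the triangular factor \<open>Y\<close> has no
  entries in rows outside, so the infinite product is already the finite one.\<close>

lemma trunc_times:
  assumes "UT Y" shows "trunc N (X * Y) = trunc N X * trunc N Y"
proof (rule eq_matI)
  fix i j assume "i < dim_row (trunc N X * trunc N Y)" "j < dim_col (trunc N X * trunc N Y)"
  then have ij: "i < N" "j < N" by (auto simp: trunc_def)
  have "ent (X * Y) i j = (\<Sum>k\<in>{0..<N}. ent X i k * ent Y k j)"
    by (rule ent_times_sum) (use UT_D[OF assms] blk_le_in ij in auto)
  then show "trunc N (X * Y) $$ (i, j) = (trunc N X * trunc N Y) $$ (i, j)"
    using ij by (simp add: trunc_def scalar_prod_def)
qed (auto simp: trunc_def)

text \<open>Left multiplication by \<open>g\<close> permutes the finite set of block triangular matrices, which contains 1.\<close>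

lemma parabolic_inverse:
  fixes g :: "'a :: {field, finite} mat"
  assumes "g \<in> parabolic ns"
  obtains g' where "g' \<in> carrier_mat N N" "g * g' = 1\<^sub>m N" "g' * g = 1\<^sub>m N" "UT (emb g')"
proof -
  have g: "g \<in> carrier_mat N N" "UT (emb g)"
    using assms UT_emb by (auto simp: parabolic_def GL_def)
  obtain g0 where g0': "g * g0 = 1\<^sub>m N" "g0 * g = 1\<^sub>m (dim_row g0)"
    using assms by (auto simp: parabolic_def GL_def invertible_mat_def inverts_mat_def)
  have "dim_col (g0 * g) = N" using g by simp
  then have "dim_row g0 = N" unfolding g0'(2) by simp
  moreover have "dim_col g0 = N" using arg_cong[OF g0'(1), of dim_col] by simp
  ultimately have g0: "g0 \<in> carrier_mat N N" "g * g0 = 1\<^sub>m N" "g0 * g = 1\<^sub>m N" using g0' by auto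
  define F where "F = {X :: 'a mat. X \<in> carrier_mat N N \<and> UT (emb X)}"
  have "finite F" unfolding F_def using finite_carrier_mat by (rule rev_finite_subset) auto
  moreover have "(*) g ` F \<subseteq> F" using g by (auto simp: F_def emb_times UT_times)
  moreover have "inj_on ((*) g) F"
  proof (rule inj_on_inverseI[where g = "(*) g0"])
    fix X assume "X \<in> F"
    then have X: "X \<in> carrier_mat N N" by (simp add: F_def)
    have "g0 * (g * X) = g0 * g * X" using g0 g X by (intro assoc_mult_mat[symmetric]) auto
    then show "g0 * (g * X) = X" using g0(3) left_mult_one_mat[OF X] by metis
  qed
  moreover have "1\<^sub>m N \<in> F" by (simp add: F_def emb_one UT_dg)
  ultimately obtain X where X: "X \<in> F" "g * X = 1\<^sub>m N"
    by (metis (no_types, opaque_lifting) endo_inj_surj imageE)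
  then have Xc: "X \<in> carrier_mat N N" by (simp add: F_def)
  have "g0 * (g * X) = g0 * g * X" using g0 g Xc by (intro assoc_mult_mat[symmetric]) auto
  then have "X = g0" using g0 Xc X by simp
  then show thesis using that[of X] X g0 by (auto simp: F_def)
qed

text \<open>\<open>emb\<close> sends the identity matrix to a projection. Completing by the identity
  outside makes the embedding unital, so that invertible matrices become units of the ring.\<close>

definition lift :: "'a :: ring_1 mat \<Rightarrow> 'a cfm" where
  "lift A = emb A + (1 - pr {..<N})"

lemma pr_INS: "INS X \<Longrightarrow> pr {..<N} * X = X" "INS X \<Longrightarrow> X * pr {..<N} = X"
  by (rule pr_times_eqI, blast dest: INS_D lessThan_iff[THEN iffD2])
    (rule times_pr_eqI, blast dest: INS_D lessThan_iff[THEN iffD2])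

lemma lift_INS: "INS X \<Longrightarrow> lift A * X = emb A * X" "INS X \<Longrightarrow> X * lift A = X * emb A"
  using pr_INS[of X] by (auto simp: lift_def algebra_simps)

lemma lift_times:
  assumes "A \<in> carrier_mat N N" "B \<in> carrier_mat N N"
  shows "lift A * lift B = lift (A * B)"
proof -
  have i: "INS (emb A)" "INS (emb B)" using assms by (auto intro: INS_emb)
  have e: "(1 - pr {..<N}) * (1 - pr {..<N}) = (1 - pr {..<N} :: 'a cfm)"
    by (simp add: algebra_simps dg_times_dg)
      (intro arg_cong2[of _ _ _ _ "(-)"] arg_cong[of _ _ dg], auto)
  have "lift A * lift B = emb A * lift B + (1 - pr {..<N}) * lift B" by (simp add: lift_def distrib_right)
  also have "emb A * lift B = emb A * emb B" using i by (simp add: lift_INS)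
  also have "(1 - pr {..<N}) * lift B = 1 - pr {..<N}"
    using pr_INS[OF i(2)] e by (simp add: lift_def distrib_left left_diff_distrib)
  finally show ?thesis using assms by (simp add: lift_def emb_times)
qed

lemma UT_lift: "UT (emb A) \<Longrightarrow> UT (lift A)"
  unfolding lift_def by (intro UT_add UT_minus UT_one UT_dg)

lemma lift_one: "lift (1\<^sub>m N) = 1"
  by (simp add: lift_def emb_one)

lemma unit_pair_lift:
  assumes "A \<in> carrier_mat N N" "B \<in> carrier_mat N N" "A * B = 1\<^sub>m N" "B * A = 1\<^sub>m N"
    "UT (emb A)" "UT (emb B)"
  shows "unit_pair (lift A) (lift B)"
  using assms by (simp add: unit_pair_def UT_lift lift_times lift_one)

definition nu :: "'a :: field mat \<Rightarrow> 'a cfm" where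
  "nu g = emb (g - 1\<^sub>m N)"

lemma parabolicD:
  assumes "g \<in> parabolic ns"
  shows "g \<in> carrier_mat N N" "UT (emb g)" "UT (nu g)" "INS (nu g)" "nu g = emb g - pr {..<N}"
proof -
  show g: "g \<in> carrier_mat N N" "UT (emb g)" using assms UT_emb by (auto simp: parabolic_def GL_def)
  then show n: "nu g = emb g - pr {..<N}" by (simp add: nu_def emb_minus emb_one)
  show "UT (nu g)" unfolding n using g(2) UT_dg by (rule UT_minus)
  show "INS (nu g)" unfolding nu_def using g by (intro INS_emb minus_carrier_mat) simp
qed

lemma levi_emb:
  assumes "r \<in> levi ns" shows "r \<in> carrier_mat N N" "UT (emb r)" "dp (emb r) = emb r"
proof -
  show r: "r \<in> carrier_mat N N" using assms by (simp add: levi_def GL_def)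
  have s: "bn i = bn j" if "ent (emb r) i j \<noteq> 0" for i j
    using that assms r unfolding levi_def supported_on_def
    by (auto simp: ent_emb diag_positions_iff split: if_splits)
  then show "UT (emb r)" by (auto simp: UT_def)
  show "dp (emb r) = emb r" by (rule cfm_eqI) (use s in \<open>auto simp: ent_dp\<close>)
qed

lemma unip_emb:
  assumes "a \<in> unip_radical ns"
  obtains x where "NIL x" "INS x" "a \<in> carrier_mat N N" "lift a = 1 + x"
proof -
  obtain x where x: "a = 1\<^sub>m N + x" "x \<in> carrier_mat N N" "supported_on x (roots ns)"
    using assms by (auto simp: unip_radical_def nil_algebra_def)
  show thesis
    by (rule that[of "emb x"]) (use x NIL_emb in \<open>auto simp: INS_emb lift_def emb_add[of _ N] emb_one\<close>)
qed

text \<open>From left to right, \<open>p = r * a\<close> and \<open>q = r * b'\<close> with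
  \<open>b'\<close> inverse to \<open>b\<close>. From right to left, \<open>r\<close> is the
  diagonal part of \<open>p\<close>, and \<open>a\<close>, \<open>b\<close> are what remains of
  \<open>p\<close> and of the inverse of \<open>q\<close>; \<open>b\<close> is unipotent because
  \<open>q\<close> has the same diagonal part as \<open>p\<close>.\<close>

lemma par_equiv_iff:
  fixes g g' :: "'a :: {field, finite} mat"
  assumes "g \<in> parabolic ns" "g' \<in> parabolic ns"
  shows "par_equiv ns g g' \<longleftrightarrow> eqv (nu g) (nu g')"
proof
  assume "par_equiv ns g g'"
  then obtain r r' a b where r: "r \<in> levi ns" "r' \<in> levi ns" "inverts_mat r r'" "inverts_mat r' r"
    and ab: "a \<in> unip_radical ns" "b \<in> unip_radical ns"
    and g': "g' = 1\<^sub>m N + r * a * (g - 1\<^sub>m N) * b * r'"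
    unfolding par_equiv_def by blast
  obtain x where x: "NIL x" "INS x" "a \<in> carrier_mat N N" "lift a = 1 + x"
    using unip_emb[OF ab(1)] by metis
  obtain y where y: "NIL y" "INS y" "b \<in> carrier_mat N N" "lift b = 1 + y"
    using unip_emb[OF ab(2)] by metis
  obtain x' where x': "unit_pair (1 + x) (1 + x')" using NIL_unit_pair[OF x(1,2)] by metis
  obtain y' where y': "NIL y'" "unit_pair (1 + y) (1 + y')" using NIL_unit_pair[OF y(1,2)] by metis
  note c = levi_emb(1)[OF r(1)] levi_emb(1)[OF r(2)] x(3) y(3) parabolicD(1)[OF assms(1)]
  have rr: "unit_pair (lift r) (lift r')"
    using c r(3,4) levi_emb[OF r(1)] levi_emb[OF r(2)]
    by (intro unit_pair_lift) (auto simp: inverts_mat_def)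
  have "g' - 1\<^sub>m N = r * a * (g - 1\<^sub>m N) * b * r'" unfolding g'
    by (rule eq_matI) (use c in auto)
  then have "nu g' = emb r * emb a * nu g * emb b * emb r'"
    using c by (simp add: nu_def emb_times[of _ N] mult_carrier_mat[of _ N N _ N] minus_carrier_mat)
  also have "\<dots> = lift r * lift a * nu g * lift b * lift r'"
    using c parabolicD(4)[OF assms(1)]
    by (simp add: lift_INS INS_times INS_emb mult.assoc)
  finally have n: "nu g' = lift r * (1 + x) * nu g * (1 + y) * lift r'" unfolding x(4) y(4) .
  have "nu g' * (lift r * (1 + y')) = lift r * (1 + x) * nu g * ((1 + y) * (lift r' * lift r) * (1 + y'))"
    unfolding n by (simp add: mult.assoc)
  then have e: "lift r * (1 + x) * nu g = nu g' * (lift r * (1 + y'))"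
    using rr y'(2) by (simp add: unit_pair_def)
  show "eqv (nu g) (nu g')"
  proof (rule eqvI[OF unit_pair_times[OF rr x'] unit_pair_times[OF rr unit_pair_sym[OF y'(2)]] _ e])
    have "lift r * (1 + x) - lift r * (1 + y') = lift r * (x - y')" by (simp add: algebra_simps)
    then show "NIL (lift r * (1 + x) - lift r * (1 + y'))"
      using rr x(1) y'(1) by (simp add: unit_pair_def UT_times_NIL NIL_minus)
  qed
next
  assume "eqv (nu g) (nu g')"
  then obtain p p' q q' where *: "unit_pair p p'" "unit_pair q q'" "NIL (p - q)" "p * nu g = nu g' * q"
    unfolding eqv_def by blast
  then have UT: "UT p" "UT p'" "UT q" "UT q'" by (auto simp: unit_pair_def)
  have inv: "dp p * dp p' = 1" "dp p' * dp p = 1"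
    using * UT by (simp_all add: unit_pair_def dp_one flip: dp_times)
  define r where "r = trunc N (dp p)"
  define r' where "r' = trunc N (dp p')"
  define a where "a = trunc N (dp p' * p)"
  define b where "b = trunc N (q' * dp p)"
  have rr: "r * r' = 1\<^sub>m N" "r' * r = 1\<^sub>m N"
    unfolding r_def r'_def using inv by (simp_all add: UT_dp trunc_one flip: trunc_times)
  have c: "r \<in> carrier_mat N N" "r' \<in> carrier_mat N N" by (simp_all add: r_def r'_def)
  have ii: "inverts_mat r r'" "inverts_mat r' r" using rr c by (auto simp: inverts_mat_def)
  then have "invertible_mat r" "invertible_mat r'" using c by (auto simp: invertible_mat_def square_mat.simps)
  then have lv: "r \<in> levi ns" "r' \<in> levi ns"
    using c by (auto simp: levi_def GL_def r_def r'_def supported_trunc)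
  have un: "trunc N X \<in> unip_radical ns" if "NIL (X - 1)" for X :: "'a cfm"
  proof -
    have "trunc N X = trunc N (1 + (X - 1))" by simp
    also have "\<dots> = 1\<^sub>m N + trunc N (X - 1)" by (simp only: trunc_add trunc_one)
    finally show ?thesis using supported_trunc(2)[OF that]
      by (auto simp: unip_radical_def nil_algebra_def)
  qed
  have "dp p' * p - 1 = dp p' * (p - dp p)" using inv by (simp add: algebra_simps)
  then have a: "a \<in> unip_radical ns"
    unfolding a_def using UT by (intro un) (simp add: UT_times_NIL UT_dp NIL_minus_dp)
  \<comment> \<open>This difference is \<open>dp p - q\<close>; multiplied by the inverse of
    \<open>q\<close> it becomes \<open>q' * dp p - 1\<close>.\<close>
  have "NIL ((p - q) - (p - dp p))" by (rule NIL_minus[OF *(3) NIL_minus_dp[OF UT(1)]])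
  then have "NIL (q' * ((p - q) - (p - dp p)))" by (rule UT_times_NIL[OF UT(4)])
  moreover have "q' * ((p - q) - (p - dp p)) = q' * dp p - 1"
    using *(2) by (simp add: algebra_simps unit_pair_def)
  ultimately have b: "b \<in> unip_radical ns"
    unfolding b_def by (intro un) simp
  have "nu g' = p * nu g * q'" using *(2,4) by (simp add: unit_pair_def mult.assoc)
  also have "\<dots> = (dp p * dp p') * p * nu g * q' * (dp p * dp p')" using inv by simp
  also have "\<dots> = dp p * (dp p' * p) * nu g * (q' * dp p) * dp p'" by (simp add: mult.assoc)
  finally have "trunc N (nu g') = r * a * trunc N (nu g) * b * r'"
    using UT parabolicD(3)[OF assms(1)]
    by (simp only: trunc_times UT_dp UT_times r_def r'_def a_def b_def)
  then have h: "g' - 1\<^sub>m N = r * a * (g - 1\<^sub>m N) * b * r'"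
    using assms by (simp add: nu_def trunc_emb minus_carrier_mat)
  have "g' = 1\<^sub>m N + (g' - 1\<^sub>m N)" using parabolicD(1)[OF assms(2)] by (intro eq_matI) auto
  then have "g' = 1\<^sub>m N + r * a * (g - 1\<^sub>m N) * b * r'" unfolding h .
  then show "par_equiv ns g g'"
    unfolding par_equiv_def using assms lv a b ii by blast
qed

section \<open>Diagonal blocks\<close>

definition blkm :: "'a :: ring_1 cfm \<Rightarrow> nat \<Rightarrow> 'a mat" where
  "blkm X k = mat (ns ! k) (ns ! k) (\<lambda>(i, j). ent X (offset ns k + i) (offset ns k + j))"

lemma blkm_carrier [simp]: "blkm X k \<in> carrier_mat (ns ! k) (ns ! k)"
  by (simp add: blkm_def)

lemma offset_add_segment: "k < length ns \<Longrightarrow> i < ns ! k \<Longrightarrow> bn (offset ns k + i) = k \<and> offset ns k + i < N"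
  using bn_eqI[of "offset ns k + i" k] by (auto simp: segment_image)

lemma blkm_times:
  assumes "UT X" "UT Y" "k < length ns"
  shows "blkm (X * Y) k = blkm X k * blkm Y k"
proof (rule eq_matI)
  fix i j assume "i < dim_row (blkm X k * blkm Y k)" "j < dim_col (blkm X k * blkm Y k)"
  then have ij: "i < ns ! k" "j < ns ! k" by (auto simp: blkm_def)
  let ?o = "offset ns k"
  have "ent (X * Y) (?o + i) (?o + j) = (\<Sum>l\<in>segment ns k. ent X (?o + i) l * ent Y l (?o + j))"
  proof (rule ent_times_sum)
    fix l assume "ent Y l (?o + j) \<noteq> 0" "ent X (?o + i) l \<noteq> 0"
    then have "bn (?o + i) \<le> bn l" "bn l \<le> bn (?o + j)" using assms by (auto simp: UT_def)
    then have "bn l = k" using offset_add_segment[OF assms(3)] ij by simp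
    moreover have "l < N"
      using blk_le_in[OF \<open>bn l \<le> bn (?o + j)\<close>] offset_add_segment[OF assms(3)] ij by simp
    ultimately show "l \<in> segment ns k" using segment_iff[OF assms(3)] by simp
  qed (simp add: segment_def)
  also have "\<dots> = (\<Sum>l\<in>{0..<ns ! k}. ent X (?o + i) (?o + l) * ent Y (?o + l) (?o + j))"
    by (simp add: segment_image[OF assms(3)] sum.reindex atLeast0LessThan)
  finally show "blkm (X * Y) k $$ (i, j) = (blkm X k * blkm Y k) $$ (i, j)"
    using ij by (simp add: blkm_def scalar_prod_def)
qed (auto simp: blkm_def)

lemma blkm_one: "blkm 1 k = 1\<^sub>m (ns ! k)"
  by (rule eq_matI) (auto simp: blkm_def ent_one)

lemma blkm_dp: "k < length ns \<Longrightarrow> blkm (dp X) k = blkm X k"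
  by (rule eq_matI) (auto simp: blkm_def ent_dp offset_add_segment)

lemma blkm_emb:
  assumes "g \<in> carrier_mat N N" "k < length ns"
  shows "blkm (emb g) k = diag_block ns g k"
  by (rule eq_matI) (use assms offset_add_segment in \<open>auto simp: blkm_def diag_block_def ent_emb\<close>)

lemma segment_cases:
  assumes "i < N" "bn i = bn j"
  obtains k i' j' where "k < length ns" "i' < ns ! k" "j' < ns ! k" "i = offset ns k + i'"
    "j = offset ns k + j'" "bn i = k"
proof -
  have j: "j < N" using assms blk_le_in[of j i] by simp
  have k: "bn i < length ns" "i \<in> segment ns (bn i)" "j \<in> segment ns (bn i)"
    using bn_segment assms j by metis+
  then show thesis using that[of "bn i"] unfolding segment_image[OF k(1)] by blast
qed

lemma blkm_eqI:
  assumes "INS X" "INS Y" "dp X = X" "dp Y = Y"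
    and eq: "\<And>k. k < length ns \<Longrightarrow> blkm X k = blkm Y k"
  shows "X = Y"
proof (rule cfm_eqI)
  fix i j
  show "ent X i j = ent Y i j"
  proof (cases "i < N \<and> bn i = bn j")
    case True
    then obtain k i' j' where k: "k < length ns" "i' < ns ! k" "j' < ns ! k" "i = offset ns k + i'"
      "j = offset ns k + j'" using segment_cases[of i j] by metis
    then show ?thesis using arg_cong[OF eq[OF k(1)], of "\<lambda>A. A $$ (i', j')"] by (simp add: blkm_def)
  next
    case False
    then have "ent X i j = 0" "ent Y i j = 0"
      using assms(1-4) by (metis INS_D ent_dp)+
    then show ?thesis by simp
  qed
qed

definition bdm :: "(nat \<Rightarrow> 'a :: ring_1 mat) \<Rightarrow> 'a mat" where
  "bdm F = mat N N (\<lambda>(i, j). if bn i = bn j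
     then F (bn i) $$ (i - offset ns (bn i), j - offset ns (bn i)) else 0)"

lemma bdm_carrier [simp]: "bdm F \<in> carrier_mat N N"
  by (simp add: bdm_def)

lemma bdm_emb: "UT (emb (bdm F))" "INS (emb (bdm F))" "dp (emb (bdm F)) = emb (bdm F)"
proof -
  show "INS (emb (bdm F))" by (rule INS_emb) simp
  have *: "bn i = bn j" if "ent (emb (bdm F)) i j \<noteq> 0" for i j
    using that by (auto simp: ent_emb bdm_def split: if_splits)
  then show "UT (emb (bdm F))" by (auto simp: UT_def)
  show "dp (emb (bdm F)) = emb (bdm F)" by (rule cfm_eqI) (use * in \<open>auto simp: ent_dp\<close>)
qed

lemma blkm_bdm:
  assumes "k < length ns" "F k \<in> carrier_mat (ns ! k) (ns ! k)"
  shows "blkm (emb (bdm F)) k = F k"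
  by (rule eq_matI) (use assms offset_add_segment in \<open>auto simp: blkm_def ent_emb bdm_def\<close>)

text \<open>Conjugations chosen independently in the diagonal blocks combine to one by a
  block-diagonal matrix, which is an admissible equivalence.\<close>

lemma levi_block_conj:
  fixes h :: "'a :: ring_1 cfm"
  assumes PQ: "\<And>k. k < length ns \<Longrightarrow> P k \<in> carrier_mat (ns ! k) (ns ! k) \<and> Q k \<in> carrier_mat (ns ! k) (ns ! k) \<and>
      P k * Q k = 1\<^sub>m (ns ! k) \<and> Q k * P k = 1\<^sub>m (ns ! k)"
    and h: "UT h" "INS h"
  defines "h' \<equiv> emb (bdm P) * h * emb (bdm Q)"
  shows "UT h'" "INS h'" "eqv h h'" "\<And>k. k < length ns \<Longrightarrow> blkm h' k = P k * blkm h k * Q k"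
proof -
  have 1: "bdm F * bdm G = 1\<^sub>m N"
    if "\<And>k. k < length ns \<Longrightarrow> F k \<in> carrier_mat (ns ! k) (ns ! k) \<and> G k \<in> carrier_mat (ns ! k) (ns ! k) \<and>
      F k * G k = 1\<^sub>m (ns ! k)" for F G :: "nat \<Rightarrow> 'a mat"
  proof -
    have "emb (bdm F) * emb (bdm G) = emb (1\<^sub>m N)"
    proof (rule blkm_eqI)
      show "dp (emb (bdm F) * emb (bdm G)) = emb (bdm F) * emb (bdm G)"
        by (simp add: dp_times bdm_emb)
      show "dp (emb (1\<^sub>m N)) = emb (1\<^sub>m N)"
        by (rule cfm_eqI) (auto simp: emb_one ent_dp ent_dg)
      fix k assume k: "k < length ns"
      have "blkm (emb (1\<^sub>m N) :: 'a cfm) k = 1\<^sub>m (ns ! k)"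
        by (rule eq_matI) (use offset_add_segment[OF k] in \<open>auto simp: blkm_def emb_one ent_dg\<close>)
      then show "blkm (emb (bdm F) * emb (bdm G)) k = blkm (emb (1\<^sub>m N)) k"
        using that[OF k] k by (simp add: blkm_times bdm_emb blkm_bdm)
    qed (auto intro: INS_times bdm_emb INS_emb)
    then have "emb (bdm F * bdm G) = emb (1\<^sub>m N)" by (simp add: emb_times[of _ N])
    then show ?thesis by (metis trunc_emb bdm_carrier mult_carrier_mat one_carrier_mat)
  qed
  have "unit_pair (lift (bdm P)) (lift (bdm Q))"
    using PQ by (intro unit_pair_lift 1 bdm_emb) auto
  then have "eqv h (lift (bdm P) * h * lift (bdm Q))" by (rule eqv_conj)
  also have "lift (bdm P) * h * lift (bdm Q) = h'"
    using h by (simp add: h'_def lift_INS INS_times bdm_emb)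
  finally show "eqv h h'" .
  show "UT h'" "INS h'" unfolding h'_def using h by (auto intro!: UT_times INS_times bdm_emb)
  fix k assume k: "k < length ns"
  show "blkm h' k = P k * blkm h k * Q k"
    unfolding h'_def using k h PQ[OF k] by (simp add: blkm_times UT_times bdm_emb blkm_bdm)
qed

end

section \<open>Conjugacy classes of matrices of order 2\<close>

lemma mat2_carrier [simp]: "mat2 a b c d \<in> carrier_mat 2 2"
  by (simp add: mat2_def mat_of_rows_list_def numeral_2_eq_2)

lemma mat2_dim [simp]: "dim_row (mat2 a b c d) = 2" "dim_col (mat2 a b c d) = 2"
  using mat2_carrier[of a b c d] by (auto simp only: carrier_mat_def)

lemma mat2_index [simp]:
  "mat2 a b c d $$ (0, 0) = a" "mat2 a b c d $$ (0, Suc 0) = b"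
  "mat2 a b c d $$ (Suc 0, 0) = c" "mat2 a b c d $$ (Suc 0, Suc 0) = d"
  by (simp_all add: mat2_def mat_of_rows_list_def)

lemma less_2_iff: "i < 2 \<longleftrightarrow> i = 0 \<or> i = Suc (0 :: nat)"
  by auto

lemma mat2_eqI:
  assumes "A \<in> carrier_mat 2 2"
    "A $$ (0, 0) = a" "A $$ (0, Suc 0) = b" "A $$ (Suc 0, 0) = c" "A $$ (Suc 0, Suc 0) = d"
  shows "A = mat2 a b c d"
proof (rule eq_matI)
  fix i j assume "i < dim_row (mat2 a b c d)" "j < dim_col (mat2 a b c d)"
  then have "i < 2" "j < 2" using mat2_carrier[of a b c d] by auto
  then show "A $$ (i, j) = mat2 a b c d $$ (i, j)" using assms by (auto simp: less_2_iff)
qed (use assms(1) in auto)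

lemma mat2_cases:
  assumes "A \<in> carrier_mat 2 2"
  obtains a b c d where "A = mat2 a b c d"
  using mat2_eqI[OF assms] by blast

lemma mat2_inject [simp]: "mat2 a b c d = mat2 a' b' c' d' \<longleftrightarrow> a = a' \<and> b = b' \<and> c = c' \<and> d = d'"
  by (metis mat2_index)

lemma mat2_one: "1\<^sub>m 2 = mat2 1 0 0 1"
  by (rule mat2_eqI) auto

lemma mat2_times:
  fixes a b c d :: "'a :: semiring_0"
  shows "mat2 a b c d * mat2 e f g h = mat2 (a * e + b * g) (a * f + b * h) (c * e + d * g) (c * f + d * h)"
proof (rule mat2_eqI)
  show "mat2 a b c d * mat2 e f g h \<in> carrier_mat 2 2" by (rule mult_carrier_mat[of _ 2 2]) simp_all
  show "(mat2 a b c d * mat2 e f g h) $$ (0, 0) = a * e + b * g"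
    "(mat2 a b c d * mat2 e f g h) $$ (0, Suc 0) = a * f + b * h"
    "(mat2 a b c d * mat2 e f g h) $$ (Suc 0, 0) = c * e + d * g"
    "(mat2 a b c d * mat2 e f g h) $$ (Suc 0, Suc 0) = c * f + d * h"
    by (auto simp: scalar_prod_def numeral_2_eq_2)
qed

lemma mat2_minus: "mat2 a b c d - mat2 e f g h = mat2 (a - e) (b - f) (c - g) (d - h)"
proof (rule mat2_eqI)
  show "mat2 a b c d - mat2 e f g h \<in> carrier_mat 2 2" by (rule minus_carrier_mat) simp
  show "(mat2 a b c d - mat2 e f g h) $$ (0, 0) = a - e"
    "(mat2 a b c d - mat2 e f g h) $$ (0, Suc 0) = b - f"
    "(mat2 a b c d - mat2 e f g h) $$ (Suc 0, 0) = c - g"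
    "(mat2 a b c d - mat2 e f g h) $$ (Suc 0, Suc 0) = d - h"
    by auto
qed

lemma conj_sigma_mat2: "conj_sigma (mat2 a b c d) = mat2 d c b (a :: 'a :: field)"
  by (simp add: conj_sigma_def mat2_times)

lemma mat2_inverse:
  fixes a b c d :: "'a :: field"
  assumes "a * d - b * c \<noteq> 0"
  defines "e \<equiv> a * d - b * c"
  shows "mat2 a b c d * mat2 (d / e) (- b / e) (- c / e) (a / e) = 1\<^sub>m 2"
    "mat2 (d / e) (- b / e) (- c / e) (a / e) * mat2 a b c d = 1\<^sub>m 2"
proof -
  have e: "e \<noteq> 0" using assms by simp
  have "a * (d / e) + b * (- c / e) = e / e" "c * (- b / e) + d * (a / e) = e / e"
    "d / e * a + - b / e * c = e / e" "- c / e * b + a / e * d = e / e"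
    by (simp_all add: e_def algebra_simps flip: add_divide_distrib diff_divide_distrib)
  then show "mat2 a b c d * mat2 (d / e) (- b / e) (- c / e) (a / e) = 1\<^sub>m 2"
    "mat2 (d / e) (- b / e) (- c / e) (a / e) * mat2 a b c d = 1\<^sub>m 2"
    using e unfolding mat2_times mat2_one mat2_inject by (simp_all add: mult.commute)
qed

text \<open>With an intertwiner of nonzero determinant, only a basis of eigenvectors or a Jordan
  chain has to be exhibited, not the inverse matrix.\<close>

lemma similar_mat2I:
  fixes a b c d :: "'a :: field"
  assumes "A \<in> carrier_mat 2 2" "B \<in> carrier_mat 2 2"
    "A * mat2 a b c d = mat2 a b c d * B" "a * d - b * c \<noteq> 0"
  shows "similar_mat A B"
proof -
  obtain Q where Q: "Q \<in> carrier_mat 2 2" "mat2 a b c d * Q = 1\<^sub>m 2" "Q * mat2 a b c d = 1\<^sub>m 2"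
    using mat2_inverse[OF assms(4)] mat2_carrier by metis
  have "mat2 a b c d * B * Q = A * (mat2 a b c d * Q)"
    using assms Q by (metis assoc_mult_mat mat2_carrier)
  then have "A = mat2 a b c d * B * Q" using assms Q by simp
  then have "similar_mat_wit A B (mat2 a b c d) Q"
    by (rule similar_mat_witI[OF Q(2,3) _ assms(1,2) mat2_carrier Q(1)])
  then show ?thesis unfolding similar_mat_def by blast
qed

lemma similar_mat_witD:
  assumes "similar_mat A B" "A \<in> carrier_mat m m"
  obtains P Q where "P \<in> carrier_mat m m" "Q \<in> carrier_mat m m" "B \<in> carrier_mat m m"
    "P * Q = 1\<^sub>m m" "Q * P = 1\<^sub>m m" "A = P * B * Q"
  using assms unfolding similar_mat_def similar_mat_wit_def Let_def by auto

definition det2 :: "'a :: field mat \<Rightarrow> 'a" where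
  "det2 A = A $$ (0, 0) * A $$ (1, 1) - A $$ (0, 1) * A $$ (1, 0)"

lemma det2_mat2 [simp]: "det2 (mat2 a b c d) = a * d - b * c"
  by (simp add: det2_def)

lemma det2_times:
  assumes "A \<in> carrier_mat 2 2" "B \<in> carrier_mat 2 2"
  shows "det2 (A * B) = det2 A * det2 B"
  using assms by (elim mat2_cases) (simp add: mat2_times algebra_simps)

text \<open>These two conjugacy invariants suffice to separate the matrices allowed by
  \<open>listed\<close> for a given pattern of roots.\<close>

lemma similar_det2:
  assumes "similar_mat A B" "A \<in> carrier_mat 2 2"
  shows "det2 A = det2 B" "A = 1\<^sub>m 2 \<longleftrightarrow> B = 1\<^sub>m 2"
proof -
  obtain P Q where PQ: "P \<in> carrier_mat 2 2" "Q \<in> carrier_mat 2 2" "B \<in> carrier_mat 2 2"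
    "P * Q = 1\<^sub>m 2" "Q * P = 1\<^sub>m 2" "A = P * B * Q" by (rule similar_mat_witD[OF assms])
  have "det2 P * det2 Q = 1"
    using PQ det2_times[OF PQ(1,2)] by (simp add: mat2_one)
  then show "det2 A = det2 B"
    using PQ by (simp add: det2_times mult_carrier_mat[of _ 2 2 _ 2] algebra_simps)
  have "Q * A * P = (Q * P) * B * (Q * P)"
    unfolding PQ(6) using PQ(1-3) by (simp add: assoc_mult_mat[of _ 2 2 _ 2 _ 2] mult_carrier_mat[of _ 2 2 _ 2])
  then have "B = Q * A * P" using PQ by simp
  then show "A = 1\<^sub>m 2 \<longleftrightarrow> B = 1\<^sub>m 2" using PQ by auto
qed

lemma GL2_det2: "A \<in> GL 2 \<Longrightarrow> det2 A \<noteq> 0"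
proof -
  assume A: "A \<in> GL 2"
  then have Ac: "A \<in> carrier_mat 2 2" by (simp add: GL_def)
  obtain B where B: "A * B = 1\<^sub>m 2" "B * A = 1\<^sub>m (dim_row B)"
    using A by (auto simp: GL_def invertible_mat_def inverts_mat_def)
  have "dim_row B = 2" using arg_cong[OF B(2), of dim_col] Ac by simp
  moreover have "dim_col B = 2" using arg_cong[OF B(1), of dim_col] by simp
  ultimately have "B \<in> carrier_mat 2 2" by auto
  then have "det2 A * det2 B = 1" using det2_times[OF Ac, of B] B(1) by (simp add: mat2_one)
  then show "det2 A \<noteq> 0" by auto
qed

text \<open>
  A representative \<open>B\<close> with \<open>B - 1\<close> singular has eigenvalue 1, hence is conjugate to one of the
  representatives prescribed by \<^const>\<open>is_Cl2\<close>, and therefore equal to it.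
\<close>

lemma Cl2_cases:
  fixes C :: "'a :: field mat set"
  assumes C: "is_Cl2 C" and B: "B \<in> C"
  obtains (diag) a where "a \<noteq> 0" "B = mat2 a 0 0 1" | (unip) "B = mat2 1 1 0 1"
  | (inv) a b c d where "B = mat2 a b c d" "(a - 1) * (d - 1) - b * c \<noteq> 0"
proof -
  have rep: "representatives (GL 2) similar_mat C" "\<And>a. a \<noteq> 0 \<Longrightarrow> mat2 a 0 0 1 \<in> C" "mat2 1 1 0 1 \<in> C"
    using C by (auto simp: is_Cl2_def)
  have GL: "B \<in> GL 2" using rep(1) B by (auto simp: representatives_def)
  then have Bc: "B \<in> carrier_mat 2 2" by (simp add: GL_def)
  have uniq: "B = B'" if "similar_mat B B'" "B' \<in> C" for B'
    using rep(1) GL B similar_mat_refl[OF Bc] that unfolding representatives_def by blast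
  obtain a b c d where Beq: "B = mat2 a b c d" using Bc by (rule mat2_cases)
  define p where "p = a - 1"
  define s where "s = d - 1"
  have ad: "a = 1 + p" "d = 1 + s" by (simp_all add: p_def s_def)
  have diag0: thesis if "similar_mat B (mat2 (1 + x) 0 0 1)" for x
  proof -
    have "det2 B = 1 + x" using similar_det2[OF that Bc] by simp
    then have "1 + x \<noteq> 0" using GL2_det2[OF GL] by simp
    moreover from this have "B = mat2 (1 + x) 0 0 1" using uniq[OF that] rep(2) by simp
    ultimately show thesis by (rule diag)
  qed
  have unip0: thesis if "similar_mat B (mat2 1 1 0 1)"
    by (rule unip[OF uniq[OF that rep(3)]])
  show thesis
  proof (cases "p * s - b * c = 0")
    case False
    then show ?thesis using inv[OF Beq] by (simp add: p_def s_def)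
  next
    case True
    then have bc: "b * c = p * s" by simp
    show ?thesis
    \<comment> \<open>\<open>p + s\<close> is the trace of the singular matrix \<open>B - 1\<close>.
      If it is nonzero, \<open>B\<close> is diagonalizable with eigenvalues \<open>1 + p + s\<close>
      and 1; otherwise \<open>B - 1\<close> is nilpotent.\<close>
    proof (cases "p + s = 0")
      case False
      show ?thesis
      proof (cases "p = 0")
        case True
        have "similar_mat B (mat2 (1 + s) 0 0 1)"
        \<comment> \<open>The columns are eigenvectors of \<open>B - 1\<close> for \<open>s\<close>
          and 0, in view of \<open>p = 0\<close> and \<open>b * c = 0\<close>.\<close>
        proof (rule similar_mat2I[OF Bc mat2_carrier, of b s s "- c"])
          show "B * mat2 b s s (- c) = mat2 b s s (- c) * mat2 (1 + s) 0 0 1"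
            using True bc by (simp add: Beq ad mat2_times algebra_simps)
          have "b * c = 0" using True bc by simp
          then have e: "b * (- c) - s * s = - (s * s)"
            by (simp only: mult_minus_right minus_zero diff_0)
          show "b * (- c) - s * s \<noteq> 0" unfolding e using True False by simp
        qed
        then show ?thesis by (rule diag0)
      next
        case p: False
        have "similar_mat B (mat2 (1 + (p + s)) 0 0 1)"
        \<comment> \<open>The columns are eigenvectors of \<open>B - 1\<close> for
          \<open>p + s\<close> and 0: the first column of \<open>B - 1\<close>, and a vector in its
          kernel.\<close>
        proof (rule similar_mat2I[OF Bc mat2_carrier, of p b c "- p"])
          show "B * mat2 p b c (- p) = mat2 p b c (- p) * mat2 (1 + (p + s)) 0 0 1"
            using bc by (simp add: Beq ad mat2_times algebra_simps)
          have "p * (- p) - b * c = - (p * (p + s))" using bc by (simp add: algebra_simps)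
          then show "p * (- p) - b * c \<noteq> 0" using p False by simp
        qed
        then show ?thesis by (rule diag0)
      qed
    next
      case True
      then have s: "s = - p" by (simp add: eq_neg_iff_add_eq_0 add.commute)
      show ?thesis
      proof (cases "c = 0")
        case False
        have "similar_mat B (mat2 1 1 0 1)"
        \<comment> \<open>A Jordan chain: the first unit vector and its image \<open>(p, c)\<close>
          under \<open>B - 1\<close>.\<close>
        proof (rule similar_mat2I[OF Bc mat2_carrier, of p 1 c 0])
          show "B * mat2 p 1 c 0 = mat2 p 1 c 0 * mat2 1 1 0 1"
            using bc by (simp add: Beq ad s mat2_times algebra_simps)
        qed (use False in simp)
        then show ?thesis by (rule unip0)
      next
        case c: True
        then have p: "p = 0" using bc s by simp
        show ?thesis
        proof (cases "b = 0")
          case True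
          have "B = mat2 1 0 0 1" using True c p s by (simp add: Beq ad)
          then show ?thesis using diag[of 1] by simp
        next
          case False
          have "similar_mat B (mat2 1 1 0 1)"
          proof (rule similar_mat2I[OF Bc mat2_carrier, of b 0 0 1])
            show "B * mat2 b 0 0 1 = mat2 b 0 0 1 * mat2 1 1 0 1"
              using c p s by (simp add: Beq ad mat2_times)
          qed (use False in simp)
          then show ?thesis by (rule unip0)
        qed
      qed
    qed
  qed
qed

text \<open>
  Outside the isolated blocks, conditions (2b)-(2f) say that \<open>\<rho>\<^sub>* - 1\<close> has at most one nonzero entry,
  equal to 1 if it is off the diagonal, and vanishes in the rows and columns containing roots of \<open>D\<close>.
\<close>

definition listed :: "(nat \<times> nat) set \<Rightarrow> nat \<Rightarrow> 'a :: field mat \<Rightarrow> bool" where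
  "listed D i B \<longleftrightarrow> (\<exists>p q r s. B = mat2 p q r s \<and> p \<noteq> 0 \<and> s \<noteq> 0 \<and>
     (q = 0 \<and> r = 0 \<and> (p = 1 \<or> s = 1) \<or> p = 1 \<and> s = 1 \<and> (q = 1 \<and> r = 0 \<or> q = 0 \<and> r = 1)) \<and>
     (row_root D i \<longrightarrow> p = 1 \<and> q = 0) \<and> (row_root D (i + 1) \<longrightarrow> r = 0 \<and> s = 1) \<and>
     (col_root D i \<longrightarrow> p = 1 \<and> r = 0) \<and> (col_root D (i + 1) \<longrightarrow> q = 0 \<and> s = 1))"

definition no_roots :: "(nat \<times> nat) set \<Rightarrow> nat \<Rightarrow> bool" where
  "no_roots D i \<longleftrightarrow> \<not> row_root D i \<and> \<not> col_root D i"

lemma block2_ok_isolated: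
  "no_roots D i \<Longrightarrow> no_roots D (i + 1) \<Longrightarrow> block2_ok C D i B \<longleftrightarrow> B \<in> C"
  by (auto simp: no_roots_def block2_ok_def block2_asym_def two_roots_def)

lemma conj_sigma_image:
  "conj_sigma ` ({mat2 a 0 0 1 | a. a \<noteq> 0} \<union> {mat2 1 1 0 1}) =
     {mat2 1 0 0 a | a. a \<noteq> 0} \<union> {mat2 1 0 1 (1 :: 'a :: field)}"
  "conj_sigma ` ({mat2 1 0 0 a | a. a \<noteq> 0} \<union> {mat2 1 1 0 1}) =
     {mat2 a 0 0 1 | a. a \<noteq> 0} \<union> {mat2 1 0 1 (1 :: 'a :: field)}"
  "conj_sigma ` {mat2 a 0 0 1 | a. a \<noteq> 0} = {mat2 1 0 0 a | a. a \<noteq> (0 :: 'a :: field)}"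
  "conj_sigma ` {mat2 1 1 0 1, mat2 1 0 0 1} = {mat2 1 0 1 1, mat2 1 0 0 (1 :: 'a :: field)}"
  by (auto simp: conj_sigma_mat2 image_iff intro: exI[of _ "mat2 _ 0 0 1"]) (metis conj_sigma_mat2)+

text \<open>Checked on the sixteen patterns of roots in the two rows and two columns, the empty
  pattern being excluded by the hypothesis.\<close>

lemma block2_ok_listed:
  assumes "\<not> (no_roots D i \<and> no_roots D (i + 1))"
  shows "block2_ok C D i B \<longleftrightarrow> listed D i B"
proof -
  have n: "\<not> (\<not> row_root D i \<and> \<not> row_root D (i + 1) \<and> \<not> col_root D i \<and> \<not> col_root D (i + 1))"
    using assms by (auto simp: no_roots_def)
  show ?thesis
    unfolding block2_ok_def block2_asym_def two_roots_def image_ident conj_sigma_image listed_def mat2_one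
    using n
    by (cases "row_root D i"; cases "row_root D (i + 1)"; cases "col_root D i"; cases "col_root D (i + 1)";
        simp; auto)
qed

text \<open>Any root of \<open>D\<close> at the block forces one diagonal entry to be 1 and one
  off-diagonal entry to be 0. The determinant then gives the other diagonal entry, and being the
  identity or not decides between the identity and the unipotent matrix.\<close>

lemma listed_unique:
  assumes "\<not> (no_roots D i \<and> no_roots D (i + 1))" "listed D i A" "listed D i B"
    "similar_mat A B"
  shows "A = B"
proof -
  have "A \<in> carrier_mat 2 2" using assms(2) by (auto simp: listed_def)
  from similar_det2[OF assms(4) this] have "det2 A = det2 B" "A = 1\<^sub>m 2 \<longleftrightarrow> B = 1\<^sub>m 2" by auto
  then show ?thesis
    using assms(1-3) unfolding listed_def no_roots_def mat2_one by (elim exE conjE) auto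
qed

text \<open>\<open>G\<close> is a generalized inverse for which both products are coordinate
  projections, onto the nonzero columns and the nonzero rows of \<open>M\<close>. In particular the
  nonzero columns of \<open>M\<close> are linearly independent, and so are its nonzero rows.\<close>

definition pivotal :: "nat \<Rightarrow> 'a :: ring_1 mat \<Rightarrow> 'a mat \<Rightarrow> bool" where
  "pivotal m M G \<longleftrightarrow> M \<in> carrier_mat m m \<and> G \<in> carrier_mat m m \<and>
     G * M = mat m m (\<lambda>(i, j). if i = j \<and> (\<exists>k<m. M $$ (k, j) \<noteq> 0) then 1 else 0) \<and>
     M * G = mat m m (\<lambda>(i, j). if i = j \<and> (\<exists>k<m. M $$ (i, k) \<noteq> 0) then 1 else 0)"

lemma ex_less_2: "(\<exists>k<2. P k) \<longleftrightarrow> P 0 \<or> P (Suc 0)"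
  by (auto simp: less_2_iff)

lemma pivotal_mat2I:
  fixes p q r s p' q' r' s' :: "'a :: ring_1"
  assumes "mat2 p' q' r' s' * mat2 p q r s =
      mat2 (if p \<noteq> 0 \<or> r \<noteq> 0 then 1 else 0) 0 0 (if q \<noteq> 0 \<or> s \<noteq> 0 then 1 else 0)"
    "mat2 p q r s * mat2 p' q' r' s' =
      mat2 (if p \<noteq> 0 \<or> q \<noteq> 0 then 1 else 0) 0 0 (if r \<noteq> 0 \<or> s \<noteq> 0 then 1 else 0)"
  shows "pivotal 2 (mat2 p q r s) (mat2 p' q' r' s')"
  unfolding pivotal_def assms
  by (intro conjI mat2_carrier mat2_eqI[symmetric]) (auto simp: ex_less_2)

lemma pivotal_single:
  fixes p s :: "'a :: field"
  shows "\<exists>G. pivotal 2 (mat2 p 0 0 0) G" "\<exists>G. pivotal 2 (mat2 0 0 0 s) G"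
    "\<exists>G. pivotal 2 (mat2 0 1 0 (0 :: 'a)) G" "\<exists>G. pivotal 2 (mat2 0 0 1 (0 :: 'a)) G"
proof -
  \<comment> \<open>The convention \<open>inverse 0 = 0\<close> also covers
    \<open>p = 0\<close>.\<close>
  show "\<exists>G. pivotal 2 (mat2 p 0 0 0) G"
    by (rule exI, rule pivotal_mat2I[of "inverse p" 0 0 0]) (auto simp: mat2_times)
  show "\<exists>G. pivotal 2 (mat2 0 0 0 s) G"
    by (rule exI, rule pivotal_mat2I[of 0 0 0 "inverse s"]) (auto simp: mat2_times)
  show "\<exists>G. pivotal 2 (mat2 0 1 0 (0 :: 'a)) G"
    by (rule exI, rule pivotal_mat2I[of 0 0 1 0]) (auto simp: mat2_times)
  show "\<exists>G. pivotal 2 (mat2 0 0 1 (0 :: 'a)) G"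
    by (rule exI, rule pivotal_mat2I[of 0 1 0 0]) (auto simp: mat2_times)
qed

lemma pivotal_invertible:
  fixes a b c d :: "'a :: field"
  assumes "a * d - b * c \<noteq> 0"
  shows "\<exists>G. pivotal 2 (mat2 a b c d) G"
proof (rule exI, rule pivotal_mat2I)
  have "a \<noteq> 0 \<or> c \<noteq> 0" "b \<noteq> 0 \<or> d \<noteq> 0" "a \<noteq> 0 \<or> b \<noteq> 0" "c \<noteq> 0 \<or> d \<noteq> 0" using assms by auto
  then show "mat2 (d / (a * d - b * c)) (- b / (a * d - b * c)) (- c / (a * d - b * c)) (a / (a * d - b * c)) *
      mat2 a b c d = mat2 (if a \<noteq> 0 \<or> c \<noteq> 0 then 1 else 0) 0 0 (if b \<noteq> 0 \<or> d \<noteq> 0 then 1 else 0)"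
    "mat2 a b c d * mat2 (d / (a * d - b * c)) (- b / (a * d - b * c)) (- c / (a * d - b * c)) (a / (a * d - b * c)) =
      mat2 (if a \<noteq> 0 \<or> b \<noteq> 0 then 1 else 0) 0 0 (if c \<noteq> 0 \<or> d \<noteq> 0 then 1 else 0)"
    using mat2_inverse[OF assms] by (simp_all add: mat2_one)
qed

lemma pivotal_Cl2:
  fixes C :: "'a :: field mat set"
  assumes "is_Cl2 C" "B \<in> C"
  shows "\<exists>G. pivotal 2 (B - 1\<^sub>m 2) G"
  using assms
  by (cases rule: Cl2_cases[OF assms])
    (auto simp: mat2_one mat2_minus intro: pivotal_single pivotal_invertible)

lemma pivotal_listed:
  assumes "listed D i B"
  shows "\<exists>G. pivotal 2 (B - 1\<^sub>m 2) G"
proof -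
  obtain p q r s where B: "B = mat2 p q r s"
    and c: "q = 0 \<and> r = 0 \<and> (p = 1 \<or> s = 1) \<or> p = 1 \<and> s = 1 \<and> (q = 1 \<and> r = 0 \<or> q = 0 \<and> r = 1)"
    using assms unfolding listed_def by blast
  then show ?thesis
    by (auto simp: mat2_one mat2_minus intro: pivotal_single)
qed

lemma pivotal_1:
  fixes M :: "'a :: field mat"
  assumes "M \<in> carrier_mat 1 1"
  shows "\<exists>G. pivotal 1 M G"
  by (rule exI[of _ "mat 1 1 (\<lambda>_. inverse (M $$ (0, 0)))"])
    (use assms in \<open>auto simp: pivotal_def scalar_prod_def intro!: eq_matI\<close>)

section \<open>Blocks of order at most 2\<close>

definition Zcol :: "'a :: zero cfm \<Rightarrow> nat set" where "Zcol d = {j. \<exists>i. ent d i j \<noteq> 0}"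
definition Zrow :: "'a :: zero cfm \<Rightarrow> nat set" where "Zrow d = {i. \<exists>j. ent d i j \<noteq> 0}"

definition xD :: "(nat \<times> nat) set \<Rightarrow> nat \<Rightarrow> 'a :: ring_1 cfm" where
  "xD D n = emb (mat n n (\<lambda>(i, j). if (i, j) \<in> D then 1 else 0))"

context block_type
begin

lemma INS_pr: "S \<subseteq> {..<N} \<Longrightarrow> INS (pr S)"
  by (auto simp: INS_def ent_dg split: if_splits)

lemma dp_dg: "dp (dg t) = dg t"
  by (rule cfm_eqI) (auto simp: ent_dp ent_dg)

text \<open>The generalized inverses of the blocks are assembled into one block-diagonal matrix; the
  nonzero rows and columns of the blocks are exactly those of \<open>d\<close>, because
  \<open>d\<close> has no entries between blocks.\<close>

lemma block_pinv:
  fixes d :: "'a :: field cfm"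
  assumes d: "INS d" "dp d = d" and piv: "\<And>k. k < length ns \<Longrightarrow> \<exists>G. pivotal (ns ! k) (blkm d k) G"
  obtains G where "UT G" "INS G" "G * d = pr (Zcol d)" "d * G = pr (Zrow d)"
proof -
  obtain F where F: "\<And>k. k < length ns \<Longrightarrow> pivotal (ns ! k) (blkm d k) (F k)" using piv by metis
  then have Fc: "F k \<in> carrier_mat (ns ! k) (ns ! k)" if "k < length ns" for k
    using that by (auto simp: pivotal_def)
  let ?G = "emb (bdm F)"
  have UTd: "UT d" using d(2) UT_dp by metis
  have Zin: "Zcol d \<subseteq> {..<N}" "Zrow d \<subseteq> {..<N}" using d(1) by (auto simp: INS_def Zcol_def Zrow_def)
  have same: "bn i = bn j" if "ent d i j \<noteq> 0" for i j
    using that d(2) by (metis ent_dp)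
  have col: "(\<exists>i. ent d i (offset ns k + j) \<noteq> 0) \<longleftrightarrow> (\<exists>i<ns ! k. blkm d k $$ (i, j) \<noteq> 0)"
    "(\<exists>i. ent d (offset ns k + j) i \<noteq> 0) \<longleftrightarrow> (\<exists>i<ns ! k. blkm d k $$ (j, i) \<noteq> 0)"
    if k: "k < length ns" "j < ns ! k" for k j
  proof -
    have in_seg: "\<exists>i'<ns ! k. i = offset ns k + i'" if "bn i = k" for i
      using that offset_add_segment[OF k] k(1) segment_iff[OF k(1), of i] segment_image[OF k(1)]
        blk_le_in[of i "offset ns k + j"] by auto
    show "(\<exists>i. ent d i (offset ns k + j) \<noteq> 0) \<longleftrightarrow> (\<exists>i<ns ! k. blkm d k $$ (i, j) \<noteq> 0)"
    proof
      assume "\<exists>i. ent d i (offset ns k + j) \<noteq> 0"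
      then obtain i where i: "ent d i (offset ns k + j) \<noteq> 0" by blast
      then have "bn i = k" using same offset_add_segment[OF k] by metis
      then obtain i' where "i' < ns ! k" "i = offset ns k + i'" using in_seg by blast
      then show "\<exists>i<ns ! k. blkm d k $$ (i, j) \<noteq> 0"
        using i k by (intro exI[of _ i']) (simp add: blkm_def)
    qed (use k in \<open>auto simp: blkm_def\<close>)
    show "(\<exists>i. ent d (offset ns k + j) i \<noteq> 0) \<longleftrightarrow> (\<exists>i<ns ! k. blkm d k $$ (j, i) \<noteq> 0)"
    proof
      assume "\<exists>i. ent d (offset ns k + j) i \<noteq> 0"
      then obtain i where i: "ent d (offset ns k + j) i \<noteq> 0" by blast
      then have "bn i = k" using same offset_add_segment[OF k] by metis
      then obtain i' where "i' < ns ! k" "i = offset ns k + i'" using in_seg by blast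
      then show "\<exists>i<ns ! k. blkm d k $$ (j, i) \<noteq> 0"
        using i k by (intro exI[of _ i']) (simp add: blkm_def)
    qed (use k in \<open>auto simp: blkm_def\<close>)
  qed
  show thesis
  proof (rule that[of ?G])
    show "UT ?G" "INS ?G" by (rule bdm_emb)+
    show "?G * d = pr (Zcol d)"
    proof (rule blkm_eqI)
      fix k assume k: "k < length ns"
      have "blkm (?G * d) k = F k * blkm d k" using k UTd Fc[OF k] by (simp add: blkm_times bdm_emb blkm_bdm)
      also have "\<dots> = blkm (pr (Zcol d)) k"
        using F[OF k] unfolding pivotal_def
        by (auto simp: blkm_def ent_dg Zcol_def col(1)[OF k, unfolded blkm_def] intro!: eq_matI)
      finally show "blkm (?G * d) k = blkm (pr (Zcol d)) k" .
    qed (use d UTd Zin in \<open>simp_all add: INS_times bdm_emb INS_pr dp_dg dp_times\<close>)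
    show "d * ?G = pr (Zrow d)"
    proof (rule blkm_eqI)
      fix k assume k: "k < length ns"
      have "blkm (d * ?G) k = blkm d k * F k" using k UTd Fc[OF k] by (simp add: blkm_times bdm_emb blkm_bdm)
      also have "\<dots> = blkm (pr (Zrow d)) k"
        using F[OF k] unfolding pivotal_def
        by (auto simp: blkm_def ent_dg Zrow_def col(2)[OF k, unfolded blkm_def] intro!: eq_matI)
      finally show "blkm (d * ?G) k = blkm (pr (Zrow d)) k" .
    qed (use d UTd Zin in \<open>simp_all add: INS_times bdm_emb INS_pr dp_dg dp_times\<close>)
  qed
qed

text \<open>\<open>1 + h\<close> is the product of its diagonal part and a matrix \<open>1 + x\<close> with \<open>x\<close> nilpotent.\<close>

lemma unit_of_dp:
  fixes h :: "'a :: field cfm"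
  assumes h: "UT h" "INS h" and V: "dp (1 + h) * V' = 1" "V' * dp (1 + h) = 1" "UT V'"
  shows "trunc N (1 + h) \<in> parabolic ns" "nu (trunc N (1 + h)) = h"
    "trunc N (dp (1 + h)) \<in> levi ns"
proof -
  let ?V = "dp (1 + h)"
  have UT1: "UT (1 + h)" using h by (intro UT_add UT_one)
  have nil: "NIL (1 + h - ?V)" using UT1 by (rule NIL_minus_dp)
  have e: "1 + h - ?V = h - dp h" by (simp add: dp_add dp_one)
  have "INS (1 + h - ?V)" unfolding e using h by (simp add: INS_minus INS_dp)
  with nil V(3) have "NIL (V' * (1 + h - ?V))" "INS (V' * (1 + h - ?V))"
    by (auto intro: UT_times_NIL INS_UT_times)
  then obtain z where z: "unit_pair (1 + V' * (1 + h - ?V)) (1 + z)" by (rule NIL_unit_pair)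
  have VV: "unit_pair ?V V'" using V by (simp add: unit_pair_def UT_dp)
  have "?V * (1 + V' * (1 + h - ?V)) = ?V + (?V * V') * (1 + h - ?V)" by (simp add: distrib_left mult.assoc)
  then have "?V * (1 + V' * (1 + h - ?V)) = 1 + h" using V by simp
  then have u: "unit_pair (1 + h) ((1 + z) * V')" using unit_pair_times[OF VV z] by simp
  have inv: "invertible_mat (trunc N X)" if "unit_pair X Y" for X Y :: "'a cfm"
  proof -
    have "trunc N X * trunc N Y = 1\<^sub>m N" "trunc N Y * trunc N X = 1\<^sub>m N"
      using that by (simp_all add: unit_pair_def trunc_one flip: trunc_times)
    then show ?thesis
      unfolding invertible_mat_def inverts_mat_def
      by (auto simp: trunc_def square_mat.simps intro!: exI[of _ "trunc N Y"])
  qed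
  show p: "trunc N (1 + h) \<in> parabolic ns"
    using inv[OF u] supported_trunc(1)[OF UT1] by (simp add: parabolic_def GL_def)
  show "trunc N ?V \<in> levi ns"
    using inv[OF VV] supported_trunc(3) by (simp add: levi_def GL_def)
  have "emb (trunc N (1 + h)) = pr {..<N} + h"
    by (rule cfm_eqI) (use h(2) in \<open>auto simp: ent_emb trunc_def ent_one ent_dg INS_def\<close>)
  then show "nu (trunc N (1 + h)) = h" using parabolicD(5)[OF p] by simp
qed

lemma levi_parabolic: "r \<in> levi ns \<Longrightarrow> r \<in> parabolic ns"
  by (auto simp: levi_def parabolic_def supported_on_def)

lemma lift_nu:
  assumes "g \<in> parabolic ns" shows "lift g = 1 + nu g"
  using parabolicD(5)[OF assms] by (simp add: lift_def)

lemma parabolic_unit_pair: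
  fixes g :: "'a :: {field, finite} mat"
  assumes "g \<in> parabolic ns"
  obtains V where "unit_pair (1 + nu g) V"
proof -
  obtain g' where g': "g' \<in> carrier_mat N N" "g * g' = 1\<^sub>m N" "g' * g = 1\<^sub>m N" "UT (emb g')"
    using parabolic_inverse[OF assms] by metis
  have "unit_pair (lift g) (lift g')"
    using g' parabolicD[OF assms] by (intro unit_pair_lift) auto
  then show thesis using that lift_nu[OF assms] by metis
qed

lemma dp_unit_pair:
  assumes "unit_pair X Y" shows "unit_pair (dp X) (dp Y)"
  using assms by (simp add: unit_pair_def UT_dp dp_one flip: dp_times)

text \<open>\<open>1 + h\<close> differs from the unit \<open>p * (1 + nu g) * q'\<close> by
  \<open>(p - q) * q'\<close>, which is strictly block upper. So the diagonal part of
  \<open>1 + h\<close> is invertible, and every such \<open>h\<close> equivalent to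
  \<open>nu g\<close> again comes from an element of \<open>P\<close>.\<close>

lemma parabolic_of_eqv:
  fixes g :: "'a :: {field, finite} mat"
  assumes g: "g \<in> parabolic ns" and e: "eqv (nu g) h" and h: "UT h" "INS h"
  shows "trunc N (1 + h) \<in> parabolic ns" "nu (trunc N (1 + h)) = h"
    "trunc N (dp (1 + h)) \<in> levi ns"
proof -
  obtain p p' q q' where *: "unit_pair p p'" "unit_pair q q'" "NIL (p - q)" "p * nu g = h * q"
    using e unfolding eqv_def by blast
  obtain V where V: "unit_pair (1 + nu g) V" using parabolic_unit_pair[OF g] .
  have U: "unit_pair (p * (1 + nu g) * q') (q * (V * p'))"
    by (intro unit_pair_times * unit_pair_sym[OF *(2)] V)
  have "p * (1 + nu g) * q' = (p - q) * q' + (1 + h) * (q * q')"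
    using *(2,4) by (simp add: algebra_simps unit_pair_def)
  then have "1 + h = p * (1 + nu g) * q' - (p - q) * q'" using *(2) by (simp add: unit_pair_def)
  moreover have "NIL ((p - q) * q')" using * by (intro NIL_times_UT) (auto simp: unit_pair_def)
  ultimately have "dp (1 + h) = dp (p * (1 + nu g) * q')" by (simp only: dp_minus dp_NIL diff_0_right)
  then have "unit_pair (dp (1 + h)) (dp (q * (V * p')))" using dp_unit_pair[OF U] by simp
  then have "dp (1 + h) * dp (q * (V * p')) = 1" "dp (q * (V * p')) * dp (1 + h) = 1"
    "UT (dp (q * (V * p')))" by (auto simp: unit_pair_def)
  from unit_of_dp[OF h this] show "trunc N (1 + h) \<in> parabolic ns" "nu (trunc N (1 + h)) = h"
    "trunc N (dp (1 + h)) \<in> levi ns" .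
qed

lemma blkm_nu:
  assumes "g \<in> parabolic ns" "k < length ns"
  shows "blkm (1 + nu g) k = diag_block ns g k" "blkm (nu g) k = diag_block ns g k - 1\<^sub>m (ns ! k)"
proof -
  have c: "diag_block ns g k \<in> carrier_mat (ns ! k) (ns ! k)" by (simp add: diag_block_def)
  note o = offset_add_segment[OF assms(2)]
  have e: "ent (1 + nu g) (offset ns k + i) (offset ns k + j) = g $$ (offset ns k + i, offset ns k + j)"
    if "i < ns ! k" "j < ns ! k" for i j
    using that o[of i] o[of j] parabolicD(1)[OF assms(1)]
    by (simp add: parabolicD(5)[OF assms(1)] ent_one ent_dg ent_emb)
  show 1: "blkm (1 + nu g) k = diag_block ns g k"
    by (rule eq_matI) (auto simp: blkm_def diag_block_def e simp del: ent_add)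
  have "blkm (nu g) k = blkm (1 + nu g) k - 1\<^sub>m (ns ! k)"
    by (rule eq_matI) (auto simp: blkm_def ent_one)
  then show "blkm (nu g) k = diag_block ns g k - 1\<^sub>m (ns ! k)" using 1 by simp
qed

lemma blkm_NIL: "k < length ns \<Longrightarrow> NIL X \<Longrightarrow> blkm X k = 0\<^sub>m (ns ! k) (ns ! k)"
  by (rule eq_matI) (auto simp: blkm_def offset_add_segment dest: NIL_D)

lemma blkm_unit_pair:
  assumes "unit_pair X Y" "k < length ns"
  shows "blkm X k * blkm Y k = 1\<^sub>m (ns ! k)" "blkm Y k * blkm X k = 1\<^sub>m (ns ! k)"
  using assms by (simp_all add: unit_pair_def blkm_one flip: blkm_times)

text \<open>\<open>p\<close> and \<open>q\<close> have the same \<open>k\<close>-th block, so the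
  relation between \<open>X\<close> and \<open>Y\<close> becomes conjugation by this block.\<close>

lemma blkm_similar:
  assumes "unit_pair p p'" "unit_pair q q'" "NIL (p - q)" "p * X = Y * q" "UT X" "UT Y" "k < length ns"
  shows "similar_mat (blkm Y k) (blkm X k)"
proof -
  let ?m = "ns ! k"
  have UT: "UT p" "UT q" using assms by (auto simp: unit_pair_def)
  have pq: "blkm p k = blkm q k"
  proof (rule eq_matI)
    fix i j assume "i < dim_row (blkm q k)" "j < dim_col (blkm q k)"
    then show "blkm p k $$ (i, j) = blkm q k $$ (i, j)"
      using arg_cong[OF blkm_NIL[OF assms(7,3)], of "\<lambda>A. A $$ (i, j)"] by (simp add: blkm_def)
  qed (auto simp: blkm_def)
  have "blkm p k * blkm X k = blkm Y k * blkm p k"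
    using arg_cong[OF assms(4), of "\<lambda>A. blkm A k"] assms(5-7) UT pq by (simp add: blkm_times)
  then have "blkm p k * blkm X k * blkm p' k = blkm Y k * (blkm p k * blkm p' k)"
    by (simp add: assoc_mult_mat[of _ ?m ?m _ ?m _ ?m])
  then have e: "blkm Y k = blkm p k * blkm X k * blkm p' k"
    using blkm_unit_pair[OF assms(1,7)] right_mult_one_mat[OF blkm_carrier] by metis
  have "similar_mat_wit (blkm Y k) (blkm X k) (blkm p k) (blkm p' k)"
    by (rule similar_mat_witI[OF blkm_unit_pair[OF assms(1,7)] e]) simp_all
  then show ?thesis unfolding similar_mat_def by blast
qed

text \<open>Adding \<open>p\<close> to both sides of \<open>p * nu g = nu g' * q\<close> gives
  \<open>p * (1 + nu g) = Y * q\<close>, where \<open>Y\<close> deviates from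
  \<open>1 + nu g'\<close> by \<open>(p - q) * q'\<close>. The deviation is strictly block upper and
  does not show in the diagonal blocks.\<close>

lemma eqv_diag_similar:
  fixes g g' :: "'a :: {field, finite} mat"
  assumes "g \<in> parabolic ns" "g' \<in> parabolic ns" "eqv (nu g) (nu g')" "k < length ns"
  shows "similar_mat (diag_block ns g' k) (diag_block ns g k)"
proof -
  obtain p p' q q' where *: "unit_pair p p'" "unit_pair q q'" "NIL (p - q)" "p * nu g = nu g' * q"
    using assms(3) unfolding eqv_def by blast
  define Y where "Y = (1 + nu g') + (p - q) * q'"
  have qq: "q' * q = 1" using *(2) by (simp add: unit_pair_def)
  have nil: "NIL ((p - q) * q')" using * by (intro NIL_times_UT) (auto simp: unit_pair_def)
  have UTg: "UT (1 + nu g)" "UT (1 + nu g')" using assms parabolicD by (auto intro!: UT_add UT_one)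
  have "Y * q = q + nu g' * q + (p - q) * (q' * q)" by (simp add: Y_def distrib_right mult.assoc)
  then have "p * (1 + nu g) = Y * q" using *(4) qq by (simp add: distrib_left)
  then have "similar_mat (blkm Y k) (blkm (1 + nu g) k)"
    using UTg assms(4) nil by (intro blkm_similar[OF *(1-3)]) (auto simp: Y_def intro: UT_add NIL_UT)
  moreover have "blkm Y k = blkm (1 + nu g') k"
  proof -
    have "blkm Y k = blkm (1 + nu g') k + blkm ((p - q) * q') k"
      unfolding Y_def by (rule eq_matI) (auto simp: blkm_def)
    then show ?thesis by (simp add: blkm_NIL[OF assms(4) nil])
  qed
  ultimately show ?thesis using blkm_nu assms by metis
qed

lemma roots_no: "D \<subseteq> roots ns \<Longrightarrow> (b, a) \<in> D \<Longrightarrow> b < N \<and> a < N \<and> bn b < bn a"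
  using roots_iff by blast

lemma ent_xD: "D \<subseteq> roots ns \<Longrightarrow> ent (xD D N) i j = (if (i, j) \<in> D then 1 else 0)"
  unfolding xD_def by (auto simp: ent_emb dest: roots_no)

lemma nu_g_elem:
  fixes \<rho> :: "'a :: {field, finite} mat"
  assumes D: "D \<subseteq> roots ns" and r: "\<rho> \<in> levi ns"
  shows "g_elem ns D \<rho> \<in> parabolic ns" "nu (g_elem ns D \<rho>) = nu \<rho> + xD D N"
    "\<And>k. k < length ns \<Longrightarrow> diag_block ns (g_elem ns D \<rho>) k = diag_block ns \<rho> k"
    "dp (nu \<rho>) = nu \<rho>"
proof -
  have rp: "\<rho> \<in> parabolic ns" using r by (rule levi_parabolic)
  note R = parabolicD[OF rp]
  let ?h = "nu \<rho> + xD D N"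
  have nilD: "NIL (xD D N :: 'a cfm)" "INS (xD D N :: 'a cfm)"
    using D by (auto simp: NIL_def INS_def ent_xD dest: roots_no split: if_splits)
  show dpr: "dp (nu \<rho>) = nu \<rho>" using levi_emb(3)[OF r] R(5) by (simp add: dp_minus dp_dg)
  have h: "UT ?h" "INS ?h" using R nilD by (auto intro: UT_add INS_add NIL_UT)
  have d: "dp (1 + ?h) = 1 + nu \<rho>" using dpr nilD by (simp add: dp_add dp_one dp_NIL)
  obtain V where "unit_pair (1 + nu \<rho>) V" using parabolic_unit_pair[OF rp] .
  then have V: "(1 + nu \<rho>) * V = 1" "V * (1 + nu \<rho>) = 1" "UT V" by (auto simp: unit_pair_def)
  have "trunc N (1 + ?h) = g_elem ns D \<rho>"
  proof (rule eq_matI)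
    fix i j assume "i < dim_row (g_elem ns D \<rho>)" "j < dim_col (g_elem ns D \<rho>)"
    then have "i < N" "j < N" by (auto simp: g_elem_def rook_mat_def)
    then show "trunc N (1 + ?h) $$ (i, j) = g_elem ns D \<rho> $$ (i, j)"
      using R(1) D by (simp add: trunc_def g_elem_def rook_mat_def R(5) ent_xD ent_one ent_dg ent_emb)
  qed (auto simp: trunc_def g_elem_def rook_mat_def)
  then show "g_elem ns D \<rho> \<in> parabolic ns" "nu (g_elem ns D \<rho>) = ?h"
    using unit_of_dp(1,2)[OF h, unfolded d, OF V] by simp_all
  fix k assume k: "k < length ns"
  show "diag_block ns (g_elem ns D \<rho>) k = diag_block ns \<rho> k"
  proof (rule eq_matI)
    fix i j assume "i < dim_row (diag_block ns \<rho> k)" "j < dim_col (diag_block ns \<rho> k)"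
    then have ij: "i < ns ! k" "j < ns ! k" by (auto simp: diag_block_def)
    then have "(offset ns k + i, offset ns k + j) \<notin> D" using roots_no[OF D] offset_add_segment[OF k] by fastforce
    then show "diag_block ns (g_elem ns D \<rho>) k $$ (i, j) = diag_block ns \<rho> k $$ (i, j)"
      using ij offset_add_segment[OF k] R(1) by (simp add: diag_block_def g_elem_def rook_mat_def)
  qed (auto simp: diag_block_def)
qed

end

section \<open>Elements of \<open>BB\<close> as normal forms\<close>

locale small_blocks = block_type +
  fixes C :: "'a :: {field, finite} mat set"
  assumes size: "k < length ns \<Longrightarrow> ns ! k = 1 \<or> ns ! k = 2"
    and C: "is_Cl2 C"
begin

definition isol :: "(nat \<times> nat) set \<Rightarrow> nat \<Rightarrow> bool" where
  "isol D k \<longleftrightarrow> (\<forall>i. bn i = k \<longrightarrow> no_roots D i)"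

lemma in_block:
  assumes "k < length ns"
  shows "bn i = k \<longleftrightarrow> i = offset ns k \<or> (ns ! k = 2 \<and> i = offset ns k + 1)"
proof -
  have "bn i = k \<longleftrightarrow> i \<in> segment ns k"
    using segment_iff[OF assms, of i] assms by (auto simp: bn_def split: if_splits)
  also have "\<dots> \<longleftrightarrow> i = offset ns k \<or> (ns ! k = 2 \<and> i = offset ns k + 1)"
    using size[OF assms] offset_Suc[OF assms] by (auto simp: segment_def)
  finally show ?thesis .
qed

lemma isol_iff:
  assumes "k < length ns"
  shows "isol D k \<longleftrightarrow> no_roots D (offset ns k) \<and> (ns ! k = 2 \<longrightarrow> no_roots D (offset ns k + 1))"
  unfolding isol_def in_block[OF assms] by auto

lemma ent_nu_block:
  assumes "g \<in> parabolic ns" "k < length ns" "i < ns ! k" "j < ns ! k"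
  shows "ent (nu g) (offset ns k + i) (offset ns k + j) =
    diag_block ns g k $$ (i, j) - (if i = j then 1 else 0)"
proof -
  have "ent (nu g) (offset ns k + i) (offset ns k + j) = blkm (nu g) k $$ (i, j)"
    using assms by (simp add: blkm_def)
  then show ?thesis using blkm_nu(2)[OF assms(1,2)] assms by (simp add: diag_block_def)
qed

lemma BB_D:
  assumes "(D, \<rho>) \<in> BB ns Ds C" "k < length ns"
  shows "\<rho> \<in> levi ns" "D \<in> Ds"
    "ns ! k = 1 \<Longrightarrow> block1_ok D (offset ns k) (diag_block ns \<rho> k)"
    "ns ! k = 2 \<Longrightarrow> block2_ok C D (offset ns k) (diag_block ns \<rho> k)"
  using assms by (auto simp: BB_def)

lemma BB_pivotal:
  assumes "(D, \<rho>) \<in> BB ns Ds C" "k < length ns"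
  shows "\<exists>G. pivotal (ns ! k) (blkm (nu \<rho>) k) G"
proof (cases "ns ! k = 1")
  case True
  then show ?thesis using pivotal_1[of "blkm (nu \<rho>) k"] blkm_carrier[of "nu \<rho>" k] by simp
next
  case False
  then have 2: "ns ! k = 2" using size[OF assms(2)] by simp
  have e: "blkm (nu \<rho>) k = diag_block ns \<rho> k - 1\<^sub>m 2"
    using blkm_nu(2)[OF levi_parabolic[OF BB_D(1)[OF assms]] assms(2)] 2 by simp
  show ?thesis
  proof (cases "isol D k")
    case True
    then have "diag_block ns \<rho> k \<in> C"
      using BB_D(4)[OF assms 2] block2_ok_isolated isol_iff[OF assms(2)] 2 by metis
    then show ?thesis using pivotal_Cl2[OF C] e 2 by metis
  next
    case False
    then have "listed D (offset ns k) (diag_block ns \<rho> k)"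
      using BB_D(4)[OF assms 2] block2_ok_listed isol_iff[OF assms(2)] 2 by metis
    then show ?thesis using pivotal_listed e 2 by metis
  qed
qed

lemma BB_vanish_block:
  assumes B: "(D, \<rho>) \<in> BB ns Ds C" "k < length ns" and ij: "i < ns ! k" "j < ns ! k"
    and root: "row_root D (offset ns k + i) \<or> col_root D (offset ns k + j)"
  shows "diag_block ns \<rho> k $$ (i, j) = (if i = j then 1 else 0)"
proof (cases "ns ! k = 1")
  case True
  then have "diag_block ns \<rho> k = 1\<^sub>m 1" using BB_D(3)[OF B True] ij root by (auto simp: block1_ok_def)
  then show ?thesis using ij True by simp
next
  case False
  then have 2: "ns ! k = 2" using size[OF B(2)] by simp
  then have ij': "i = 0 \<or> i = Suc 0" "j = 0 \<or> j = Suc 0" using ij less_2_iff by auto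
  then have "\<not> (no_roots D (offset ns k) \<and> no_roots D (offset ns k + 1))"
    using root by (auto simp: no_roots_def)
  then have "listed D (offset ns k) (diag_block ns \<rho> k)" using BB_D(4)[OF B 2] block2_ok_listed by metis
  then obtain p q r s where "diag_block ns \<rho> k = mat2 p q r s"
    "row_root D (offset ns k) \<longrightarrow> p = 1 \<and> q = 0" "row_root D (offset ns k + 1) \<longrightarrow> r = 0 \<and> s = 1"
    "col_root D (offset ns k) \<longrightarrow> p = 1 \<and> r = 0" "col_root D (offset ns k + 1) \<longrightarrow> q = 0 \<and> s = 1"
    unfolding listed_def by blast
  then show ?thesis using ij' root by auto
qed

text \<open>Supplies the conditions \<open>D_row\<close> and \<open>D_col\<close> of
  \<open>normal_form\<close>: roots lie neither in pivot rows nor in pivot columns.\<close>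

lemma BB_vanish:
  assumes B: "(D, \<rho>) \<in> BB ns Ds C" and root: "row_root D i \<or> col_root D j"
  shows "ent (nu \<rho>) i j = 0"
proof (rule ccontr)
  assume ne: "ent (nu \<rho>) i j \<noteq> 0"
  have r: "\<rho> \<in> levi ns" using B by (auto simp: BB_def)
  have "dp (nu \<rho>) = nu \<rho>" using nu_g_elem(4)[OF _ r, of "{}"] by simp
  then have "bn i = bn j" using ne by (metis ent_dp)
  moreover have "i < N" using ne parabolicD(4)[OF levi_parabolic[OF r]] by (auto simp: INS_def)
  ultimately obtain k i' j' where k: "k < length ns" "i' < ns ! k" "j' < ns ! k" "i = offset ns k + i'"
      "j = offset ns k + j'" using segment_cases by metis
  have "diag_block ns \<rho> k $$ (i', j') = (if i' = j' then 1 else 0)"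
    using BB_vanish_block[OF B k(1-3)] root k by simp
  then show False using ent_nu_block[OF levi_parabolic[OF r] k(1-3)] ne k by simp
qed

lemma rook_chains:
  assumes "rook_placement ns D" shows "D \<subseteq> roots ns" "chains N D"
proof -
  show D: "D \<subseteq> roots ns" using assms by (simp add: rook_placement_def)
  show "chains N D"
    unfolding chains_def
  proof (intro conjI allI impI)
    fix b a assume "(b, a) \<in> D"
    then show "b < a" "a < N" using roots_no[OF D] blk_less_imp by blast+
  next
    fix b a a' assume "(b, a) \<in> D" "(b, a') \<in> D"
    then show "a = a'" using assms unfolding rook_placement_def Uniq_def by blast
  next
    fix b b' a assume "(b, a) \<in> D" "(b', a) \<in> D"
    then show "b = b'" using assms unfolding rook_placement_def Uniq_def by blast
  qed
qed

lemma BB_normal_form: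
  assumes B: "(D, \<rho>) \<in> BB ns Ds C" and D: "rook_placement ns D"
  obtains G where "normal_form N bn D (Zcol (nu \<rho>)) (nu \<rho>) G (nu (g_elem ns D \<rho>))"
proof -
  have r: "\<rho> \<in> levi ns" using B by (auto simp: BB_def)
  note n = nu_g_elem[OF rook_chains(1)[OF D] r]
  note R = parabolicD[OF levi_parabolic[OF r]]
  obtain G where G: "G * nu \<rho> = pr (Zcol (nu \<rho>))"
    using block_pinv[OF R(4) n(4) BB_pivotal[OF B]] by metis
  show thesis
  proof (rule that, unfold_locales)
    show "chains N D" by (rule rook_chains[OF D])
    show "bn b < bn a" if "(b, a) \<in> D" for a b using roots_no[OF rook_chains(1)[OF D] that] by simp
    show "bn i = bn j \<and> j \<in> Zcol (nu \<rho>)" if "ent (nu \<rho>) i j \<noteq> 0" for i j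
      using that n(4) unfolding Zcol_def by (metis (mono_tags, lifting) ent_dp mem_Collect_eq)
    show "ent (nu \<rho>) b j = 0" if "(b, a) \<in> D" for b a j
      using BB_vanish[OF B] that by (auto simp: row_root_def)
    show "a \<notin> Zcol (nu \<rho>)" if "(b, a) \<in> D" for b a
      using BB_vanish[OF B] that by (auto simp: col_root_def Zcol_def)
    show "G * nu \<rho> = pr (Zcol (nu \<rho>))" by (rule G)
    show "ent (nu (g_elem ns D \<rho>)) i j = ent (nu \<rho>) i j + (if (i, j) \<in> D then 1 else 0)" for i j
      unfolding n(2) by (simp add: ent_xD[OF rook_chains(1)[OF D]])
  qed
qed

lemma weylI:
  assumes w: "w permutes {..<N}" and b: "\<And>a. a < N \<Longrightarrow> bn (w a) = bn a"
  shows "w \<in> weyl ns"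
proof -
  have "w ` segment ns k = segment ns k" if k: "k < length ns" for k
  proof (rule endo_inj_surj)
    show "w ` segment ns k \<subseteq> segment ns k"
    proof
      fix i assume "i \<in> w ` segment ns k"
      then obtain a where a: "i = w a" "a < N" "bn a = k" using segment_iff[OF k] by auto
      then have "i < N" using permutes_in_image[OF w, of a] by simp
      then show "i \<in> segment ns k" using segment_iff[OF k] b a by simp
    qed
    show "inj_on w (segment ns k)" using permutes_inj_on[OF w] .
    show "finite (segment ns k)" by (simp add: segment_def)
  qed
  then show ?thesis using w by (simp add: weyl_def lessThan_atLeast0)
qed

lemma weylD:
  assumes "w \<in> weyl ns" shows "w permutes {..<N}" "bn (w a) = bn a"
proof -
  show w: "w permutes {..<N}" using assms by (simp add: weyl_def lessThan_atLeast0)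
  show "bn (w a) = bn a"
  proof (cases "a < N")
    case True
    then have s: "bn a < length ns" "a \<in> segment ns (bn a)" using bn_segment by auto
    then have "w a \<in> segment ns (bn a)" using assms by (auto simp: weyl_def)
    then show ?thesis using bn_eqI s by blast
  next
    case False
    then show ?thesis using permutes_not_in[OF w, of a] by simp
  qed
qed

lemma weyl_equiv_refl: "weyl_equiv ns D D"
  unfolding weyl_equiv_def
proof
  show "id \<in> weyl ns" by (auto simp: weyl_def permutes_id)
  show "D = map_prod id id ` D" by (auto simp: map_prod_def)
qed

lemma similar_mat_1:
  fixes A B :: "'a mat"
  assumes "similar_mat A B" "A \<in> carrier_mat 1 1" shows "A = B"
proof -
  obtain P Q where PQ: "P \<in> carrier_mat 1 1" "Q \<in> carrier_mat 1 1" "B \<in> carrier_mat 1 1"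
    "P * Q = 1\<^sub>m 1" "A = P * B * Q" by (rule similar_mat_witD[OF assms])
  have m: "(X * Y) $$ (0, 0) = X $$ (0, 0) * Y $$ (0, 0)"
    if "X \<in> carrier_mat 1 1" "Y \<in> carrier_mat 1 1" for X Y :: "'a mat"
    using that by (auto simp: scalar_prod_def)
  have "P $$ (0, 0) * Q $$ (0, 0) = 1" using m[OF PQ(1,2)] PQ(4) by simp
  then have "A $$ (0, 0) = B $$ (0, 0)"
    using m[OF mult_carrier_mat[OF PQ(1,3)] PQ(2)] m[OF PQ(1,3)] PQ(5) by (simp add: algebra_simps)
  then show ?thesis using assms(2) PQ(3) by (intro eq_matI) auto
qed

lemma BB_unique:
  assumes rep: "representatives {D. rook_placement ns D} (weyl_equiv ns) Ds"
    and B: "(D, \<rho>) \<in> BB ns Ds C" and B': "(D', \<rho>') \<in> BB ns Ds C"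
    and e: "eqv (nu (g_elem ns D \<rho>)) (nu (g_elem ns D' \<rho>'))"
  shows "D = D' \<and> \<rho> = \<rho>'"
proof -
  have r: "\<rho> \<in> levi ns" "\<rho>' \<in> levi ns" "D \<in> Ds" "D' \<in> Ds" using B B' by (auto simp: BB_def)
  then have D: "rook_placement ns D" "rook_placement ns D'" using rep by (auto simp: representatives_def)
  obtain G where G: "normal_form N bn D (Zcol (nu \<rho>)) (nu \<rho>) G (nu (g_elem ns D \<rho>))"
    using BB_normal_form[OF B D(1)] .
  obtain G' where G': "normal_form N bn D' (Zcol (nu \<rho>')) (nu \<rho>') G' (nu (g_elem ns D' \<rho>'))"
    using BB_normal_form[OF B' D(2)] .
  obtain w where w: "w permutes {..<N}" "\<And>a. a < N \<Longrightarrow> bn (w a) = bn a" "map_prod w w ` D = D'"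
    using normal_form_unique[OF G G' e] by metis
  then have "weyl_equiv ns D D'" unfolding weyl_equiv_def using weylI by blast
  then have DD: "D = D'"
    using rep D r weyl_equiv_refl[of D] unfolding representatives_def by blast
  note n = nu_g_elem[OF rook_chains(1)[OF D(1)] r(1)]
  note n' = nu_g_elem[OF rook_chains(1)[OF D(2)] r(2)]
  have eq: "diag_block ns \<rho> k = diag_block ns \<rho>' k" if k: "k < length ns" for k
  proof -
    have sim: "similar_mat (diag_block ns \<rho>' k) (diag_block ns \<rho> k)"
      using eqv_diag_similar[OF n(1) n'(1) e k] n(3)[OF k] n'(3)[OF k] by simp
    have c: "diag_block ns \<rho>' k \<in> carrier_mat (ns ! k) (ns ! k)" by (simp add: diag_block_def)
    show ?thesis
    proof (cases "ns ! k = 1")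
      case True
      then show ?thesis using similar_mat_1[OF sim] c by simp
    next
      case False
      then have 2: "ns ! k = 2" using size[OF k] by simp
      note b = BB_D(4)[OF B k 2] BB_D(4)[OF B' k 2]
      show ?thesis
      proof (cases "no_roots D (offset ns k) \<and> no_roots D (offset ns k + 1)")
        case True
        then have m: "diag_block ns \<rho> k \<in> C" "diag_block ns \<rho>' k \<in> C"
          using b block2_ok_isolated DD by metis+
        then have "diag_block ns \<rho>' k \<in> GL 2" using C by (auto simp: is_Cl2_def representatives_def)
        moreover have "similar_mat (diag_block ns \<rho>' k) (diag_block ns \<rho>' k)" using c by (rule similar_mat_refl)
        ultimately show ?thesis using m sim C unfolding is_Cl2_def representatives_def by metis
      next
        case False
        then show ?thesis using b block2_ok_listed listed_unique sim DD by metis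
      qed
    qed
  qed
  have "emb \<rho> = emb \<rho>'"
    by (rule blkm_eqI)
      (use levi_emb[OF r(1)] levi_emb[OF r(2)] eq in \<open>simp_all add: INS_emb blkm_emb\<close>)
  then have "\<rho> = \<rho>'"
    using trunc_emb[OF levi_emb(1)[OF r(1)]] trunc_emb[OF levi_emb(1)[OF r(2)]] by metis
  then show ?thesis using DD by simp
qed

end

section \<open>Existence of the normal form\<close>

text \<open>Conjugation by \<open>dg t\<close> multiplies the entry at \<open>(i, j)\<close> by
  \<open>t i / t j\<close>. The recursion is the condition that this becomes 1, so
  \<open>torus\<close> is the product of the entries along the chain ending at \<open>j\<close>. The
  guard \<open>i < j\<close> ensures termination.\<close>

function torus :: "'a :: field cfm \<Rightarrow> nat \<Rightarrow> 'a" where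
  "torus h j = (if \<exists>i<j. ent h i j \<noteq> 0
     then ent h (SOME i. i < j \<and> ent h i j \<noteq> 0) j * torus h (SOME i. i < j \<and> ent h i j \<noteq> 0) else 1)"
  by pat_completeness auto
termination
proof (relation "measure (\<lambda>(h, j). j)", simp)
  fix h :: "'a cfm" and j :: nat
  assume "\<exists>i<j. ent h i j \<noteq> 0"
  then have "(SOME i. i < j \<and> ent h i j \<noteq> 0) < j" by (rule someI2_ex) simp
  then show "((h, SOME i. i < j \<and> ent h i j \<noteq> 0), h, j) \<in> measure (\<lambda>(h, j). j)" by simp
qed

declare torus.simps [simp del]

lemma torus_nonzero: "torus h j \<noteq> 0"
proof (induction j rule: less_induct)
  case (less j)
  show ?case
  proof (cases "\<exists>i<j. ent h i j \<noteq> 0")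
    case True
    then have "(SOME i. i < j \<and> ent h i j \<noteq> 0) < j \<and> ent h (SOME i. i < j \<and> ent h i j \<noteq> 0) j \<noteq> 0"
      by (rule someI_ex)
    then show ?thesis using less True by (subst torus.simps) simp
  next
    case False
    then have "torus h j = 1" unfolding torus.simps[of h j] by (simp only: if_False)
    then show ?thesis by simp
  qed
qed

lemma torus_step:
  assumes "i < j" "ent h i j \<noteq> 0" "\<And>i'. i' < j \<Longrightarrow> ent h i' j \<noteq> 0 \<Longrightarrow> i' = i"
  shows "torus h j = ent h i j * torus h i"
proof -
  have "(SOME i. i < j \<and> ent h i j \<noteq> 0) = i"
  proof (rule some_equality)
    show "i < j \<and> ent h i j \<noteq> 0" using assms(1,2) by simp
    show "i' = i" if "i' < j \<and> ent h i' j \<noteq> 0" for i' using assms(3) that by blast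
  qed
  moreover have "\<exists>i<j. ent h i j \<noteq> 0" using assms(1,2) by blast
  ultimately show ?thesis unfolding torus.simps[of h j] by simp
qed

context small_blocks
begin

lemma diag_block_GL:
  assumes g: "(g :: 'a mat) \<in> parabolic ns" "k < length ns"
  shows "diag_block ns g k \<in> GL (ns ! k)"
proof -
  obtain V where V: "unit_pair (1 + nu g) V" using parabolic_unit_pair[OF g(1)] .
  have "diag_block ns g k * blkm V k = 1\<^sub>m (ns ! k)" "blkm V k * diag_block ns g k = 1\<^sub>m (ns ! k)"
    using blkm_unit_pair[OF V g(2)] blkm_nu(1)[OF g] by simp_all
  moreover have "diag_block ns g k \<in> carrier_mat (ns ! k) (ns ! k)" by (simp add: diag_block_def)
  ultimately show ?thesis
    unfolding GL_def invertible_mat_def inverts_mat_def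
    by (auto simp: square_mat.simps intro!: exI[of _ "blkm V k"]) (simp_all add: blkm_def)
qed

text \<open>\<open>S\<close> is the set of blocks to be moved into \<open>C\<close>. The lemma
  serves twice: for all blocks at the start, and at the end for the isolated blocks only, when the
  others must stay fixed.\<close>

lemma block_normalize:
  assumes g: "(g :: 'a mat) \<in> parabolic ns"
  obtains P Q where
    "\<And>k. k < length ns \<Longrightarrow> P k \<in> carrier_mat (ns ! k) (ns ! k) \<and> Q k \<in> carrier_mat (ns ! k) (ns ! k) \<and>
      P k * Q k = 1\<^sub>m (ns ! k) \<and> Q k * P k = 1\<^sub>m (ns ! k)"
    "\<And>k. k < length ns \<Longrightarrow> k \<notin> S \<Longrightarrow> P k = 1\<^sub>m (ns ! k) \<and> Q k = 1\<^sub>m (ns ! k)"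
    "\<And>k. k < length ns \<Longrightarrow> k \<in> S \<Longrightarrow> ns ! k = 2 \<Longrightarrow>
      \<exists>B\<in>C. P k * (diag_block ns g k - 1\<^sub>m 2) * Q k = B - 1\<^sub>m 2"
proof -
  have "\<exists>P Q. P \<in> carrier_mat (ns ! k) (ns ! k) \<and> Q \<in> carrier_mat (ns ! k) (ns ! k) \<and>
      P * Q = 1\<^sub>m (ns ! k) \<and> Q * P = 1\<^sub>m (ns ! k) \<and> (k \<notin> S \<longrightarrow> P = 1\<^sub>m (ns ! k) \<and> Q = 1\<^sub>m (ns ! k)) \<and>
      (k \<in> S \<longrightarrow> ns ! k = 2 \<longrightarrow> (\<exists>B\<in>C. P * (diag_block ns g k - 1\<^sub>m 2) * Q = B - 1\<^sub>m 2))"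
    if k: "k < length ns" for k
  proof (cases "k \<in> S \<and> ns ! k = 2")
    case False
    then show ?thesis by (intro exI[of _ "1\<^sub>m (ns ! k)"]) auto
  next
    case True
    let ?A = "diag_block ns g k"
    have A: "?A \<in> GL 2" "?A \<in> carrier_mat 2 2"
      using diag_block_GL[OF g k] True by (simp_all add: GL_def)
    obtain B where B: "B \<in> C" "similar_mat ?A B"
      using C A(1) unfolding is_Cl2_def representatives_def by blast
    obtain P Q where PQ: "P \<in> carrier_mat 2 2" "Q \<in> carrier_mat 2 2" "B \<in> carrier_mat 2 2"
      "P * Q = 1\<^sub>m 2" "Q * P = 1\<^sub>m 2" "?A = P * B * Q" using similar_mat_witD[OF B(2) A(2)] .
    have "Q * ?A * P = (Q * P) * B * (Q * P)"
      unfolding PQ(6) using PQ(1-3) by (simp add: assoc_mult_mat[of _ 2 2 _ 2 _ 2] mult_carrier_mat[of _ 2 2 _ 2])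
    then have 1: "Q * ?A * P = B" using PQ by simp
    have "Q * (?A - 1\<^sub>m 2) * P = (Q * ?A - Q * 1\<^sub>m 2) * P"
      using PQ(2) A(2) by (simp add: mult_minus_distrib_mat[of _ 2 2])
    also have "\<dots> = Q * ?A * P - Q * 1\<^sub>m 2 * P"
      using PQ(1,2) A(2) by (intro minus_mult_distrib_mat[of _ 2 2]) auto
    also have "\<dots> = B - 1\<^sub>m 2" using 1 PQ(2,5) by simp
    finally have "Q * (?A - 1\<^sub>m 2) * P = B - 1\<^sub>m 2" .
    then show ?thesis using PQ B(1) True by (intro exI[of _ Q] exI[of _ P]) auto
  qed
  then obtain P Q where "\<And>k. k < length ns \<Longrightarrow> P k \<in> carrier_mat (ns ! k) (ns ! k) \<and> Q k \<in> carrier_mat (ns ! k) (ns ! k) \<and>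
      P k * Q k = 1\<^sub>m (ns ! k) \<and> Q k * P k = 1\<^sub>m (ns ! k) \<and> (k \<notin> S \<longrightarrow> P k = 1\<^sub>m (ns ! k) \<and> Q k = 1\<^sub>m (ns ! k)) \<and>
      (k \<in> S \<longrightarrow> ns ! k = 2 \<longrightarrow> (\<exists>B\<in>C. P k * (diag_block ns g k - 1\<^sub>m 2) * Q k = B - 1\<^sub>m 2))"
    by metis
  then show thesis using that[of P Q] by blast
qed

text \<open>
  A normal form up to the Weyl group and up to conjugation in the isolated blocks.
\<close>

definition prenormal :: "(nat \<times> nat) set \<Rightarrow> 'a cfm \<Rightarrow> bool" where
  "prenormal D h \<longleftrightarrow> UT h \<and> INS h \<and>
    (\<forall>i j. bn i < bn j \<longrightarrow> ent h i j = (if (i, j) \<in> D then 1 else 0)) \<and>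
    (\<forall>i j. bn i = bn j \<longrightarrow> row_root D i \<or> col_root D j \<longrightarrow> ent h i j = 0) \<and>
    (\<forall>i j i' j'. bn i = bn j \<longrightarrow> bn i' = bn i \<longrightarrow> bn j' = bn i \<longrightarrow> \<not> isol D (bn i) \<longrightarrow>
       ent h i j \<noteq> 0 \<longrightarrow> ent h i' j' \<noteq> 0 \<longrightarrow> i = i' \<and> j = j') \<and>
    (\<forall>i j. bn i = bn j \<longrightarrow> i \<noteq> j \<longrightarrow> \<not> isol D (bn i) \<longrightarrow> ent h i j \<noteq> 0 \<longrightarrow> ent h i j = 1)"

lemma prenormalD:
  assumes "prenormal D h"
  shows "UT h" "INS h" "\<And>i j. bn i < bn j \<Longrightarrow> ent h i j = (if (i, j) \<in> D then 1 else 0)"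
    "\<And>i j. bn i = bn j \<Longrightarrow> row_root D i \<or> col_root D j \<Longrightarrow> ent h i j = 0"
    "\<And>i j i' j'. bn i = bn j \<Longrightarrow> bn i' = bn i \<Longrightarrow> bn j' = bn i \<Longrightarrow> \<not> isol D (bn i) \<Longrightarrow>
       ent h i j \<noteq> 0 \<Longrightarrow> ent h i' j' \<noteq> 0 \<Longrightarrow> i = i' \<and> j = j'"
    "\<And>i j. bn i = bn j \<Longrightarrow> i \<noteq> j \<Longrightarrow> \<not> isol D (bn i) \<Longrightarrow> ent h i j \<noteq> 0 \<Longrightarrow> ent h i j = 1"
  using assms unfolding prenormal_def by blast+

lemma block_unique_pair:
  assumes "bn a = bn a'" "a \<noteq> a'" "bn i = bn a"
  shows "i = a \<or> i = a'"
proof -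
  have "a < N" using assms blk_eq_in by blast
  then have k: "bn a < length ns" using bn_segment by simp
  show ?thesis
    using assms in_block[OF k, of a] in_block[OF k, of a'] in_block[OF k, of i] by auto
qed

text \<open>A representative with \<open>B - 1\<close> invertible would make every row and column of
  the block a pivot, against \<open>free\<close>. The remaining representatives leave at most one
  entry, and \<open>x \<le> y\<close> since the unipotent one is upper triangular; this position is
  what allows \<open>torus\<close> to scale it.\<close>

lemma single_entry_block:
  assumes k: "k < length ns"
    and B: "ns ! k = 2 \<Longrightarrow> \<exists>B\<in>C. blkm d k = B - 1\<^sub>m 2"
    and free: "bn b = k" "b \<notin> Zrow d \<or> b \<notin> Zcol d"
  obtains x y where "x \<le> y" "\<And>i j. bn i = k \<Longrightarrow> bn j = k \<Longrightarrow> ent d i j \<noteq> 0 \<Longrightarrow> i = x \<and> j = y"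
proof (cases "ns ! k = 2")
  case False
  then have "\<And>i. bn i = k \<Longrightarrow> i = offset ns k" using in_block[OF k] by simp
  then show ?thesis using that[of "offset ns k" "offset ns k"] by blast
next
  case True
  let ?o = "offset ns k"
  obtain B where B: "B \<in> C" "blkm d k = B - 1\<^sub>m 2" using B[OF True] by blast
  have e: "ent d (?o + i) (?o + j) = (B - 1\<^sub>m 2) $$ (i, j)" if "i < 2" "j < 2" for i j
    using that True arg_cong[OF B(2), of "\<lambda>A. A $$ (i, j)"] by (simp add: blkm_def)
  have e': "ent d ?o ?o = (B - 1\<^sub>m 2) $$ (0, 0)" "ent d ?o (?o + 1) = (B - 1\<^sub>m 2) $$ (0, 1)"
    "ent d (?o + 1) ?o = (B - 1\<^sub>m 2) $$ (1, 0)" "ent d (?o + 1) (?o + 1) = (B - 1\<^sub>m 2) $$ (1, 1)"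
    using e[of 0 0] e[of 0 1] e[of 1 0] e[of 1 1] by simp_all
  have bk: "bn i = k \<longleftrightarrow> i = ?o \<or> i = ?o + 1" for i using in_block[OF k] True by simp
  show ?thesis
  proof (cases rule: Cl2_cases[OF C B(1)])
    case (1 a)
    have "i = ?o \<and> j = ?o" if "bn i = k" "bn j = k" "ent d i j \<noteq> 0" for i j
      using that e' unfolding bk 1 mat2_one mat2_minus by auto
    then show ?thesis using that[of ?o ?o] by blast
  next
    case 2
    show ?thesis
    proof (rule that[of ?o "?o + 1"])
      show "i = ?o \<and> j = ?o + 1" if "bn i = k" "bn j = k" "ent d i j \<noteq> 0" for i j
        using that e' unfolding bk 2 mat2_one mat2_minus by auto
    qed simp
  next
    case (3 a b' c f)
    have nz: "a - 1 \<noteq> 0 \<or> b' \<noteq> 0" "c \<noteq> 0 \<or> f - 1 \<noteq> 0" "a - 1 \<noteq> 0 \<or> c \<noteq> 0" "b' \<noteq> 0 \<or> f - 1 \<noteq> 0"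
      using 3(2) by auto
    have z: "ent d ?o ?o = a - 1" "ent d ?o (?o + 1) = b'" "ent d (?o + 1) ?o = c" "ent d (?o + 1) (?o + 1) = f - 1"
      using e' unfolding 3(1) mat2_one mat2_minus by simp_all
    have "?o \<in> Zrow d" "?o + 1 \<in> Zrow d" "?o \<in> Zcol d" "?o + 1 \<in> Zcol d"
      unfolding Zrow_def Zcol_def mem_Collect_eq using z nz by metis+
    then have "b \<in> Zrow d \<and> b \<in> Zcol d" using free(1) unfolding bk by blast
    then show ?thesis using free(2) by blast
  qed
qed

lemma prenormal_exists:
  assumes g: "(g :: 'a mat) \<in> parabolic ns"
  obtains D h where "rook_placement ns D" "prenormal D h" "eqv (nu g) h"
proof -
  obtain P Q where PQ: "\<And>k. k < length ns \<Longrightarrow> P k \<in> carrier_mat (ns ! k) (ns ! k) \<and> Q k \<in> carrier_mat (ns ! k) (ns ! k) \<and>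
      P k * Q k = 1\<^sub>m (ns ! k) \<and> Q k * P k = 1\<^sub>m (ns ! k)"
    and PQC: "\<And>k. k < length ns \<Longrightarrow> ns ! k = 2 \<Longrightarrow> \<exists>B\<in>C. P k * (diag_block ns g k - 1\<^sub>m 2) * Q k = B - 1\<^sub>m 2"
    using block_normalize[OF g, of UNIV] by (metis UNIV_I)
  define h1 where "h1 = emb (bdm P) * nu g * emb (bdm Q)"
  have h1: "UT h1" "INS h1" "eqv (nu g) h1" "\<And>k. k < length ns \<Longrightarrow> blkm h1 k = P k * blkm (nu g) k * Q k"
    unfolding h1_def using levi_block_conj[of P Q "nu g"] PQ parabolicD(3,4)[OF g] by blast+
  define d where "d = dp h1"
  have INSd: "INS d" using h1(2) by (simp add: d_def INS_dp)
  have dpd: "dp d = d" by (rule cfm_eqI) (simp add: d_def ent_dp)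
  have dC: "\<exists>B\<in>C. blkm d k = B - 1\<^sub>m 2" if "k < length ns" "ns ! k = 2" for k
    using that PQC[OF that] h1(4)[OF that(1)] blkm_nu(2)[OF g that(1)] by (simp add: d_def blkm_dp)
  have same: "bn i = bn j" if "ent d i j \<noteq> 0" for i j using that dpd by (metis ent_dp)
  have piv: "\<exists>G. pivotal (ns ! k) (blkm d k) G" if k: "k < length ns" for k
  proof (cases "ns ! k = 2")
    case True
    then show ?thesis using dC[OF k True] pivotal_Cl2[OF C] by metis
  next
    case False
    then have "ns ! k = 1" using size[OF k] by simp
    then show ?thesis using pivotal_1[of "blkm d k"] blkm_carrier[of d k] by simp
  qed
  obtain G where G: "UT G" "INS G" "G * d = pr (Zcol d)" "d * G = pr (Zrow d)"
    using block_pinv[OF INSd dpd piv] by metis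
  have dGd: "d * G * d = d" unfolding G(4) by (rule pr_times_eqI) (auto simp: Zrow_def)
  obtain u where u: "NIL u" "INS u" "eqv h1 (d + u)" "u * (G * d) = 0" "d * G * u = 0"
    using clear_pivots[OF h1(1,2) d_def G(1,2) dGd] by metis
  \<comment> \<open>In a block of order at most 2, two free rows are all the rows, so
    \<open>d\<close> vanishes on the block and its columns are free as well; likewise for
    columns.\<close>
  interpret pivots N bn "Zrow d" "Zcol d" d
  proof
    fix a a' assume a: "bn a = bn a'" "a \<noteq> a'"
    show "a \<notin> Zcol d" if f: "a \<notin> Zrow d" "a' \<notin> Zrow d"
    proof
      assume "a \<in> Zcol d"
      then obtain i where i: "ent d i a \<noteq> 0" by (auto simp: Zcol_def)
      then have "i = a \<or> i = a'" using block_unique_pair[OF a same[OF i]] by simp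
      then show False using i f by (auto simp: Zrow_def)
    qed
    show "a \<notin> Zrow d" if f: "a \<notin> Zcol d" "a' \<notin> Zcol d"
    proof
      assume "a \<in> Zrow d"
      then obtain i where i: "ent d a i \<noteq> 0" by (auto simp: Zrow_def)
      then have "i = a \<or> i = a'" using block_unique_pair[OF a same[OF i, symmetric]] by simp
      then show False using i f by (auto simp: Zcol_def)
    qed
  qed (auto simp: Zrow_def Zcol_def)
  have "OFF u"
    unfolding OFF_def
  proof (intro conjI u(1,2) allI impI)
    fix i j assume ne: "ent u i j \<noteq> 0"
    show "i \<notin> Zrow d"
      using arg_cong[OF u(5), of "\<lambda>A. ent A i j"] ne by (auto simp: G(4))
    show "j \<notin> Zcol d"
      using arg_cong[OF u(4), of "\<lambda>A. ent A i j"] ne by (auto simp: G(3))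
  qed
  then obtain v where v: "OFF v" "eqv (d + u) (d + v)" "\<And>m. monomial m v" using monomial_form by metis
  define h2 where "h2 = d + v"
  define t where "t = torus h2"
  have t0: "t j \<noteq> 0" for j by (simp add: t_def torus_nonzero)
  have tt: "unit_pair (dg t) (dg (\<lambda>i. inverse (t i)))"
    using t0 by (simp add: unit_pair_def UT_dg dg_times_dg one_eq_dg)
  define h3 where "h3 = dg t * h2 * dg (\<lambda>i. inverse (t i))"
  have h3: "ent h3 i j = t i * ent h2 i j * inverse (t j)" for i j by (simp add: h3_def)
  define D where "D = {(i, j). ent v i j \<noteq> 0}"
  have vD: "bn i < bn j \<and> i < j \<and> i < N \<and> j < N \<and> i \<notin> Zrow d \<and> j \<notin> Zcol d" if "(i, j) \<in> D" for i j
    using that OFF_D[OF v(1)] by (auto simp: D_def)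
  have mrow: "j = j'" if "(i, j) \<in> D" "(i, j') \<in> D" for i j j'
    using that monomial_row[OF v(3), of j "Suc (max j j')" j'] by (auto simp: D_def)
  have mcol: "i = i'" if "(i, j) \<in> D" "(i', j) \<in> D" for i i' j
    using that monomial_col[OF v(3), of j "Suc j"] by (auto simp: D_def)
  have rook: "rook_placement ns D"
    unfolding rook_placement_def Uniq_def
  proof (intro conjI allI impI subsetI)
    fix p assume "p \<in> D"
    then show "p \<in> roots ns" using vD by (cases p) (auto simp: roots_iff)
  qed (use mrow mcol in blast)+
  have h2_diag: "ent h2 i j = ent d i j" if "bn i = bn j" for i j
    using that OFF_D[OF v(1), of i j] by (auto simp: h2_def)
  have h2_off: "ent h2 i j = ent v i j" if "bn i < bn j" for i j
    using that same[of i j] by (auto simp: h2_def)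
  have unit_entry: "ent h3 i j = 1"
    if "i < j" "ent h2 i j \<noteq> 0" "\<And>i'. ent h2 i' j \<noteq> 0 \<Longrightarrow> i' = i" for i j
  proof -
    have "t j = ent h2 i j * t i" unfolding t_def
      by (rule torus_step[OF that(1,2)]) (rule that(3))
    then show ?thesis using t0[of i] t0[of j] by (simp add: h3 field_simps)
  qed
  \<comment> \<open>A block that meets \<open>D\<close> contains an index whose row or column is
    free of pivots, which rules out an invertible block of \<open>d\<close>.\<close>
  have single: "\<exists>x y. x \<le> y \<and> (\<forall>i j. bn i = k \<longrightarrow> bn j = k \<longrightarrow> ent d i j \<noteq> 0 \<longrightarrow> i = x \<and> j = y)"
    if ni: "\<not> isol D k" for k
  proof -
    obtain b where b: "bn b = k" "row_root D b \<or> col_root D b"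
      using ni by (auto simp: isol_def no_roots_def)
    then have "b < N" "b \<notin> Zrow d \<or> b \<notin> Zcol d" using vD by (auto simp: row_root_def col_root_def)
    moreover from this have "k < length ns" using b bn_segment by auto
    ultimately show ?thesis using single_entry_block[of k d b] dC b(1) by metis
  qed
  have "prenormal D h3"
    unfolding prenormal_def
  proof (intro conjI allI impI)
    have "UT d" by (simp add: d_def UT_dp)
    moreover have "UT v" using v(1) by (intro NIL_UT) (simp add: OFF_def)
    ultimately have "UT h2" unfolding h2_def by (rule UT_add)
    then show "UT h3" unfolding h3_def by (intro UT_times UT_dg)
    have "INS v" using v(1) by (simp add: OFF_def)
    with INSd have "INS h2" unfolding h2_def by (rule INS_add)
    then show "INS h3" by (auto simp: INS_def h3)
    show "ent h3 i j = (if (i, j) \<in> D then 1 else 0)" if ij: "bn i < bn j" for i j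
    proof (cases "(i, j) \<in> D")
      case True
      have col: "ent h2 i' j = ent v i' j" for i' using vD[OF True] by (auto simp: h2_def Zcol_def)
      have "ent h3 i j = 1"
      proof (rule unit_entry)
        show "i < j" using vD[OF True] by simp
        show "ent h2 i j \<noteq> 0" using True unfolding col by (simp add: D_def)
        fix i' assume "ent h2 i' j \<noteq> 0"
        then have "(i', j) \<in> D" unfolding col by (simp add: D_def)
        then show "i' = i" using mcol True by blast
      qed
      then show ?thesis using True by simp
    qed (use h2_off[OF ij] in \<open>auto simp: D_def h3\<close>)
    show "ent h3 i j = 0" if "bn i = bn j" "row_root D i \<or> col_root D j" for i j
    proof -
      have "i \<notin> Zrow d \<or> j \<notin> Zcol d" using that(2) vD by (auto simp: row_root_def col_root_def)
      then show ?thesis using h2_diag[OF that(1)] by (auto simp: h3 Zrow_def Zcol_def)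
    qed
    show "i = i'" "j = j'"
      if hyp: "bn i = bn j" "bn i' = bn i" "bn j' = bn i" "\<not> isol D (bn i)" "ent h3 i j \<noteq> 0" "ent h3 i' j' \<noteq> 0"
      for i j i' j'
    proof -
      have "ent d i j \<noteq> 0" "ent d i' j' \<noteq> 0"
        using hyp(5,6) h2_diag[OF hyp(1)] h2_diag[of i' j'] hyp(2,3) by (auto simp: h3)
      moreover obtain x y where "\<And>i' j'. bn i' = bn i \<Longrightarrow> bn j' = bn i \<Longrightarrow> ent d i' j' \<noteq> 0 \<Longrightarrow> i' = x \<and> j' = y"
        using single[OF hyp(4)] by blast
      ultimately show "i = i'" "j = j'" using hyp(1-3) by metis+
    qed
    show "ent h3 i j = 1" if ij: "bn i = bn j" "i \<noteq> j" "\<not> isol D (bn i)" "ent h3 i j \<noteq> 0" for i j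
    proof -
      have dij: "ent d i j \<noteq> 0" using ij(4) h2_diag[OF ij(1)] by (auto simp: h3)
      then have jZ: "j \<in> Zcol d" by (auto simp: Zcol_def)
      obtain x y where xy: "x \<le> y" "\<And>i' j'. bn i' = bn i \<Longrightarrow> bn j' = bn i \<Longrightarrow> ent d i' j' \<noteq> 0 \<Longrightarrow> i' = x \<and> j' = y"
        using single[OF ij(3)] by blast
      have eq: "i = x" "j = y" using xy(2)[OF refl ij(1)[symmetric] dij] by auto
      \<comment> \<open>\<open>j\<close> is a pivot column, so \<open>v\<close> is empty there and
        the entry of \<open>d\<close> is alone in its column.\<close>
      have col: "ent h2 i' j = ent d i' j" for i' using OFF_D[OF v(1), of i' j] jZ by (auto simp: h2_def)
      show ?thesis
      proof (rule unit_entry)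
        show "i < j" using xy(1) eq ij(2) by simp
        show "ent h2 i j \<noteq> 0" using col dij by simp
        show "i' = i" if "ent h2 i' j \<noteq> 0" for i'
        proof -
          have "ent d i' j \<noteq> 0" using that col by simp
          then show ?thesis using xy(2)[of i' j] same[of i' j] eq(1) ij(1) by simp
        qed
      qed
    qed
  qed
  moreover have "eqv (nu g) h3"
    using h1(3) u(3) v(2) eqv_conj[OF tt, of h2] unfolding h2_def[symmetric] h3_def[symmetric]
    by (meson eqv_trans)
  ultimately show thesis using that rook by blast
qed

section \<open>The Weyl group and the isolated blocks\<close>

definition pmat :: "(nat \<Rightarrow> nat) \<Rightarrow> 'a cfm" where
  "pmat w = Cfm (\<lambda>i j. if i = w j then 1 else 0)"

lemma ent_pmat: "ent (pmat w) i j = (if i = w j then 1 else 0)"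
  unfolding pmat_def by (subst ent_Cfm) auto

lemma ent_times_pmat: "ent (A * pmat w) i j = ent A i (w j)"
  by (subst ent_times_sum[where S = "{w j}"]) (auto simp: ent_pmat split: if_splits)

lemma ent_pmat_times:
  assumes "bij w" shows "ent (pmat w * A) i j = ent A (inv_into UNIV w i) j"
proof (subst ent_times_sum[where S = "{inv_into UNIV w i}"])
  show "k \<in> {inv_into UNIV w i}" if "ent (pmat w) i k \<noteq> 0" for k
    using that assms by (auto simp: ent_pmat bij_is_inj split: if_splits)
qed (use assms in \<open>auto simp: ent_pmat bij_is_surj surj_f_inv_f\<close>)

text \<open>Conjugation by a permutation matrix that preserves the blocks. It may carry the
  off-diagonal entry of a block below the diagonal; therefore \<open>prenormal\<close> admits both
  positions, as do the matrices conjugated by \<open>\<sigma>\<close> in the definition of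
  \<open>BB\<close>.\<close>

lemma prenormal_weyl:
  assumes h: "prenormal D h" and w: "w \<in> weyl ns"
  obtains h' where "prenormal (map_prod w w ` D) h'" "eqv h h'"
proof -
  note w' = weylD[OF w]
  have bij: "bij w" using permutes_bij[OF w'(1)] .
  define v where "v = inv_into UNIV w"
  have wv: "w (v i) = i" "v (w i) = i" for i
    using bij by (simp_all add: v_def bij_is_surj surj_f_inv_f bij_is_inj)
  have bv: "bn (v i) = bn i" for i using w'(2)[of "v i"] wv by simp
  have up: "unit_pair (pmat w) (pmat v)"
    unfolding unit_pair_def
  proof (intro conjI)
    show "UT (pmat w)" "UT (pmat v)" by (auto simp: UT_def ent_pmat w'(2) bv split: if_splits)
    show "pmat w * pmat v = 1" "pmat v * pmat w = 1"
      by (rule cfm_eqI, auto simp: ent_times_pmat ent_pmat ent_one wv)+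
  qed
  define h' where "h' = pmat w * h * pmat v"
  have e: "ent h' i j = ent h (v i) (v j)" for i j
    by (simp add: h'_def ent_times_pmat mult.assoc ent_pmat_times[OF bij] v_def)
  have D': "(i, j) \<in> map_prod w w ` D \<longleftrightarrow> (v i, v j) \<in> D" for i j
    by (auto simp: wv intro!: image_eqI[of _ _ "(v i, v j)"])
  have rr: "row_root (map_prod w w ` D) i \<longleftrightarrow> row_root D (v i)"
    "col_root (map_prod w w ` D) i \<longleftrightarrow> col_root D (v i)" for i
    unfolding row_root_def col_root_def D' by (metis wv)+
  have iso: "isol (map_prod w w ` D) k \<longleftrightarrow> isol D k" for k
    unfolding isol_def no_roots_def rr by (metis wv bv)
  have inj: "v i = v j \<longleftrightarrow> i = j" for i j by (metis wv)
  have vN: "v i < N \<longleftrightarrow> i < N" for i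
    using permutes_in_image[OF permutes_inv[OF w'(1)], of i] by (simp add: v_def)
  note H = prenormalD[OF h]
  have "prenormal (map_prod w w ` D) h'"
    unfolding prenormal_def e D' rr iso
  proof (intro conjI allI impI)
    show "UT h'" using UT_D[OF H(1)] bv unfolding UT_def e by metis
    show "INS h'" using INS_D[OF H(2)] vN unfolding INS_def e by metis
    show "i = i'" "j = j'"
      if "bn i = bn j" "bn i' = bn i" "bn j' = bn i" "\<not> isol D (bn i)" "ent h (v i) (v j) \<noteq> 0"
        "ent h (v i') (v j') \<noteq> 0" for i j i' j'
    proof -
      have "v i = v i' \<and> v j = v j'"
        by (rule H(5)[OF _ _ _ _ that(5,6)]) (unfold bv, (rule that(1-4))+)
      then show "i = i'" "j = j'" unfolding inj by blast+
    qed
    show "ent h (v i) (v j) = (if (v i, v j) \<in> D then 1 else 0)" if "bn i < bn j" for i j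
      by (rule H(3)) (unfold bv, rule that)
    show "ent h (v i) (v j) = 0" if "bn i = bn j" "row_root D (v i) \<or> col_root D (v j)" for i j
      by (rule H(4)[OF _ that(2)]) (unfold bv, rule that)
    show "ent h (v i) (v j) = 1"
      if "bn i = bn j" "i \<noteq> j" "\<not> isol D (bn i)" "ent h (v i) (v j) \<noteq> 0" for i j
      by (rule H(6)[OF _ _ _ that(4)]) (unfold bv inj, (rule that)+)
  qed
  moreover have "eqv h h'" unfolding h'_def by (rule eqv_conj[OF up])
  ultimately show thesis by (rule that)
qed

end

context small_blocks
begin

text \<open>The scaling by the torus and the permutation may have moved the isolated blocks out of
  \<open>C\<close>. They are conjugated back by a block-diagonal matrix that is the identity in all
  blocks meeting \<open>D\<close>, so that the roots and the other blocks are preserved.\<close>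

lemma prenormal_imp_BB:
  assumes g: "(g :: 'a mat) \<in> parabolic ns" and h: "prenormal D h" "eqv (nu g) h"
    and D: "rook_placement ns D" "D \<in> Ds"
  obtains \<rho> where "(D, \<rho>) \<in> BB ns Ds C" "eqv (nu g) (nu (g_elem ns D \<rho>))"
proof -
  have DR: "D \<subseteq> roots ns" using rook_chains(1)[OF D(1)] .
  note H = prenormalD[OF h(1)]
  define f where "f = trunc N (1 + h)"
  have f: "f \<in> parabolic ns" "nu f = h" using parabolic_of_eqv[OF g h(2) H(1,2)] by (simp_all add: f_def)
  obtain P Q where PQ: "\<And>k. k < length ns \<Longrightarrow> P k \<in> carrier_mat (ns ! k) (ns ! k) \<and> Q k \<in> carrier_mat (ns ! k) (ns ! k) \<and>
      P k * Q k = 1\<^sub>m (ns ! k) \<and> Q k * P k = 1\<^sub>m (ns ! k)"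
    and PQ1: "\<And>k. k < length ns \<Longrightarrow> k \<notin> {k. isol D k} \<Longrightarrow> P k = 1\<^sub>m (ns ! k) \<and> Q k = 1\<^sub>m (ns ! k)"
    and PQC: "\<And>k. k < length ns \<Longrightarrow> k \<in> {k. isol D k} \<Longrightarrow> ns ! k = 2 \<Longrightarrow>
      \<exists>B\<in>C. P k * (diag_block ns f k - 1\<^sub>m 2) * Q k = B - 1\<^sub>m 2"
    by (rule block_normalize[OF f(1), of "{k. isol D k}"], rule that, blast, blast, blast)
  define L where "L = emb (bdm P)"
  define R where "R = emb (bdm Q)"
  let ?x = "xD D N :: 'a cfm"
  define d where "d = dp h"
  have hd: "h = d + ?x"
  proof (rule cfm_eqI)
    fix i j
    show "ent h i j = ent (d + ?x) i j"
    proof (cases "bn i" "bn j" rule: linorder_cases)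
      case less
      then show ?thesis using H(3) by (simp add: d_def ent_dp ent_xD[OF DR])
    next
      case equal
      then have "(i, j) \<notin> D" using roots_no[OF DR] by fastforce
      then show ?thesis using equal by (simp add: d_def ent_dp ent_xD[OF DR])
    next
      case greater
      then have "(i, j) \<notin> D" "ent h i j = 0" using roots_no[OF DR, of i j] UT_D[OF H(1), of i j] by auto
      then show ?thesis using greater by (simp add: d_def ent_dp ent_xD[OF DR])
    qed
  qed
  have one: "ent (emb (bdm F)) i j = (if i = j then 1 else 0)"
    if ij: "i < N" "bn i = bn j" "F (bn i) = 1\<^sub>m (ns ! bn i)" for F :: "nat \<Rightarrow> 'a mat" and i j
  proof -
    obtain k i' j' where k: "k < length ns" "i' < ns ! k" "j' < ns ! k" "i = offset ns k + i'"
      "j = offset ns k + j'" "bn i = k" using segment_cases[OF ij(1,2)] by metis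
    have "ent (emb (bdm F)) i j = blkm (emb (bdm F)) k $$ (i', j')" using k by (simp add: blkm_def)
    also have "\<dots> = F k $$ (i', j')" using blkm_bdm[of k F] k ij(3) by simp
    finally show ?thesis using k ij(3) by simp
  qed
  have nd: "ent (emb (bdm F)) i j = 0" if "bn i \<noteq> bn j" for F :: "nat \<Rightarrow> 'a mat" and i j
    using that bdm_emb(3)[of F] by (metis ent_dp)
  \<comment> \<open>Every root lies in a row whose block is not isolated, where \<open>L\<close> is
    the identity; \<open>xR\<close> is the same for columns.\<close>
  have Lx: "L * ?x = ?x"
  proof (rule cfm_eqI)
    fix i j
    have L1: "ent L i l = (if i = l then 1 else 0)" if "ent ?x l j \<noteq> 0" for l
    proof (cases "bn i = bn l")
      case True
      have "(l, j) \<in> D" using that by (simp add: ent_xD[OF DR] split: if_splits)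
      then have "l < N" "\<not> isol D (bn i)" using roots_no[OF DR] True
        by (auto simp: isol_def no_roots_def row_root_def)
      moreover from this have "i < N" using blk_le_in[of i l] True by simp
      ultimately show ?thesis unfolding L_def using True PQ1 bn_segment(1) by (intro one) auto
    next
      case False
      then show ?thesis unfolding L_def using nd by auto
    qed
    have "ent (L * ?x) i j = (\<Sum>l\<in>{i}. ent L i l * ent ?x l j)"
      by (rule ent_times_sum) (use L1 in \<open>auto split: if_splits\<close>)
    then show "ent (L * ?x) i j = ent ?x i j" using L1[of i] by (cases "ent ?x i j = 0") auto
  qed
  have xR: "?x * R = ?x"
  proof (rule cfm_eqI)
    fix i j
    have R1: "ent R l j = (if l = j then 1 else 0)" if "ent ?x i l \<noteq> 0" for l
    proof (cases "bn l = bn j")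
      case True
      have "(i, l) \<in> D" using that by (simp add: ent_xD[OF DR] split: if_splits)
      then have "l < N" "\<not> isol D (bn l)" using roots_no[OF DR]
        by (auto simp: isol_def no_roots_def col_root_def)
      moreover from this have "Q (bn l) = 1\<^sub>m (ns ! bn l)" using PQ1 bn_segment(1)[of l] by blast
      ultimately show ?thesis unfolding R_def using True by (intro one)
    next
      case False
      then show ?thesis unfolding R_def using nd by auto
    qed
    have "ent (?x * R) i j = (\<Sum>l\<in>{j}. ent ?x i l * ent R l j)"
      by (rule ent_times_sum) (use R1 in \<open>auto split: if_splits\<close>)
    then show "ent (?x * R) i j = ent ?x i j" using R1[of j] by (cases "ent ?x i j = 0") auto
  qed
  define h' where "h' = L * h * R"
  have h': "UT h'" "INS h'" "eqv h h'" "\<And>k. k < length ns \<Longrightarrow> blkm h' k = P k * blkm h k * Q k"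
    unfolding h'_def L_def R_def using levi_block_conj[of P Q h] PQ H(1,2) by blast+
  define d' where "d' = L * d * R"
  have hd': "h' = d' + ?x" unfolding h'_def hd d'_def using Lx xR by (simp add: distrib_left distrib_right)
  have UT: "UT L" "UT R" "UT d" "dp L = L" "dp R = R" "dp d = d"
    by (simp_all add: L_def R_def d_def bdm_emb UT_dp) (rule cfm_eqI, simp add: ent_dp)
  have dpd': "dp d' = d'" unfolding d'_def using UT by (simp add: dp_times UT_times)
  have nilx: "NIL ?x" using DR by (auto simp: NIL_def ent_xD dest: roots_no split: if_splits)
  have dph': "dp (1 + h') = 1 + d'" by (simp add: hd' dp_add dp_one dpd' dp_NIL[OF nilx])
  define \<rho> where "\<rho> = trunc N (1 + d')"
  have e': "eqv (nu g) h'" using h(2) h'(3) by (rule eqv_trans)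
  have \<rho>: "\<rho> \<in> levi ns" unfolding \<rho>_def dph'[symmetric] by (rule parabolic_of_eqv(3)[OF g e' h'(1,2)])
  have INSd': "INS d'" unfolding d'_def L_def R_def d_def
    by (intro INS_times bdm_emb INS_dp H(2))
  have "emb \<rho> = pr {..<N} + d'"
    by (rule cfm_eqI) (use INSd' in \<open>auto simp: \<rho>_def ent_emb trunc_def ent_one ent_dg INS_def\<close>)
  then have nu\<rho>: "nu \<rho> = d'" using parabolicD(5)[OF levi_parabolic[OF \<rho>]] by simp
  have eqg: "eqv (nu g) (nu (g_elem ns D \<rho>))"
    using nu_g_elem(2)[OF DR \<rho>] e' by (simp add: nu\<rho> hd')
  have blk: "diag_block ns \<rho> k - 1\<^sub>m (ns ! k) = P k * blkm h k * Q k" if k: "k < length ns" for k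
  proof -
    have "diag_block ns \<rho> k - 1\<^sub>m (ns ! k) = blkm d' k"
      using blkm_nu(2)[OF levi_parabolic[OF \<rho>] k] by (simp add: nu\<rho>)
    also have "\<dots> = blkm h' k" using blkm_dp[OF k, of h'] dph' by (simp add: dp_add dp_one)
    finally show ?thesis using h'(4)[OF k] by simp
  qed
  have blk_ent: "diag_block ns \<rho> k $$ (i, j) = ent h (offset ns k + i) (offset ns k + j) + (if i = j then 1 else 0)"
    if k: "k < length ns" "\<not> isol D k" "i < ns ! k" "j < ns ! k" for k i j
  proof -
    have "P k * blkm h k * Q k = blkm h k" using PQ1[OF k(1)] k(2) by (simp add: left_mult_one_mat[OF blkm_carrier] right_mult_one_mat[OF blkm_carrier])
    then have "(diag_block ns \<rho> k - 1\<^sub>m (ns ! k)) $$ (i, j) = blkm h k $$ (i, j)" using blk[OF k(1)] by simp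
    then show ?thesis using k by (simp add: diag_block_def blkm_def diff_eq_eq split: if_splits)
  qed
  have GL: "diag_block ns \<rho> k \<in> GL (ns ! k)" if "k < length ns" for k
    using diag_block_GL[OF levi_parabolic[OF \<rho>] that] .
  have "block1_ok D (offset ns k) (diag_block ns \<rho> k)" if k: "k < length ns" "ns ! k = 1" for k
  proof (cases "isol D k")
    case True
    then show ?thesis using isol_iff[OF k(1)] GL[OF k(1)] k(2) by (auto simp: block1_ok_def no_roots_def)
  next
    case False
    then have r: "row_root D (offset ns k) \<or> col_root D (offset ns k)"
      using isol_iff[OF k(1)] k(2) by (auto simp: no_roots_def)
    then have "ent h (offset ns k) (offset ns k) = 0" using H(4) by simp
    then have "diag_block ns \<rho> k $$ (0, 0) = 1" using blk_ent[OF k(1) False, of 0 0] k(2) by simp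
    moreover have "diag_block ns \<rho> k \<in> carrier_mat 1 1" using k(2) by (simp add: diag_block_def)
    ultimately have "diag_block ns \<rho> k = 1\<^sub>m 1" by (intro eq_matI) auto
    then show ?thesis using r by (auto simp: block1_ok_def)
  qed
  moreover have "block2_ok C D (offset ns k) (diag_block ns \<rho> k)" if k: "k < length ns" "ns ! k = 2" for k
  proof (cases "isol D k")
    case True
    obtain B where B: "B \<in> C" "P k * (diag_block ns f k - 1\<^sub>m 2) * Q k = B - 1\<^sub>m 2"
      using PQC[OF k(1) _ k(2)] True by auto
    have "blkm h k = diag_block ns f k - 1\<^sub>m 2" using blkm_nu(2)[OF f(1) k(1)] f(2) k(2) by simp
    then have e: "diag_block ns \<rho> k - 1\<^sub>m 2 = B - 1\<^sub>m 2" using blk[OF k(1)] B(2) k(2) by simp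
    have c: "diag_block ns \<rho> k \<in> carrier_mat 2 2" "B \<in> carrier_mat 2 2"
      using k(2) B(1) C by (auto simp: diag_block_def is_Cl2_def representatives_def GL_def)
    have "diag_block ns \<rho> k = B"
    proof (rule eq_matI)
      fix i j assume "i < dim_row B" "j < dim_col B"
      then show "diag_block ns \<rho> k $$ (i, j) = B $$ (i, j)"
        using c arg_cong[OF e, of "\<lambda>A. A $$ (i, j)"] by simp
    qed (use c in auto)
    moreover have "no_roots D (offset ns k)" "no_roots D (offset ns k + 1)"
      using True isol_iff[OF k(1)] k(2) by auto
    ultimately show ?thesis using block2_ok_isolated B(1) by metis
  next
    case False
    let ?o = "offset ns k"
    have bo: "bn ?o = k" "bn (?o + 1) = k" using in_block[OF k(1)] k(2) by auto
    have m: "diag_block ns \<rho> k = mat2 (ent h ?o ?o + 1) (ent h ?o (?o + 1)) (ent h (?o + 1) ?o) (ent h (?o + 1) (?o + 1) + 1)"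
      by (rule mat2_eqI) (use k(2) blk_ent[OF k(1) False, of 0 0] blk_ent[OF k(1) False, of 0 1]
        blk_ent[OF k(1) False, of 1 0] blk_ent[OF k(1) False, of 1 1] in \<open>auto simp: diag_block_def\<close>)
    have det: "det2 (diag_block ns \<rho> k) \<noteq> 0" using GL[OF k(1)] k(2) GL2_det2 by metis
    have uniq: "i = i' \<and> j = j'"
      if "bn i = k" "bn j = k" "bn i' = k" "bn j' = k" "ent h i j \<noteq> 0" "ent h i' j' \<noteq> 0" for i j i' j'
      using H(5)[of i j i' j'] that False by simp
    have off: "ent h ?o (?o + 1) \<in> {0, 1}" "ent h (?o + 1) ?o \<in> {0, 1}"
      using H(6)[of ?o "?o + 1"] H(6)[of "?o + 1" ?o] bo False by auto
    have van: "row_root D i \<or> col_root D j \<Longrightarrow> ent h i j = 0" if "bn i = k" "bn j = k" for i j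
      using H(4)[of i j] that by simp
    have "listed D ?o (diag_block ns \<rho> k)"
      unfolding listed_def
    proof (intro exI conjI, rule m)
      have z: "ent h ?o ?o = 0 \<or> ent h (?o + 1) (?o + 1) = 0" "ent h ?o (?o + 1) = 0 \<or> ent h (?o + 1) ?o = 0"
        "ent h ?o (?o + 1) \<noteq> 0 \<or> ent h (?o + 1) ?o \<noteq> 0 \<Longrightarrow> ent h ?o ?o = 0 \<and> ent h (?o + 1) (?o + 1) = 0"
        using uniq[OF bo(1) bo(1) bo(2) bo(2)] uniq[OF bo(1) bo(2) bo(2) bo(1)]
          uniq[OF bo(1) bo(2) bo(1) bo(1)] uniq[OF bo(1) bo(2) bo(2) bo(2)]
          uniq[OF bo(2) bo(1) bo(1) bo(1)] uniq[OF bo(2) bo(1) bo(2) bo(2)] by auto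
      show "ent h ?o ?o + 1 \<noteq> 0" "ent h (?o + 1) (?o + 1) + 1 \<noteq> 0" using det z unfolding m by auto
      show "ent h ?o (?o + 1) = 0 \<and> ent h (?o + 1) ?o = 0 \<and> (ent h ?o ?o + 1 = 1 \<or> ent h (?o + 1) (?o + 1) + 1 = 1) \<or>
        ent h ?o ?o + 1 = 1 \<and> ent h (?o + 1) (?o + 1) + 1 = 1 \<and>
        (ent h ?o (?o + 1) = 1 \<and> ent h (?o + 1) ?o = 0 \<or> ent h ?o (?o + 1) = 0 \<and> ent h (?o + 1) ?o = 1)"
        using z off by auto
    qed (use van[OF bo(1) bo(1)] van[OF bo(1) bo(2)] van[OF bo(2) bo(1)] van[OF bo(2) bo(2)] in simp_all)
    moreover have "\<not> (no_roots D ?o \<and> no_roots D (?o + 1))" using False isol_iff[OF k(1)] k(2) by simp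
    ultimately show ?thesis using block2_ok_listed by metis
  qed
  ultimately have "(D, \<rho>) \<in> BB ns Ds C" using D(2) \<rho> by (simp add: BB_def)
  then show thesis using that eqg by blast
qed

lemma BB_exists:
  assumes rep: "representatives {D. rook_placement ns D} (weyl_equiv ns) Ds"
    and g: "(g :: 'a mat) \<in> parabolic ns"
  obtains D \<rho> where "(D, \<rho>) \<in> BB ns Ds C" "eqv (nu g) (nu (g_elem ns D \<rho>))"
proof -
  obtain D0 h0 where h0: "rook_placement ns D0" "prenormal D0 h0" "eqv (nu g) h0"
    using prenormal_exists[OF g] .
  obtain D where D: "D \<in> Ds" "weyl_equiv ns D0 D"
    using rep h0(1) unfolding representatives_def by blast
  then obtain w where w: "w \<in> weyl ns" "D = map_prod w w ` D0" unfolding weyl_equiv_def by blast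
  obtain h where h: "prenormal D h" "eqv h0 h" using prenormal_weyl[OF h0(2) w(1)] w(2) by metis
  have "rook_placement ns D" using rep D(1) by (auto simp: representatives_def)
  then show thesis using prenormal_imp_BB[OF g h(1) eqv_trans[OF h0(3) h(2)]] D(1) that by metis
qed

end

theorem theorem6p2:
  fixes ns :: "nat list"
    and Ds :: "(nat \<times> nat) set set"
    and Cl2 :: "'a :: {field, finite} mat set"
  assumes "ns \<noteq> []"
    and "\<forall>m \<in> set ns. 1 \<le> m \<and> m \<le> 2"
    and "representatives {D. rook_placement ns D} (weyl_equiv ns) Ds"
    and "is_Cl2 Cl2"
  shows "(\<forall>g \<in> parabolic ns. \<exists>(D, \<rho>) \<in> BB ns Ds Cl2. par_equiv ns g (g_elem ns D \<rho>)) \<and>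
    (\<forall>g \<in> parabolic ns. \<forall>(D, \<rho>) \<in> BB ns Ds Cl2. \<forall>(D', \<rho>') \<in> BB ns Ds Cl2.
       par_equiv ns g (g_elem ns D \<rho>) \<and> par_equiv ns g (g_elem ns D' \<rho>') \<longrightarrow>
       g_elem ns D \<rho> = g_elem ns D' \<rho>') \<and>
    parabolic ns = (\<Union>(D, \<rho>) \<in> BB ns Ds Cl2. par_class ns (g_elem ns D \<rho>)) \<and>
    disjoint_family_on (\<lambda>(D, \<rho>). par_class ns (g_elem ns D \<rho>)) (BB ns Ds Cl2)"
proof -
  interpret small_blocks ns Cl2
  proof
    fix k assume "k < length ns"
    then have "1 \<le> ns ! k \<and> ns ! k \<le> 2" using assms(2) by simp
    then show "ns ! k = 1 \<or> ns ! k = 2" by linarith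
  qed (rule assms)
  have par: "g_elem ns D \<rho> \<in> parabolic ns" if "(D, \<rho>) \<in> BB ns Ds Cl2" for D \<rho>
  proof (rule nu_g_elem(1))
    show "D \<subseteq> roots ns" "\<rho> \<in> levi ns"
      using that assms(3) by (auto simp: BB_def representatives_def rook_placement_def)
  qed
  have uniq: "D = D' \<and> \<rho> = \<rho>'"
    if "(D, \<rho>) \<in> BB ns Ds Cl2" "(D', \<rho>') \<in> BB ns Ds Cl2" "eqv (nu g) (nu (g_elem ns D \<rho>))"
      "eqv (nu g) (nu (g_elem ns D' \<rho>'))" for D \<rho> D' \<rho>' g
    by (rule BB_unique[OF assms(3) that(1,2) eqv_trans[OF eqv_sym[OF that(3)] that(4)]])
  have ex: "\<exists>D \<rho>. (D, \<rho>) \<in> BB ns Ds Cl2 \<and> eqv (nu g) (nu (g_elem ns D \<rho>))" if "g \<in> parabolic ns" for g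
    using BB_exists[OF assms(3) that] by metis
  have 1: "\<forall>g \<in> parabolic ns. \<exists>(D, \<rho>) \<in> BB ns Ds Cl2. par_equiv ns g (g_elem ns D \<rho>)"
  proof
    fix g :: "'a mat" assume g: "g \<in> parabolic ns"
    then obtain D \<rho> where B: "(D, \<rho>) \<in> BB ns Ds Cl2" "eqv (nu g) (nu (g_elem ns D \<rho>))"
      using ex by blast
    then have "par_equiv ns g (g_elem ns D \<rho>)" using par_equiv_iff[OF g par] by blast
    then show "\<exists>(D, \<rho>) \<in> BB ns Ds Cl2. par_equiv ns g (g_elem ns D \<rho>)"
      using B(1) by (intro bexI[of _ "(D, \<rho>)"]) simp_all
  qed
  have 2: "\<forall>g \<in> parabolic ns. \<forall>(D, \<rho>) \<in> BB ns Ds Cl2. \<forall>(D', \<rho>') \<in> BB ns Ds Cl2.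
       par_equiv ns g (g_elem ns D \<rho>) \<and> par_equiv ns g (g_elem ns D' \<rho>') \<longrightarrow>
       g_elem ns D \<rho> = g_elem ns D' \<rho>'"
  proof (clarify)
    fix g :: "'a mat" and D \<rho> D' \<rho>'
    assume g: "g \<in> parabolic ns" and B: "(D, \<rho>) \<in> BB ns Ds Cl2" "(D', \<rho>') \<in> BB ns Ds Cl2"
      and e: "par_equiv ns g (g_elem ns D \<rho>)" "par_equiv ns g (g_elem ns D' \<rho>')"
    then have "D = D' \<and> \<rho> = \<rho>'" using uniq[OF B] par_equiv_iff[OF g] par by blast
    then show "g_elem ns D \<rho> = g_elem ns D' \<rho>'" by simp
  qed
  have cls: "g \<in> par_class ns (g_elem ns D \<rho>) \<longleftrightarrow> g \<in> parabolic ns \<and> eqv (nu g) (nu (g_elem ns D \<rho>))"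
    if "(D, \<rho>) \<in> BB ns Ds Cl2" for g D \<rho>
  proof
    assume "g \<in> par_class ns (g_elem ns D \<rho>)"
    then have "par_equiv ns (g_elem ns D \<rho>) g" by (simp add: par_class_def)
    moreover from this have "g \<in> parabolic ns" by (simp add: par_equiv_def)
    ultimately show "g \<in> parabolic ns \<and> eqv (nu g) (nu (g_elem ns D \<rho>))"
      using par_equiv_iff[OF par[OF that]] eqv_sym by blast
  next
    assume "g \<in> parabolic ns \<and> eqv (nu g) (nu (g_elem ns D \<rho>))"
    moreover from this have "eqv (nu (g_elem ns D \<rho>)) (nu g)" using eqv_sym by blast
    ultimately show "g \<in> par_class ns (g_elem ns D \<rho>)"
      using par_equiv_iff[OF par[OF that], of g] by (simp add: par_class_def)
  qed
  have 3: "parabolic ns = (\<Union>(D, \<rho>) \<in> BB ns Ds Cl2. par_class ns (g_elem ns D \<rho>))"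
  proof (intro equalityI subsetI)
    fix g :: "'a mat" assume g: "g \<in> parabolic ns"
    then obtain D \<rho> where B: "(D, \<rho>) \<in> BB ns Ds Cl2" "eqv (nu g) (nu (g_elem ns D \<rho>))"
      using ex by blast
    then have "g \<in> par_class ns (g_elem ns D \<rho>)" using cls g by blast
    then show "g \<in> (\<Union>(D, \<rho>) \<in> BB ns Ds Cl2. par_class ns (g_elem ns D \<rho>))" using B(1) by blast
  next
    fix g :: "'a mat" assume "g \<in> (\<Union>(D, \<rho>) \<in> BB ns Ds Cl2. par_class ns (g_elem ns D \<rho>))"
    then show "g \<in> parabolic ns" using cls by blast
  qed
  have 4: "disjoint_family_on (\<lambda>(D, \<rho>). par_class ns (g_elem ns D \<rho>)) (BB ns Ds Cl2)"
    unfolding disjoint_family_on_def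
  proof (intro ballI impI)
    fix x y assume xy: "x \<in> BB ns Ds Cl2" "y \<in> BB ns Ds Cl2" "x \<noteq> y"
    obtain D \<rho> D' \<rho>' where eq: "x = (D, \<rho>)" "y = (D', \<rho>')" by (cases x, cases y)
    have B: "(D, \<rho>) \<in> BB ns Ds Cl2" "(D', \<rho>') \<in> BB ns Ds Cl2" using xy eq by auto
    \<comment> \<open>\<open>uniq\<close> identifies the pairs, not merely the matrices, so classes
      belonging to different pairs cannot meet.\<close>
    have False if "g \<in> par_class ns (g_elem ns D \<rho>)" "g \<in> par_class ns (g_elem ns D' \<rho>')" for g
      using that uniq[OF B, of g] cls[OF B(1), of g] cls[OF B(2), of g] xy(3) eq by blast
    then show "(case x of (D, \<rho>) \<Rightarrow> par_class ns (g_elem ns D \<rho>)) \<inter>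
      (case y of (D, \<rho>) \<Rightarrow> par_class ns (g_elem ns D \<rho>)) = {}"
      unfolding eq by auto
  qed
  show ?thesis using 1 2 3 4 by blast
qed

end
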